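(* Let $q\ge 2$. Assume: (i) the convex link function $m_0$ is bounded in absolute value by a constant $M_0\ge1$ on $D$ and is Lipschitz on $D$ with constant $L_0$; (ii) $\sup_{x\in\chi}|x|\le T<\infty$; (iii) $[\mathbb{E}(|\epsilon|^q)]^{1/q}<\infty$, $\mathbb{E}(\epsilon\mid X)=0$ $P_X$-a.e., and $\mathbb{E}(\epsilon^2\mid X=x)\le\sigma^2<\infty$ for all $x\in\chi$. Then, as $n\to\infty$, $$\sup_{L_0\le L\le nL_0}\ \min\left\{\frac{n^{2/5}}{L},\ \frac{n^{1/2-1/(2q)}}{\sqrt L}\right\}\,\|\check m_L\circ\check\theta_L-m_0\circ\theta_0\|=O_p\big(\sqrt{\log\log n}\big).$$
   Context: Setting: $(X_i,Y_i)$, $i=1,\dots,n$, are i.i.d. from $Y=m_0(\theta_0^\top X)+\epsilon$, with $X\in\mathbb{R}^d$ ($d$ fixed) having law $P_X$ and support $\chi$; $|\cdot|$ is the Euclidean norm; $\Theta=\{\eta\in\mathbb{R}^d:|\eta|=1,\ \eta_1\ge0\}$ and $\theta_0\in\Theta$. $D=\mathrm{conv}\{\theta^\top x:x\in\chi,\theta\in\Theta\}$. For $L>0$, $\mathcal{M}_L$ is the class of convex functions $m:D\to\mathbb{R}$ that are Lipschitz with constant $L$. For $m:D\to\mathbb{R}$ and $\theta\in\Theta$, $(m\circ\theta)(x)=m(\theta^\top x)$, $x\in\chi$. For $g:\chi\to\mathbb{R}$, $\|g\|^2=\int g^2\,dP_X$; when $g$ is random (depends on the data) the integral is over $x\sim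 P_X$ only. For each $L$, the convex Lipschitz constrained least squares estimator (CLSE) $(\check m_L,\check\theta_L)$ is any global minimizer of $Q_n(m,\theta)=\frac1n\sum_{i=1}^n\{Y_i-m(\theta^\top X_i)\}^2$ over $\mathcal{M}_L\times\Theta$, where $\check m_L$ is taken to be linearly interpolated between consecutive points of $\{\check\theta_L^\top X_i\}_{i=1}^n$ and linearly extrapolated outside them. *)

theory Defs
  imports "HOL-Probability.Probability"
begin

definition measure_support :: "'a::topological_space measure \<Rightarrow> 'a set" where
  "measure_support P = {x. \<forall>U. open U \<and> x \<in> U \<longrightarrow> emeasure P U > 0}"

text \<open>The index \<open>k\<close> names the coordinate of \<open>\<real>\<^sup>d\<close> that is called the first one.\<close>

definition index_space :: "'d::finite \<Rightarrow> (real ^ 'd) set" where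
  "index_space k = {\<eta>. norm \<eta> = 1 \<and> \<eta> $ k \<ge> 0}"

definition link_domain :: "'d::finite \<Rightarrow> (real ^ 'd) set \<Rightarrow> real set" where
  "link_domain k \<X> = convex hull {\<theta> \<bullet> x | \<theta> x. x \<in> \<X> \<and> \<theta> \<in> index_space k}"

text \<open>Functions on \<open>D\<close> are represented by functions on \<open>\<real>\<close> whose values outside \<open>D\<close> are arbitrary.\<close>

definition convex_lipschitz :: "real set \<Rightarrow> real \<Rightarrow> (real \<Rightarrow> real) set" where
  "convex_lipschitz D L = {m. convex_on D m \<and> L-lipschitz_on D m}"

definition empirical_risk ::
  "nat \<Rightarrow> (nat \<Rightarrow> real ^ 'd::finite) \<Rightarrow> (nat \<Rightarrow> real) \<Rightarrow> (real \<Rightarrow> real) \<Rightarrow> real ^ 'd \<Rightarrow> real" where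
  "empirical_risk n x y m \<theta> = (1 / real n) * (\<Sum>i<n. (y i - m (\<theta> \<bullet> x i))\<^sup>2)"

definition affine_fun_on :: "real set \<Rightarrow> (real \<Rightarrow> real) \<Rightarrow> bool" where
  "affine_fun_on S m \<longleftrightarrow> (\<exists>a b. \<forall>t\<in>S. m t = a + b * t)"

text \<open>
  Linear interpolation between consecutive points \<open>a < b\<close> of the finite set \<open>K\<close>, and linear
  extrapolation within \<open>D\<close>: the first and the last piece are prolonged to the ends of \<open>D\<close>.
  If \<open>K\<close> is a single point, there is no adjacent piece, and \<open>m\<close> is affine on all of \<open>D\<close>.
\<close>

definition linearly_interpolated :: "real set \<Rightarrow> real set \<Rightarrow> (real \<Rightarrow> real) \<Rightarrow> bool" where
  "linearly_interpolated D K m \<longleftrightarrow>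
     (\<forall>a\<in>K. \<forall>b\<in>K. a < b \<and> K \<inter> {a<..<b} = {} \<longrightarrow>
        affine_fun_on {t \<in> D. (a \<le> t \<or> a = Min K) \<and> (t \<le> b \<or> b = Max K)} m) \<and>
     (card K = 1 \<longrightarrow> affine_fun_on D m)"

definition is_CLSE ::
  "'d::finite \<Rightarrow> real set \<Rightarrow> real \<Rightarrow> nat \<Rightarrow> (nat \<Rightarrow> real ^ 'd) \<Rightarrow> (nat \<Rightarrow> real) \<Rightarrow>
     (real \<Rightarrow> real) \<Rightarrow> real ^ 'd \<Rightarrow> bool" where
  "is_CLSE k D L n x y m \<theta> \<longleftrightarrow>
     m \<in> convex_lipschitz D L \<and> \<theta> \<in> index_space k \<and>
     (\<forall>m'\<in>convex_lipschitz D L. \<forall>\<theta>'\<in>index_space k.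
        empirical_risk n x y m \<theta> \<le> empirical_risk n x y m' \<theta>') \<and>
     linearly_interpolated D ((\<lambda>i. \<theta> \<bullet> x i) ` {..<n}) m"

text \<open>
  The integral is restricted to \<open>\<X>\<close> explicitly, because the integrand is specified, and in
  particular measurable, only there.
\<close>

definition L2_norm_on :: "('a::topological_space) measure \<Rightarrow> 'a set \<Rightarrow> ('a \<Rightarrow> real) \<Rightarrow> real" where
  "L2_norm_on P \<X> g = sqrt (LINT x:\<X>|P. (g x)\<^sup>2)"

definition sigma_gen :: "'w measure \<Rightarrow> ('w \<Rightarrow> 'a::topological_space) \<Rightarrow> 'w measure" where
  "sigma_gen M X = vimage_algebra (space M) X borel"

text \<open>\<open>v x\<close> is (a version of) the conditional expectation of \<open>f\<close> given \<open>X = x\<close>.\<close>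

definition cond_exp_version ::
  "'w measure \<Rightarrow> ('w \<Rightarrow> 'a::topological_space) \<Rightarrow> ('w \<Rightarrow> real) \<Rightarrow> ('a \<Rightarrow> real) \<Rightarrow> bool" where
  "cond_exp_version M X f v \<longleftrightarrow> v \<in> borel_measurable borel \<and>
     (AE \<omega> in M. real_cond_exp M (sigma_gen M X) f \<omega> = v (X \<omega>))"

text \<open>
  Stochastic boundedness \<open>Z n = O\<^sub>p(r n)\<close>. Since \<open>Z n\<close> may be a supremum over an uncountable set of
  arbitrarily selected minimizers, it need not be measurable; the exceptional event is therefore
  covered by a measurable set of small probability (i.e. outer probability is used).
\<close>

definition bigO_p :: "'w measure \<Rightarrow> (nat \<Rightarrow> 'w \<Rightarrow> ereal) \<Rightarrow> (nat \<Rightarrow> real) \<Rightarrow> bool" where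
  "bigO_p M Z r \<longleftrightarrow>
     (\<forall>e>0. \<exists>C>0. \<forall>\<^sub>F n in sequentially.
        \<exists>A\<in>sets M. measure M A \<le> e \<and> {\<omega> \<in> space M. \<bar>Z n \<omega>\<bar> > ereal (C * r n)} \<subseteq> A)"

end

theory Submission
  imports Defs
begin

text \<open>
  Dividing by \<open>L\<close> puts \<open>g = (m \<circ> \<theta> - m\<^sub>0 \<circ> \<theta>\<^sub>0) / L\<close> into one fixed class \<open>\<G>\<close> of differences of bounded
  convex 1-Lipschitz ridge functions, so that no uniformity in \<open>L\<close> is left to prove: minimality gives
  \<open>L \<Sum> g(X\<^sub>i)\<^sup>2 \<le> 2 \<Sum> \<epsilon>\<^sub>i g(X\<^sub>i)\<close>, and the vanishing of the sum of the residuals bounds \<open>g\<close>.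
  The sup-norm entropy of \<open>\<G>\<close> at scale \<open>\<delta>\<close> is of order \<open>\<delta>\<close> to the power \<open>-1/2\<close>: the Moreau envelope is a sup-norm
  isometry from convex functions into functions with second derivative in \<open>[0, 1]\<close>, which are determined
  up to \<open>O(h\<^sup>2)\<close> by rounding their values on a grid of mesh \<open>h\<close>, and the rounded values have bounded second differences.
  Chaining with Bernstein's inequality, applied to the noise truncated at a multiple of \<open>n\<close> to the power \<open>1/q\<close> and
  to \<open>g\<^sup>2\<close>, controls both sides of the basic inequality for \<open>g\<close> of norm below a given radius; since
  \<open>\<G>\<close> is star-shaped, rescaling takes the place of peeling.
\<close>

section \<open>Bernstein's inequality\<close>

text \<open>The exponent 2/5 comes from balancing sqrt(n) * d^(3/4) against n * d^2: an entropy of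
  order u^(-1/2) makes the chaining sum at radius d of order d^(3/4). The other rate reflects that
  only \<open>q\<close> moments are available: truncation at n^(1/q) leaves a total bias and a range
  term of order n^(1/q), which n * d^2 has to dominate. The two sides of the basic inequality are
  localised at different radii. The sum of g^2 involves bounded variables only, and its radius
  n^(-2/5) enters the rate with the factor L. Beyond it, L times the squared norm is at most a
  constant times the squared noise radius, so L times the norm is of order sqrt(L) times that
  radius. Suprema over the class and selected minimizers need not be measurable. Hence chaining runs
  through finite nets inside the localised class, the exceptional events are finite unions, and what
  remains below the last scale is estimated pointwise. The weighted supremum is bounded by a
  constant with probability near one; sqrt(log log n) enters because it is eventually at least
  1.\<close>

lemma exp_le_quadratic:
  fixes x :: real
  assumes "x \<le> 1"
  shows "exp x \<le> 1 + x + x\<^sup>2"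
proof (cases "0 \<le> x")
  case True
  then show ?thesis using exp_bound assms by blast
next
  case False
  define y where "y = - x"
  have y: "0 < y" using False by (simp add: y_def)
  have e: "1 + y + y\<^sup>2 / 2 \<le> exp y"
    using exp_lower_Taylor_quadratic[of y] y by (simp add: power2_eq_square)
  have p: "0 \<le> 1 - y + y\<^sup>2"
  proof -
    have "1 - y + y\<^sup>2 = (y - 1/2)\<^sup>2 + 3/4" by (simp add: power2_eq_square algebra_simps)
    then show ?thesis by simp
  qed
  \<comment> \<open>The two quadratics are reciprocal up to nonnegative terms of higher order, so
    the Taylor lower bound for exp y becomes an upper bound for exp (-y).\<close>
  have "1 \<le> 1 + y\<^sup>2/2 + y^3/2 + y^4/2" using y by simp
  also have "\<dots> = (1 - y + y\<^sup>2) * (1 + y + y\<^sup>2/2)"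
    by (simp add: power2_eq_square power3_eq_cube power4_eq_xxxx field_simps)
  also have "\<dots> \<le> (1 - y + y\<^sup>2) * exp y" using e p by (rule mult_left_mono)
  finally have "1 / exp y \<le> 1 - y + y\<^sup>2" by (simp add: divide_le_eq)
  then show ?thesis by (simp add: y_def exp_minus inverse_eq_divide)
qed

context prob_space
begin

lemma integrable_AE_bounded:
  fixes Z :: "'a \<Rightarrow> real"
  assumes "random_variable borel Z" "AE \<omega> in M. \<bar>Z \<omega>\<bar> \<le> b"
  shows "integrable M Z"
  using assms by (intro integrable_const_bound[where B = b]) auto

lemma mgf_le:
  fixes Z :: "'a \<Rightarrow> real"
  assumes Z[measurable]: "random_variable borel Z"
    and b: "AE \<omega> in M. \<bar>Z \<omega>\<bar> \<le> b"
    and a: "expectation Z \<le> a" and v: "expectation (\<lambda>\<omega>. (Z \<omega>)\<^sup>2) \<le> v"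
    and l: "0 < l" "l * b \<le> 1"
  shows "integrable M (\<lambda>\<omega>. exp (l * Z \<omega>))"
    and "expectation (\<lambda>\<omega>. exp (l * Z \<omega>)) \<le> exp (l * a + l\<^sup>2 * v)"
proof -
  have lZ: "AE \<omega> in M. l * \<bar>Z \<omega>\<bar> \<le> 1"
    using b by eventually_elim (use l in \<open>meson mult_left_mono order_trans less_imp_le\<close>)
  have lZ': "AE \<omega> in M. l * Z \<omega> \<le> 1"
    using lZ by eventually_elim (use l in \<open>smt (verit) abs_ge_self mult_left_mono\<close>)
  show I: "integrable M (\<lambda>\<omega>. exp (l * Z \<omega>))"
    by (rule integrable_AE_bounded[where b = "exp 1"], simp) (use lZ' in auto)
  have I1: "integrable M Z" using b by (rule integrable_AE_bounded[OF Z])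
  have I2: "integrable M (\<lambda>\<omega>. (Z \<omega>)\<^sup>2)"
  proof (rule integrable_AE_bounded[where b = "b\<^sup>2"], simp)
    show "AE \<omega> in M. \<bar>(Z \<omega>)\<^sup>2\<bar> \<le> b\<^sup>2"
      using b by eventually_elim (simp add: abs_le_square_iff[symmetric])
  qed
  have "expectation (\<lambda>\<omega>. exp (l * Z \<omega>)) \<le> expectation (\<lambda>\<omega>. 1 + l * Z \<omega> + l\<^sup>2 * (Z \<omega>)\<^sup>2)"
  proof (rule integral_mono_AE[OF I])
    show "integrable M (\<lambda>\<omega>. 1 + l * Z \<omega> + l\<^sup>2 * (Z \<omega>)\<^sup>2)" using I1 I2 by auto
    show "AE \<omega> in M. exp (l * Z \<omega>) \<le> 1 + l * Z \<omega> + l\<^sup>2 * (Z \<omega>)\<^sup>2"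
      using lZ' by eventually_elim (metis exp_le_quadratic power_mult_distrib)
  qed
  also have "\<dots> = 1 + l * expectation Z + l\<^sup>2 * expectation (\<lambda>\<omega>. (Z \<omega>)\<^sup>2)"
    using I1 I2 by (simp add: prob_space)
  also have "\<dots> \<le> 1 + (l * a + l\<^sup>2 * v)"
    using add_mono[OF mult_left_mono[OF a, of l] mult_left_mono[OF v, of "l\<^sup>2"]] l by simp
  also have "\<dots> \<le> exp (l * a + l\<^sup>2 * v)" by (rule exp_ge_add_one_self)
  finally show "expectation (\<lambda>\<omega>. exp (l * Z \<omega>)) \<le> exp (l * a + l\<^sup>2 * v)" .
qed

text \<open>Chernoff's method with the parameter \<open>l\<close> left free. The means are only
  bounded above by \<open>a\<close>, because truncated noise is not centred; this shifts the
  threshold by n * a.\<close>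

lemma bernstein_exp:
  fixes Z :: "nat \<Rightarrow> 'a \<Rightarrow> real"
  assumes ind: "indep_vars (\<lambda>_. borel) Z {..<n}"
    and b: "\<And>i. i < n \<Longrightarrow> AE \<omega> in M. \<bar>Z i \<omega>\<bar> \<le> b"
    and a: "\<And>i. i < n \<Longrightarrow> expectation (Z i) \<le> a"
    and v: "\<And>i. i < n \<Longrightarrow> expectation (\<lambda>\<omega>. (Z i \<omega>)\<^sup>2) \<le> v"
    and l: "0 < l" "l * b \<le> 1"
  shows "prob {\<omega> \<in> space M. (\<Sum>i<n. Z i \<omega>) > real n * a + real n * l * v + h / l} \<le> exp (- h)"
proof -
  have Z[measurable]: "random_variable borel (Z i)" if "i < n" for i
    using ind that by (auto simp: indep_vars_def)
  have ind': "indep_vars (\<lambda>_. borel) (\<lambda>i \<omega>. exp (l * Z i \<omega>)) {..<n}"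
    using indep_vars_compose2[OF ind, of "\<lambda>_ x. exp (l * x)" "\<lambda>_. borel"] by simp
  have int: "integrable M (\<lambda>\<omega>. exp (l * Z i \<omega>))" if "i < n" for i
    using mgf_le(1)[OF Z[OF that] b[OF that] a[OF that] v[OF that] l] .
  define t where "t = real n * a + real n * l * v + h / l"
  let ?P = "\<lambda>\<omega>. \<Prod>i<n. exp (l * Z i \<omega>)"
  have P: "?P \<omega> = exp (l * (\<Sum>i<n. Z i \<omega>))" for \<omega>
    by (simp add: exp_sum sum_distrib_left)
  have "integrable M ?P"
    by (rule indep_vars_integrable[OF _ ind']) (auto intro: int)
  moreover have "expectation ?P = (\<Prod>i<n. expectation (\<lambda>\<omega>. exp (l * Z i \<omega>)))"
    by (rule indep_vars_lebesgue_integral[OF _ ind']) (auto intro: int)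
  moreover have "\<dots> \<le> (\<Prod>i<n. exp (l * a + l\<^sup>2 * v))"
    using mgf_le(2)[OF Z b a v l] by (intro prod_mono) auto
  moreover have "(\<Prod>i<n. exp (l * a + l\<^sup>2 * v)) = exp (real n * (l * a + l\<^sup>2 * v))"
    by (simp add: exp_of_nat_mult[symmetric])
  ultimately have E: "integrable M ?P" "expectation ?P \<le> exp (real n * (l * a + l\<^sup>2 * v))"
    by auto
  have [measurable]: "random_variable borel (\<lambda>\<omega>. \<Sum>i<n. Z i \<omega>)"
    using Z by (intro borel_measurable_sum) auto
  have "prob {\<omega> \<in> space M. (\<Sum>i<n. Z i \<omega>) > t} \<le> prob {\<omega> \<in> space M. ?P \<omega> \<ge> exp (l * t)}"
    using l E(1) by (intro finite_measure_mono) (auto simp: P)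
  also have "\<dots> \<le> expectation ?P / exp (l * t)"
    by (intro integral_Markov_inequality_measure[where A = "{}"] E(1)) (auto intro!: AE_I2 prod_nonneg)
  also have "\<dots> \<le> exp (real n * (l * a + l\<^sup>2 * v)) / exp (l * t)"
    using E(2) by (simp add: divide_right_mono)
  also have "\<dots> = exp (- h)"
    using l by (simp add: t_def exp_diff[symmetric] algebra_simps power2_eq_square)
  finally show ?thesis by (simp add: t_def)
qed

lemma bernstein:
  fixes Z :: "nat \<Rightarrow> 'a \<Rightarrow> real"
  assumes ind: "indep_vars (\<lambda>_. borel) Z {..<n}" and n: "0 < n"
    and b: "\<And>i. i < n \<Longrightarrow> AE \<omega> in M. \<bar>Z i \<omega>\<bar> \<le> b"
    and a: "\<And>i. i < n \<Longrightarrow> expectation (Z i) \<le> a"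
    and v: "\<And>i. i < n \<Longrightarrow> expectation (\<lambda>\<omega>. (Z i \<omega>)\<^sup>2) \<le> v"
    and pos: "0 < b" "0 < v" "0 < h"
  shows "prob {\<omega> \<in> space M. (\<Sum>i<n. Z i \<omega>) > real n * a + 2 * sqrt (real n * v * h) + h * b} \<le> exp (- h)"
proof -
  \<comment> \<open>\<open>l0\<close> minimises n * l * v + h / l and makes both terms equal to sqrt
    (n * v * h). The cap 1 / b enforces \<open>l * b \<le> 1\<close> and adds at most h * b.\<close>
  define l0 where "l0 = sqrt (h / (real n * v))"
  define l where "l = min (1 / b) l0"
  have l0: "0 < l0" using pos n by (simp add: l0_def)
  have l: "0 < l" "l * b \<le> 1" using pos l0 by (auto simp: l_def min_def field_simps)
  have e1: "real n * l0 * v = sqrt (real n * v * h)"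
    using pos n by (simp add: l0_def real_sqrt_divide real_sqrt_mult field_simps)
  have e2: "h / l0 = sqrt (real n * v * h)"
    using pos n by (simp add: l0_def real_sqrt_divide real_sqrt_mult field_simps)
  have "real n * l * v \<le> real n * l0 * v"
    using pos by (intro mult_right_mono mult_left_mono) (auto simp: l_def)
  moreover have "h / l \<le> h * b + h / l0"
    using pos l0 by (auto simp: l_def min_def field_simps)
  ultimately have le: "real n * a + real n * l * v + h / l \<le> real n * a + 2 * sqrt (real n * v * h) + h * b"
    using e1 e2 by simp
  have Z[measurable]: "random_variable borel (Z i)" if "i < n" for i
    using ind that by (auto simp: indep_vars_def)
  have [measurable]: "random_variable borel (\<lambda>\<omega>. \<Sum>i<n. Z i \<omega>)"
    using Z by (intro borel_measurable_sum) auto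
  have "prob {\<omega> \<in> space M. (\<Sum>i<n. Z i \<omega>) > real n * a + 2 * sqrt (real n * v * h) + h * b}
      \<le> prob {\<omega> \<in> space M. (\<Sum>i<n. Z i \<omega>) > real n * a + real n * l * v + h / l}"
    using le by (intro finite_measure_mono) auto
  also have "\<dots> \<le> exp (- h)" by (rule bernstein_exp[OF ind b a v l])
  finally show ?thesis .
qed

end

section \<open>Chaining\<close>

definition sup_close :: "'x set \<Rightarrow> real \<Rightarrow> ('x \<Rightarrow> real) \<Rightarrow> ('x \<Rightarrow> real) \<Rightarrow> bool" where
  "sup_close \<X> c u v \<longleftrightarrow> (\<forall>x\<in>\<X>. \<bar>u x - v x\<bar> \<le> c)"

lemma sum_power_tail_le:
  fixes x :: real
  assumes "0 \<le> x" "x \<le> 1/2"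
  shows "(\<Sum>j\<in>{k..<J}. x ^ j) \<le> 2 * x ^ k"
proof (cases "k \<le> J")
  case True
  then have "(\<Sum>j\<in>{k..<J}. x ^ j) \<le> 2 * x ^ k - 2 * x ^ J"
  proof (induction J rule: dec_induct)
    case (step J)
    have "(\<Sum>j\<in>{k..<Suc J}. x ^ j) = (\<Sum>j\<in>{k..<J}. x ^ j) + x ^ J"
      using step by simp
    moreover have "2 * (x * x ^ J) \<le> x ^ J"
      using mult_right_mono[of "2 * x" 1 "x ^ J"] assms by simp
    ultimately show ?case using step by simp
  qed simp
  also have "\<dots> \<le> 2 * x ^ k" using assms by simp
  finally show ?thesis .
qed (use assms in simp)

text \<open>A discrete Dudley integral: \<open>d\<close> is the localisation radius, the first
  factor bounds the standard deviation of a link at scale j, and sqrt 2 ^ j is the root of the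
  entropy. The terms grow geometrically below \<open>k\<close> and decay above it, so the scale
  \<open>k\<close> dominates, and sqrt 2 ^ k / 4 ^ k equals d^(3/4).\<close>

lemma sum_scales_le:
  fixes C d :: real
  assumes "0 \<le> C" "d = 1 / 4 ^ k"
  shows "(\<Sum>j<J. (if j < k then d else C / 4 ^ j) * sqrt 2 ^ j) \<le> (3 + 2 * C) * (sqrt 2 ^ k / 4 ^ k)"
proof -
  have r: "sqrt 2 \<ge> (1::real)" "sqrt 2 * 3 \<ge> (4::real)" "sqrt 2 \<le> (2::real)"
    using real_le_rsqrt[of "4/3" 2] by (auto intro: real_le_lsqrt simp: power2_eq_square)
  have 1: "(\<Sum>j<k. sqrt 2 ^ j) \<le> 3 * sqrt 2 ^ k"
  proof (induction k)
    case (Suc k)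
    have "4 * sqrt 2 ^ k \<le> 3 * (sqrt 2 * sqrt 2 ^ k)"
      using mult_right_mono[of 4 "sqrt 2 * 3" "sqrt 2 ^ k"] r by (simp add: mult_ac)
    moreover have "(\<Sum>j<Suc k. sqrt 2 ^ j) = (\<Sum>j<k. sqrt 2 ^ j) + sqrt 2 ^ k" by simp
    ultimately show ?case using Suc unfolding power_Suc by linarith
  qed simp
  have 2: "(\<Sum>j\<in>{k..<J}. (sqrt 2 / 4) ^ j) \<le> 2 * (sqrt 2 / 4) ^ k"
    using r by (intro sum_power_tail_le) auto
  have "(\<Sum>j<J. (if j < k then d else C / 4 ^ j) * sqrt 2 ^ j)
      = (\<Sum>j\<in>{..<J} \<inter> {..<k}. d * sqrt 2 ^ j) + (\<Sum>j\<in>{..<J} - {..<k}. C / 4 ^ j * sqrt 2 ^ j)"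
    by (subst sum.Int_Diff[of _ _ "{..<k}"]) (auto intro!: arg_cong2[where f = "(+)"] sum.cong)
  also have "{..<J} - {..<k} = {k..<J}" by auto
  also have "(\<Sum>j\<in>{..<J} \<inter> {..<k}. d * sqrt 2 ^ j) \<le> (\<Sum>j<k. d * sqrt 2 ^ j)"
    using assms by (intro sum_mono2) auto
  also have "(\<Sum>j<k. d * sqrt 2 ^ j) = d * (\<Sum>j<k. sqrt 2 ^ j)" by (simp add: sum_distrib_left)
  also have "\<dots> \<le> d * (3 * sqrt 2 ^ k)" using 1 assms by (intro mult_left_mono) auto
  also have "(\<Sum>j\<in>{k..<J}. C / 4 ^ j * sqrt 2 ^ j) = C * (\<Sum>j\<in>{k..<J}. (sqrt 2 / 4) ^ j)"
    by (simp add: sum_distrib_left power_divide)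
  also have "\<dots> \<le> C * (2 * (sqrt 2 / 4) ^ k)" using 2 assms by (intro mult_left_mono) auto
  finally show ?thesis using assms by (simp add: power_divide algebra_simps add_divide_distrib)
qed

context prob_space
begin

text \<open>Each pair of neighbours in consecutive nets is controlled by Bernstein's inequality, and
  a union bound over the finitely many pairs gives a measurable exceptional event. For each g only a
  nearby \<open>u\<close> in \<open>S\<close> is bounded, so no supremum over \<open>S\<close> has
  to be measurable; the step from \<open>u\<close> to g is left to the caller. \<open>var'\<close>
  carries the localisation: links between coarse scales have a standard deviation governed by the
  radius 4^-k of \<open>S\<close> and not by their sup distance.\<close>

lemma chaining_bound:
  fixes Z :: "('x \<Rightarrow> real) \<Rightarrow> nat \<Rightarrow> 'a \<Rightarrow> real" and S :: "('x \<Rightarrow> real) set"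
  assumes u0: "u0 \<in> S" "\<And>g. g \<in> S \<Longrightarrow> sup_close \<X> C g u0"
    and nets: "\<And>j. \<exists>N\<subseteq>S. finite N \<and> real (card N) \<le> exp (A * 2 ^ j) \<and> (\<forall>g\<in>S. \<exists>u\<in>N. sup_close \<X> (C / 4 ^ j) g u)"
    and ind: "\<And>u v. u \<in> S \<Longrightarrow> v \<in> S \<Longrightarrow> indep_vars (\<lambda>_. borel) (\<lambda>i \<omega>. Z u i \<omega> - Z v i \<omega>) {..<n}"
    and bound: "\<And>u v c i. u \<in> S \<Longrightarrow> v \<in> S \<Longrightarrow> sup_close \<X> c u v \<Longrightarrow> 0 < c \<Longrightarrow> i < n \<Longrightarrow>
      AE \<omega> in M. \<bar>Z u i \<omega> - Z v i \<omega>\<bar> \<le> b * c"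
    and mean: "\<And>u v c i. u \<in> S \<Longrightarrow> v \<in> S \<Longrightarrow> sup_close \<X> c u v \<Longrightarrow> 0 < c \<Longrightarrow> i < n \<Longrightarrow>
      expectation (\<lambda>\<omega>. Z u i \<omega> - Z v i \<omega>) \<le> a * c"
    and var: "\<And>u v c i. u \<in> S \<Longrightarrow> v \<in> S \<Longrightarrow> sup_close \<X> c u v \<Longrightarrow> 0 < c \<Longrightarrow> i < n \<Longrightarrow>
      expectation (\<lambda>\<omega>. (Z u i \<omega> - Z v i \<omega>)\<^sup>2) \<le> (s * c)\<^sup>2"
    and var': "\<And>u v i. u \<in> S \<Longrightarrow> v \<in> S \<Longrightarrow> i < n \<Longrightarrow>
      expectation (\<lambda>\<omega>. (Z u i \<omega> - Z v i \<omega>)\<^sup>2) \<le> (s / 4 ^ k)\<^sup>2"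
    and pos: "0 \<le> A" "0 < C" "0 < b" "0 \<le> a" "0 < s" "0 < n" "1 \<le> \<tau>"
  shows "\<exists>E\<in>events. prob E \<le> 2 * exp (- \<tau>) \<and>
    (\<forall>\<omega>\<in>space M - E. \<forall>g\<in>S. \<exists>u\<in>S. sup_close \<X> (C / 4 ^ J) g u \<and>
      (\<Sum>i<n. Z u i \<omega> - Z u0 i \<omega>) \<le> 2 * real n * a * C
        + 2 * s * sqrt (real n * (3 * A + \<tau>)) * ((3 + 2 * C) * (sqrt 2 ^ k / 4 ^ k))
        + 2 * C * b * (3 * A + \<tau>))"
proof -
  \<comment> \<open>At scale 0 the single point \<open>u0\<close> is a net, because \<open>C\<close>
    bounds its distance to all of \<open>S\<close>. Every chain therefore starts at
    \<open>u0\<close>.\<close>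
  have "\<exists>N. N \<subseteq> S \<and> finite N \<and> real (card N) \<le> exp (A * 2 ^ j) \<and> (\<forall>g\<in>S. \<exists>u\<in>N. sup_close \<X> (C / 4 ^ j) g u)
      \<and> (j = 0 \<longrightarrow> N = {u0})" for j
  proof (cases "j = 0")
    case True
    have "1 \<le> exp A" using pos by simp
    then show ?thesis using u0 pos True by (intro exI[of _ "{u0}"]) auto
  qed (use nets[of j] in auto)
  then obtain N where N: "\<And>j. N j \<subseteq> S" "\<And>j. finite (N j)" "\<And>j. real (card (N j)) \<le> exp (A * 2 ^ j)"
    "\<And>j g. g \<in> S \<Longrightarrow> \<exists>u\<in>N j. sup_close \<X> (C / 4 ^ j) g u" "N 0 = {u0}"
    by metis
  \<comment> \<open>There are at most exp (A * 2^(j+1) + A * 2^j) = exp (3 * A * 2^j) pairs at scale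
    j. The tail exponent \<kappa> * 2^j pays for them and leaves exp (- \<tau> * 2^j), which is
    summable over j.\<close>
  define \<kappa> where "\<kappa> = 3 * A + \<tau>"
  have \<kappa>: "\<kappa> > 0" using pos by (simp add: \<kappa>_def)
  \<comment> \<open>Below \<open>k\<close> the radius of \<open>S\<close> is used for the standard
    deviation, from \<open>k\<close> on the sup distance of the link.\<close>
  define w where "w j = (if j < k then 1 / 4 ^ k else C / 4 ^ j)" for j
  have w: "w j > 0" for j using pos by (simp add: w_def)
  define t where "t j = real n * (a * (C / 4 ^ j)) + 2 * sqrt (real n * (s * w j)\<^sup>2 * (\<kappa> * 2 ^ j)) + (\<kappa> * 2 ^ j) * (b * (C / 4 ^ j))" for j
  define B where "B j u v = {\<omega>\<in>space M. (\<Sum>i<n. Z u i \<omega> - Z v i \<omega>) > t j}" for j u v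
  define Lk where "Lk j = {p \<in> N (Suc j) \<times> N j. sup_close \<X> (C / 4 ^ j) (fst p) (snd p)}" for j
  define E where "E = (\<Union>j<J. \<Union>p\<in>Lk j. B j (fst p) (snd p))"
  have Bev: "B j u v \<in> events" if "u \<in> S" "v \<in> S" for j u v
  proof -
    have "random_variable borel (\<lambda>\<omega>. Z u i \<omega> - Z v i \<omega>)" if "i < n" for i
      using ind[OF \<open>u \<in> S\<close> \<open>v \<in> S\<close>] that by (auto simp: indep_vars_def)
    then have [measurable]: "random_variable borel (\<lambda>\<omega>. \<Sum>i<n. Z u i \<omega> - Z v i \<omega>)"
      by (intro borel_measurable_sum) auto
    show ?thesis unfolding B_def by measurable
  qed
  have Bp: "prob (B j u v) \<le> exp (- (\<kappa> * 2 ^ j))" if uv: "u \<in> S" "v \<in> S" "sup_close \<X> (C / 4 ^ j) u v" for j u v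
    unfolding B_def t_def
  proof (rule bernstein[OF ind[OF uv(1,2)]])
    fix i assume i: "i < n"
    show "expectation (\<lambda>\<omega>. (Z u i \<omega> - Z v i \<omega>)\<^sup>2) \<le> (s * w j)\<^sup>2"
      using var[OF uv _ i] var'[OF uv(1,2) i] pos by (auto simp: w_def)
  qed (use bound[OF uv] mean[OF uv] pos w[of j] \<kappa> in auto)
  have LS: "fst p \<in> S" "snd p \<in> S" "sup_close \<X> (C / 4 ^ j) (fst p) (snd p)" if "p \<in> Lk j" for p j
    using that N(1)[THEN subsetD] by (auto simp: Lk_def)
  have Lfin: "finite (Lk j)" for j using N(2) by (simp add: Lk_def)
  have Lcard: "real (card (Lk j)) \<le> exp (A * 2 ^ Suc j) * exp (A * 2 ^ j)" for j
  proof -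
    have "card (Lk j) \<le> card (N (Suc j) \<times> N j)"
      by (rule card_mono) (auto simp: N(2) Lk_def)
    then have "real (card (Lk j)) \<le> real (card (N (Suc j))) * real (card (N j))"
      by (metis card_cartesian_product of_nat_le_iff of_nat_mult)
    also have "\<dots> \<le> exp (A * 2 ^ Suc j) * exp (A * 2 ^ j)"
      using N(3)[of "Suc j"] N(3)[of j] by (intro mult_mono) (simp_all del: power_Suc)
    finally show ?thesis .
  qed
  have Eev: "E \<in> events" unfolding E_def using Lfin LS Bev by (intro sets.finite_UN) auto
  have "prob E \<le> (\<Sum>j<J. prob (\<Union>p\<in>Lk j. B j (fst p) (snd p)))"
    unfolding E_def using Lfin LS Bev by (intro finite_measure_subadditive_finite) (auto intro!: sets.finite_UN)
  also have "\<dots> \<le> (\<Sum>j<J. exp (- \<tau>) ^ (Suc j))"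
  proof (rule sum_mono)
    fix j
    have "prob (\<Union>p\<in>Lk j. B j (fst p) (snd p)) \<le> (\<Sum>p\<in>Lk j. prob (B j (fst p) (snd p)))"
      using Lfin LS Bev by (intro finite_measure_subadditive_finite) auto
    also have "\<dots> \<le> (\<Sum>p\<in>Lk j. exp (- (\<kappa> * 2 ^ j)))"
      using LS Bp by (intro sum_mono) auto
    also have "\<dots> = real (card (Lk j)) * exp (- (\<kappa> * 2 ^ j))" by simp
    also have "\<dots> \<le> (exp (A * 2 ^ Suc j) * exp (A * 2 ^ j)) * exp (- (\<kappa> * 2 ^ j))"
      using Lcard by (intro mult_right_mono) auto
    also have "\<dots> = exp (- (\<tau> * 2 ^ j))"
      by (simp add: exp_add[symmetric] \<kappa>_def algebra_simps)
    also have "\<dots> \<le> exp (- (\<tau> * real (Suc j)))"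
    proof -
      have "real (Suc j) \<le> 2 ^ j"
        by (metis Suc_leI less_exp of_nat_le_iff of_nat_numeral of_nat_power)
      then show ?thesis using pos by simp
    qed
    also have "\<dots> = exp (- \<tau>) ^ (Suc j)"
      by (subst exp_of_nat_mult[symmetric]) (simp add: algebra_simps)
    finally show "prob (\<Union>p\<in>Lk j. B j (fst p) (snd p)) \<le> exp (- \<tau>) ^ (Suc j)" .
  qed
  also have "\<dots> = exp (- \<tau>) * (\<Sum>j\<in>{0..<J}. exp (- \<tau>) ^ j)"
    by (simp add: sum_distrib_left lessThan_atLeast0)
  also have "\<dots> \<le> exp (- \<tau>) * (2 * exp (- \<tau>) ^ 0)"
  proof (intro mult_left_mono sum_power_tail_le)
    have "2 \<le> exp (1::real)" using exp_ge_add_one_self[of 1] by simp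
    also have "\<dots> \<le> exp \<tau>" using pos by simp
    finally show "exp (- \<tau>) \<le> 1/2" by (simp add: exp_minus field_simps)
  qed auto
  finally have Ep: "prob E \<le> 2 * exp (- \<tau>)" by simp
  have chain: "(\<Sum>i<n. Z u i \<omega> - Z u0 i \<omega>) \<le> (\<Sum>j<l. t j)"
    if "\<omega> \<in> space M - E" "l \<le> J" "u \<in> N l" for \<omega> l u
    using that(2,3)
  proof (induction l arbitrary: u)
    case 0
    then show ?case using N(5) by simp
  next
    case (Suc l)
    have uS: "u \<in> S" using Suc N(1) by blast
    obtain v where v: "v \<in> N l" "sup_close \<X> (C / 4 ^ l) u v" using N(4)[OF uS] by blast
    have "(u, v) \<in> Lk l" using v Suc by (simp add: Lk_def)
    then have "\<omega> \<notin> B l u v" using that(1) Suc.prems by (force simp: E_def)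
    then have "(\<Sum>i<n. Z u i \<omega> - Z v i \<omega>) \<le> t l" using that by (simp add: B_def)
    moreover have "(\<Sum>i<n. Z v i \<omega> - Z u0 i \<omega>) \<le> (\<Sum>j<l. t j)" using Suc v by simp
    ultimately show ?case by (simp add: sum_subtractf)
  qed
  have tsum: "(\<Sum>j<J. t j) \<le> 2 * real n * a * C
        + 2 * s * sqrt (real n * \<kappa>) * ((3 + 2 * C) * (sqrt 2 ^ k / 4 ^ k)) + 2 * C * b * \<kappa>"
  proof -
    have sq: "sqrt (real n * (s * w j)\<^sup>2 * (\<kappa> * 2 ^ j)) = s * sqrt (real n * \<kappa>) * (w j * sqrt 2 ^ j)" for j
    proof -
      have "sqrt (real n * (s * w j)\<^sup>2 * (\<kappa> * 2 ^ j)) = sqrt (real n * \<kappa>) * sqrt ((s * w j)\<^sup>2) * sqrt (2 ^ j)"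
        by (simp only: real_sqrt_mult[symmetric] mult_ac)
      then show ?thesis using pos w[of j] by (simp only: real_sqrt_abs real_sqrt_power) simp
    qed
    \<comment> \<open>The exponents grow like 2^j while the links shrink like 4^-j, so the range
      terms still form a geometric series, of ratio 1/2.\<close>
    have fr: "(\<kappa> * 2 ^ j) * (b * (C / 4 ^ j)) = (\<kappa> * b * C) * (1/2) ^ j" for j :: nat
    proof -
      have "(4::real) ^ j = 2 ^ j * 2 ^ j" by (simp flip: power_mult_distrib)
      then show ?thesis by (simp add: power_divide)
    qed
    have "(\<Sum>j<J. t j) = (real n * a * C) * (\<Sum>j\<in>{0..<J}. (1/4) ^ j)
        + 2 * s * sqrt (real n * \<kappa>) * (\<Sum>j<J. w j * sqrt 2 ^ j) + (\<kappa> * b * C) * (\<Sum>j\<in>{0..<J}. (1/2) ^ j)"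
      unfolding t_def sq fr by (simp add: sum.distrib sum_distrib_left power_divide lessThan_atLeast0 mult.assoc)
    also have "\<dots> \<le> (real n * a * C) * (2 * (1/4) ^ 0)
        + 2 * s * sqrt (real n * \<kappa>) * ((3 + 2 * C) * (sqrt 2 ^ k / 4 ^ k)) + (\<kappa> * b * C) * (2 * (1/2) ^ 0)"
      unfolding w_def using pos \<kappa>
      by (intro add_mono mult_left_mono sum_power_tail_le sum_scales_le) auto
    finally show ?thesis by (simp add: mult_ac)
  qed
  show ?thesis
  proof (intro bexI[OF _ Eev] conjI Ep ballI)
    fix \<omega> g assume \<omega>: "\<omega> \<in> space M - E" and g: "g \<in> S"
    obtain u where u: "u \<in> N J" "sup_close \<X> (C / 4 ^ J) g u" using N(4)[OF g] by blast
    show "\<exists>u\<in>S. sup_close \<X> (C / 4 ^ J) g u \<and>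
      (\<Sum>i<n. Z u i \<omega> - Z u0 i \<omega>) \<le> 2 * real n * a * C
        + 2 * s * sqrt (real n * (3 * A + \<tau>)) * ((3 + 2 * C) * (sqrt 2 ^ k / 4 ^ k))
        + 2 * C * b * (3 * A + \<tau>)"
      using chain[OF \<omega> order_refl u(1)] tsum u N(1)[of J] unfolding \<kappa>_def by (intro bexI[of _ u]) auto
  qed
qed

end

section \<open>The Moreau envelope and the entropy of convex Lipschitz functions\<close>

text \<open>The left derivative serves as \<open>s\<close>: it is the supremum of the slopes to the
  left of \<open>t\<close>, and by convexity every slope to the right is at least as large. The
  Lipschitz condition keeps all slopes in [-1, 1], also at the ends of \<open>D\<close>.\<close>

lemma subgradient_exists:
  fixes m :: "real \<Rightarrow> real"
  assumes cv: "convex_on D m" and lip: "1-lipschitz_on D m" and t: "t \<in> D"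
  shows "\<exists>s. \<bar>s\<bar> \<le> 1 \<and> (\<forall>x\<in>D. m t + s * (x - t) \<le> m x)"
proof -
  define Q where "Q x = (m t - m x) / (t - x)" for x
  have Qb: "\<bar>Q x\<bar> \<le> 1" if "x \<in> D" "x \<noteq> t" for x
  proof -
    have "\<bar>m t - m x\<bar> \<le> \<bar>t - x\<bar>"
      using lipschitz_onD[OF lip t that(1)] by (simp add: dist_real_def)
    then show ?thesis using that by (simp add: Q_def abs_divide divide_le_eq)
  qed
  \<comment> \<open>The inserted -1 keeps the set nonempty when \<open>t\<close> is the left end of
    \<open>D\<close>, and it is a lower bound for every slope.\<close>
  define s where "s = Sup (insert (-1) (Q ` {x\<in>D. x < t}))"
  have bdd: "bdd_above (insert (-1) (Q ` {x\<in>D. x < t}))"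
    using Qb by (intro bdd_aboveI[of _ 1]) fastforce
  have s1: "- 1 \<le> s" unfolding s_def using bdd by (intro cSup_upper) auto
  have s2: "s \<le> 1" unfolding s_def using Qb by (intro cSup_least) fastforce+
  show ?thesis
  proof (intro exI[of _ s] conjI ballI)
    show "\<bar>s\<bar> \<le> 1" using s1 s2 by simp
    fix x assume x: "x \<in> D"
    consider "x = t" | "x < t" | "t < x" by linarith
    then show "m t + s * (x - t) \<le> m x"
    proof cases
      case 2
      have "Q x \<le> s" unfolding s_def using bdd x 2 by (intro cSup_upper) auto
      then have "Q x * (t - x) \<le> s * (t - x)" using 2 by (intro mult_right_mono) auto
      moreover have "Q x * (t - x) = m t - m x" using 2 by (simp add: Q_def)
      ultimately show ?thesis by (simp add: algebra_simps)
    next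
      case 3
      have "s \<le> Q x"
        unfolding s_def
      proof (intro cSup_least, simp)
        fix y assume "y \<in> insert (-1) (Q ` {x\<in>D. x < t})"
        then consider "y = -1" | z where "z \<in> D" "z < t" "y = Q z" by auto
        then show "y \<le> Q x"
        proof cases
          case 1
          then show ?thesis using Qb[OF x] 3 by auto
        next
          case 2
          have "(m z - m t) / (z - t) \<le> (m t - m x) / (t - x)"
            using convex_on_slope_le[OF cv 2(1) x 2(2) 3] by linarith
          moreover have "(m z - m t) / (z - t) = (m t - m z) / (t - z)"
            by (metis minus_diff_eq minus_divide_divide)
          ultimately show ?thesis using 2 by (simp add: Q_def)
        qed
      qed
      then have "s * (x - t) \<le> Q x * (x - t)" using 3 by (intro mult_right_mono) auto
      moreover have "Q x * (x - t) = m x - m t" using 3 by (simp add: Q_def field_simps)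
      ultimately show ?thesis by simp
    qed simp
  qed
qed

text \<open>The inf-convolution of \<open>m\<close> with half the square. It is defined on the whole
  line although \<open>m\<close> is given only on \<open>D\<close>, so grid points outside
  \<open>D\<close> cause no boundary cases.\<close>

definition moreau :: "real set \<Rightarrow> (real \<Rightarrow> real) \<Rightarrow> real \<Rightarrow> real" where
  "moreau D m u = (INF t\<in>D. m t + (u - t)\<^sup>2 / 2)"

context
  fixes D :: "real set" and m :: "real \<Rightarrow> real"
  assumes D: "compact D" "D \<noteq> {}" and cont: "continuous_on D m"
begin

lemma moreau_attained:
  obtains t where "t \<in> D" "moreau D m u = m t + (u - t)\<^sup>2 / 2"
    "\<And>t'. t' \<in> D \<Longrightarrow> moreau D m u \<le> m t' + (u - t')\<^sup>2 / 2"
proof -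
  have "continuous_on D (\<lambda>t. m t + (u - t)\<^sup>2 / 2)" using cont by (intro continuous_intros) auto
  then obtain t where t: "t \<in> D" "\<And>t'. t' \<in> D \<Longrightarrow> m t + (u - t)\<^sup>2 / 2 \<le> m t' + (u - t')\<^sup>2 / 2"
    using continuous_attains_inf[OF D] by blast
  then have "moreau D m u = m t + (u - t)\<^sup>2 / 2"
    unfolding moreau_def by (intro cInf_eq_minimum) auto
  then show ?thesis using t that by metis
qed

lemma moreau_le: "t \<in> D \<Longrightarrow> moreau D m u \<le> m t + (u - t)\<^sup>2 / 2"
  using moreau_attained by metis

text \<open>Partial minimisation of a jointly convex function of (u, t): the convex combination of
  the minimisers at the two ends is a competitor in between.\<close>

lemma convex_on_moreau:
  assumes cv: "convex_on D m"
  shows "convex_on UNIV (moreau D m)"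
proof (rule convex_onI)
  fix l x y :: real assume l: "l > 0" "l < 1"
  obtain s where s: "s \<in> D" "moreau D m x = m s + (x - s)\<^sup>2 / 2" using moreau_attained by metis
  obtain t where t: "t \<in> D" "moreau D m y = m t + (y - t)\<^sup>2 / 2" using moreau_attained by metis
  let ?c = "\<lambda>a b. (1 - l) * a + l * b"
  have c: "?c s t \<in> D"
    using cv s t l unfolding convex_on_def by (auto simp: convex_def)
  have "moreau D m (?c x y) \<le> m (?c s t) + (?c x y - ?c s t)\<^sup>2 / 2" by (rule moreau_le[OF c])
  also have "m (?c s t) \<le> ?c (m s) (m t)"
    using convex_onD[OF cv, of l s t] s t l by simp
  also have "(?c x y - ?c s t)\<^sup>2 \<le> ?c ((x - s)\<^sup>2) ((y - t)\<^sup>2)"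
  proof -
    have "?c ((x - s)\<^sup>2) ((y - t)\<^sup>2) - (?c x y - ?c s t)\<^sup>2 = l * (1 - l) * ((x - s) - (y - t))\<^sup>2"
      by (simp add: power2_eq_square algebra_simps)
    moreover have "\<dots> \<ge> 0" using l by simp
    ultimately show ?thesis by linarith
  qed
  finally show "moreau D m ((1 - l) *\<^sub>R x + l *\<^sub>R y) \<le> ?c (moreau D m x) (moreau D m y)"
    unfolding s(2) t(2) by (simp add: distrib_left add_divide_distrib)
qed auto

text \<open>Expanding the square shows u^2 / 2 - \<open>moreau D m\<close> u to be the supremum over
  t of u * t - t^2 / 2 - m t, a supremum of affine functions of u. This bounds the second derivative
  of the envelope by 1. In the proof the minimiser of the intermediate point is used at both
  ends.\<close>

lemma convex_on_square_minus_moreau: "convex_on UNIV (\<lambda>u. u\<^sup>2 / 2 - moreau D m u)"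
proof (rule convex_onI)
  fix l x y :: real assume l: "l > 0" "l < 1"
  let ?z = "(1 - l) * x + l * y"
  obtain t where t: "t \<in> D" "moreau D m ?z = m t + (?z - t)\<^sup>2 / 2" using moreau_attained by metis
  have id: "(1 - l) * (c + (x - t)\<^sup>2 / 2) + l * (c + (y - t)\<^sup>2 / 2)
     = c + (?z - t)\<^sup>2 / 2 + (1 - l) * (x\<^sup>2 / 2) + l * (y\<^sup>2 / 2) - ?z\<^sup>2 / 2" for c
    by (simp add: power2_eq_square algebra_simps add_divide_distrib diff_divide_distrib)
  have "(1 - l) * moreau D m x \<le> (1 - l) * (m t + (x - t)\<^sup>2 / 2)"
    using l t moreau_le by (intro mult_left_mono) auto
  moreover have "l * moreau D m y \<le> l * (m t + (y - t)\<^sup>2 / 2)"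
    using l t moreau_le by (intro mult_left_mono) auto
  moreover have "(1 - l) * (m t + (x - t)\<^sup>2 / 2) + l * (m t + (y - t)\<^sup>2 / 2)
     = moreau D m ?z + (1 - l) * (x\<^sup>2 / 2) + l * (y\<^sup>2 / 2) - ?z\<^sup>2 / 2"
    unfolding t(2) by (rule id)
  ultimately show "((1 - l) *\<^sub>R x + l *\<^sub>R y)\<^sup>2 / 2 - moreau D m ((1 - l) *\<^sub>R x + l *\<^sub>R y)
      \<le> (1 - l) * (x\<^sup>2 / 2 - moreau D m x) + l * (y\<^sup>2 / 2 - moreau D m y)"
    unfolding right_diff_distrib[of "1 - l"] right_diff_distrib[of l] real_scaleR_def by linarith
qed auto

lemma moreau_abs_le:
  assumes B: "\<And>t. t \<in> D \<Longrightarrow> \<bar>m t\<bar> \<le> B" and R: "\<And>t. t \<in> D \<Longrightarrow> \<bar>u - t\<bar> \<le> R"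
  shows "\<bar>moreau D m u\<bar> \<le> B + R\<^sup>2 / 2"
proof -
  obtain t where t: "t \<in> D" "moreau D m u = m t + (u - t)\<^sup>2 / 2" using moreau_attained by metis
  have "(u - t)\<^sup>2 \<le> R\<^sup>2" using R[OF t(1)] by (metis abs_ge_zero power_mono power2_abs)
  moreover have "0 \<le> (u - t)\<^sup>2" by simp
  ultimately show ?thesis using B[OF t(1)] unfolding t(2) by linarith
qed

end

text \<open>
  The Moreau envelope determines a convex function isometrically: at the point \<open>u = t + s\<close>, with \<open>s\<close> a
  subgradient at \<open>t\<close>, the minimum defining the envelope is attained at \<open>t\<close>.
\<close>

lemma moreau_le_imp_le:
  fixes m1 m2 :: "real \<Rightarrow> real"
  assumes D: "compact D" and cv: "convex_on D m1" and lip: "1-lipschitz_on D m1" and c2: "continuous_on D m2"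
    and le: "\<And>u. \<exists>t\<in>D. \<bar>u - t\<bar> \<le> 1 \<Longrightarrow> moreau D m1 u \<le> moreau D m2 u + e"
    and t: "t \<in> D"
  shows "m1 t \<le> m2 t + e"
proof -
  obtain s where s: "\<bar>s\<bar> \<le> 1" "\<And>x. x \<in> D \<Longrightarrow> m1 t + s * (x - t) \<le> m1 x"
    using subgradient_exists[OF cv lip t] by blast
  have D': "D \<noteq> {}" using t by auto
  have c1: "continuous_on D m1" using lip by (rule lipschitz_on_continuous_on)
  obtain x where x: "x \<in> D" "moreau D m1 (t + s) = m1 x + (t + s - x)\<^sup>2 / 2"
    using moreau_attained[OF D D' c1] by metis
  have "(t + s - x)\<^sup>2 / 2 - (s\<^sup>2 / 2 + s * (t - x)) = (t - x)\<^sup>2 / 2"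
    by (simp add: power2_eq_square field_simps)
  then have "s\<^sup>2 / 2 + s * (t - x) \<le> (t + s - x)\<^sup>2 / 2"
    using zero_le_power2[of "t - x"] by linarith
  then have "m1 t + s\<^sup>2 / 2 \<le> moreau D m1 (t + s)"
    using s(2)[OF x(1)] x(2) by (simp add: algebra_simps)
  also have "\<dots> \<le> moreau D m2 (t + s) + e" using s t by (intro le bexI[of _ t]) auto
  also have "moreau D m2 (t + s) \<le> m2 t + s\<^sup>2 / 2"
    using moreau_le[OF D D' c2 t, of "t + s"] by simp
  finally show ?thesis by simp
qed

text \<open>\<open>f1\<close> lies below its chord, and \<open>f2\<close> lies above its chord up to
  the interpolation error of u^2 / 2. That error is l * (1 - l) * h^2 / 2, at most h^2 / 8.\<close>

lemma convex_between_grid: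
  fixes f1 f2 :: "real \<Rightarrow> real"
  assumes f1: "convex_on UNIV f1" and f2: "convex_on UNIV (\<lambda>u. u\<^sup>2 / 2 - f2 u)"
    and h: "0 < h" and u: "a \<le> u" "u \<le> a + h"
    and e: "f1 a \<le> f2 a + e" "f1 (a + h) \<le> f2 (a + h) + e"
  shows "f1 u \<le> f2 u + e + h\<^sup>2 / 8"
proof -
  define l where "l = (u - a) / h"
  have l: "0 \<le> l" "l \<le> 1" using u h by (auto simp: l_def field_simps)
  have ul: "(1 - l) * a + l * (a + h) = u" using h by (simp add: l_def field_simps)
  have 1: "f1 u \<le> (1 - l) * f1 a + l * f1 (a + h)"
    using convex_onD[OF f1 l, of a "a + h"] ul by simp
  have 2: "u\<^sup>2 / 2 - f2 u \<le> (1 - l) * (a\<^sup>2 / 2 - f2 a) + l * ((a + h)\<^sup>2 / 2 - f2 (a + h))"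
    using convex_onD[OF f2 l, of a "a + h"] ul by simp
  have 3: "(1 - l) * a\<^sup>2 + l * (a + h)\<^sup>2 - u\<^sup>2 = h\<^sup>2 / 4 - h\<^sup>2 * (l - 1/2)\<^sup>2"
    unfolding ul[symmetric] by (simp add: power2_eq_square field_simps)
  have 4: "(1 - l) * f1 a + l * f1 (a + h) \<le> (1 - l) * (f2 a + e) + l * (f2 (a + h) + e)"
    using l e by (intro add_mono mult_left_mono) auto
  have 5: "h\<^sup>2 * (l - 1/2)\<^sup>2 \<ge> 0" by simp
  have 6: "(1 - l) * (a\<^sup>2 / 2 - f2 a) + l * ((a + h)\<^sup>2 / 2 - f2 (a + h))
     = ((1 - l) * a\<^sup>2 + l * (a + h)\<^sup>2) / 2 - ((1 - l) * f2 a + l * f2 (a + h))"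
    by (simp add: field_simps)
  have 7: "(1 - l) * (f2 a + e) + l * (f2 (a + h) + e) = (1 - l) * f2 a + l * f2 (a + h) + e"
    by (simp add: field_simps)
  have aux: "F1 \<le> F2 + e + h\<^sup>2 / 8"
    if "F1 \<le> c1" "p / 2 - F2 \<le> q" "r - p = h\<^sup>2 / 4 - y" "c1 \<le> c2 + e" "0 \<le> y" "q = r / 2 - c2"
    for F1 F2 c1 c2 p q r y :: real
    using that by linarith
  show ?thesis by (rule aux[OF 1 2 3 4[unfolded 7] 5 6])
qed

section \<open>Codes of at most exp (A * 2^j) values: entropy of order \<delta>^(-1/2) at the scales
  \<delta> = 4^-j\<close>

definition subexp :: "(nat \<Rightarrow> real) \<Rightarrow> bool" where
  "subexp c \<longleftrightarrow> (\<exists>A\<ge>0. \<forall>j. c j \<le> exp (A * 2 ^ j))"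

lemma subexp_mono: "subexp c \<Longrightarrow> (\<And>j. c' j \<le> c j) \<Longrightarrow> subexp c'"
  unfolding subexp_def by (meson order_trans)

lemma subexp_mult:
  assumes "subexp c" "subexp d" "\<And>j. 0 \<le> c j" "\<And>j. 0 \<le> d j"
  shows "subexp (\<lambda>j. c j * d j)"
proof -
  obtain A where A: "A \<ge> 0" "\<And>j. c j \<le> exp (A * 2 ^ j)" using assms(1) by (auto simp: subexp_def)
  obtain B where B: "B \<ge> 0" "\<And>j. d j \<le> exp (B * 2 ^ j)" using assms(2) by (auto simp: subexp_def)
  have "c j * d j \<le> exp ((A + B) * 2 ^ j)" for j
    using mult_mono[OF A(2)[of j] B(2)[of j]] assms(4) by (simp add: distrib_right exp_add)
  then show ?thesis using A B unfolding subexp_def by (intro exI[of _ "A + B"]) auto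
qed

lemma subexp_power: "subexp c \<Longrightarrow> (\<And>j. 0 \<le> c j) \<Longrightarrow> subexp (\<lambda>j. c j ^ k)"
proof (induction k)
  case 0
  show ?case unfolding subexp_def by (intro exI[of _ 0]) auto
next
  case (Suc k)
  then show ?case by (auto intro!: subexp_mult)
qed

lemma subexp_const: "subexp (\<lambda>_. r)"
proof -
  have "r \<le> exp (\<bar>r\<bar> * 2 ^ j)" for j :: nat
  proof -
    have "r \<le> \<bar>r\<bar> * 1" by simp
    also have "\<dots> \<le> \<bar>r\<bar> * 2 ^ j" by (intro mult_left_mono) auto
    also have "\<dots> \<le> exp (\<bar>r\<bar> * 2 ^ j)" using exp_ge_add_one_self[of "\<bar>r\<bar> * 2 ^ j"] by linarith
    finally show ?thesis .
  qed
  then show ?thesis unfolding subexp_def by (intro exI[of _ "\<bar>r\<bar>"]) auto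
qed

lemma subexp_4: "subexp (\<lambda>j. 4 ^ j)"
proof -
  have "(4::real) ^ j \<le> exp (2 * 2 ^ j)" for j
  proof -
    have "(4::real) ^ j = (2 ^ j) ^ 2" by (simp add: power2_eq_square flip: power_mult_distrib)
    also have "\<dots> \<le> (exp (2 ^ j)) ^ 2"
      using exp_ge_add_one_self[of "2 ^ j"] by (intro power_mono) (linarith, simp)
    also have "\<dots> = exp (2 * 2 ^ j)" by (simp add: exp_double)
    finally show ?thesis .
  qed
  then show ?thesis unfolding subexp_def by (intro exI[of _ 2]) auto
qed

lemma subexp_exponential:
  assumes "1 \<le> a" "\<And>j. real (N j) \<le> r * 2 ^ j"
  shows "subexp (\<lambda>j. a ^ N j)"
proof -
  have "a ^ N j \<le> exp (ln a * r * 2 ^ j)" for j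
  proof -
    have "a ^ N j = exp (ln a * real (N j))" using assms by (simp add: exp_of_nat2_mult)
    also have "\<dots> \<le> exp (ln a * r * 2 ^ j)"
      using mult_left_mono[OF assms(2)[of j], of "ln a"] assms(1) by (simp add: mult_ac)
    finally show ?thesis .
  qed
  moreover have "0 \<le> r" using assms(2)[of 0] by (metis mult.right_neutral of_nat_0_le_iff order_trans power_0)
  ultimately show ?thesis using assms unfolding subexp_def by (intro exI[of _ "ln a * r"]) auto
qed

text \<open>A covering given by a labelling: parameters with equal labels are related by
  \<open>R\<close>. Labels of several components are combined by pairing, and in any subset one
  representative for each label that occurs gives a net, so the centres never leave the
  subset.\<close>

definition subexp_code ::
  "'p set \<Rightarrow> (nat \<Rightarrow> 'p \<Rightarrow> 'p \<Rightarrow> bool) \<Rightarrow> (nat \<Rightarrow> 'c set) \<Rightarrow> (nat \<Rightarrow> 'p \<Rightarrow> 'c) \<Rightarrow> bool" where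
  "subexp_code I R K code \<longleftrightarrow> subexp (\<lambda>j. real (card (K j))) \<and> (\<forall>j. finite (K j)) \<and>
     (\<forall>j. code j ` I \<subseteq> K j) \<and> (\<forall>j. \<forall>p\<in>I. \<forall>p'\<in>I. code j p = code j p' \<longrightarrow> R j p p')"

definition convex_ball :: "real set \<Rightarrow> real \<Rightarrow> (real \<Rightarrow> real) set" where
  "convex_ball D B = {m \<in> convex_lipschitz D 1. \<forall>t\<in>D. \<bar>m t\<bar> \<le> B}"

lemma second_difference_code_eq:
  fixes V W :: "nat \<Rightarrow> int"
  assumes "V 0 = W 0" "V 1 = W 1"
    and "map (\<lambda>i. V (i + 2) - 2 * V (i + 1) + V i) [0..<N] = map (\<lambda>i. W (i + 2) - 2 * W (i + 1) + W i) [0..<N]"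
    and "i \<le> N + 1"
  shows "V i = W i"
  using assms(4)
proof (induction i rule: less_induct)
  case (less i)
  consider "i = 0" | "i = 1" | k where "i = k + 2" by (metis One_nat_def add_2_eq_Suc' not0_implies_Suc)
  then show ?case
  proof cases
    case 3
    then have "k < N" using less by simp
    then have "V (k + 2) - 2 * V (k + 1) + V k = W (k + 2) - 2 * W (k + 1) + W k"
      using assms(3) by (simp add: map_eq_conv)
    moreover have "V (k + 1) = W (k + 1)" "V k = W k" using less 3 by auto
    ultimately show ?thesis using 3 by simp
  qed (use assms in simp_all)
qed

lemma floor_eq_imp_le:
  fixes x y h :: real
  assumes "\<lfloor>x / h\<rfloor> = \<lfloor>y / h\<rfloor>" "0 < h"
  shows "x \<le> y + h"
proof -
  have "x / h < y / h + 1" using assms(1) by linarith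
  then show ?thesis using assms(2) by (simp add: field_simps)
qed

text \<open>The label records the envelope on a grid of mesh 2^-j, rounded at 4^-j: two initial
  values and the second differences. As the second differences are bounded in units of 4^-j, each
  grid point contributes a bounded number of choices, about 7^(2^j) in total. Rounding values or
  slopes independently would leave a number of choices per point that grows with j, and so an extra
  factor j in the entropy.\<close>

lemma convex_ball_code:
  assumes D: "compact D" "D \<noteq> {}" "\<And>t. t \<in> D \<Longrightarrow> \<bar>t\<bar> \<le> T" and B: "0 \<le> B"
  shows "\<exists>K (code :: nat \<Rightarrow> (real \<Rightarrow> real) \<Rightarrow> int \<times> int \<times> int list).
    subexp_code (convex_ball D B) (\<lambda>j m1 m2. \<forall>t\<in>D. \<bar>m1 t - m2 t\<bar> \<le> 2 / 4 ^ j) K code"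
proof -
  have T: "0 \<le> T" using D(2,3) by force
  \<comment> \<open>Subgradients have modulus at most 1, so the envelope has to be known only within
    distance 1 of \<open>D\<close>.\<close>
  define U where "U = T + 1"
  define h where "h j = (1 / 2 ^ j :: real)" for j :: nat
  have h: "0 < h j" "h j \<le> 1" "(h j)\<^sup>2 = 1 / 4 ^ j" for j
    by (simp_all add: h_def power_divide power2_eq_square flip: power_mult_distrib)
  define u where "u j i = - U + real i * h j" for j i
  \<comment> \<open>\<open>N j\<close> second differences fix the values up to index N j + 1, which
    covers both ends of every grid cell that meets [-U, U].\<close>
  define N where "N j = nat \<lceil>2 * U * 2 ^ j\<rceil>" for j :: nat
  define f where "f m = moreau D m" for m
  define V where "V j m i = \<lfloor>f m (u j i) / (h j)\<^sup>2\<rfloor>" for j m i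
  define code where "code j m = (V j m 0, V j m 1, map (\<lambda>i. V j m (i + 2) - 2 * V j m (i + 1) + V j m i) [0..<N j])" for j m
  \<comment> \<open>A bound for the envelope at the first two grid points. They lie in [-U, -U + 1],
    hence within 2 * T + 2 of each point of \<open>D\<close>.\<close>
  define r where "r = nat \<lceil>B + (2 * T + 2)\<^sup>2 / 2\<rceil>"
  have r: "B + (2 * T + 2)\<^sup>2 / 2 \<le> real r" unfolding r_def by linarith
  \<comment> \<open>The added 1 allows for rounding down. The second differences before rounding lie
    in [0, 1] after division by h^2, and taking floors moves them by less than 2 either way, so
    -3..3 is ample.\<close>
  define R where "R j = int r * 4 ^ j + 1" for j :: nat
  define K where "K j = {- R j..R j} \<times> {- R j..R j} \<times> {xs. set xs \<subseteq> {-3..3::int} \<and> length xs = N j}" for j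
  have fin: "finite (K j)" for j
    unfolding K_def using finite_lists_length_eq[of "{-3..3::int}" "N j"] by simp
  have cardK: "real (card (K j)) = (2 * (real r * 4 ^ j) + 3) * (2 * (real r * 4 ^ j) + 3) * 7 ^ N j" for j
  proof -
    have "real (card {- R j..R j}) = 2 * (real r * 4 ^ j) + 3"
    proof -
      have "real (card {- R j..R j}) = of_int (2 * R j + 1)" by (simp add: R_def)
      then show ?thesis by (simp add: R_def)
    qed
    then show ?thesis
      unfolding K_def card_cartesian_product of_nat_mult
      by (simp add: card_lists_length_eq)
  qed
  have "subexp (\<lambda>j. (2 * real r + 3) * 4 ^ j)"
    by (intro subexp_mult subexp_const subexp_4) auto
  then have s1: "subexp (\<lambda>j. 2 * (real r * 4 ^ j) + 3)"
    by (rule subexp_mono) (simp add: algebra_simps)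
  have s2: "subexp (\<lambda>j. 7 ^ N j)"
  proof (rule subexp_exponential)
    fix j
    have "real (N j) \<le> 2 * U * 2 ^ j + 1" using T by (simp add: N_def U_def)
    also have "\<dots> \<le> (2 * U + 1) * 2 ^ j" by (simp add: algebra_simps)
    finally show "real (N j) \<le> (2 * U + 1) * 2 ^ j" .
  qed simp
  have sub: "subexp (\<lambda>j. real (card (K j)))"
    unfolding cardK using s1 s2 by (intro subexp_mult) auto
  have mD: "continuous_on D m" "convex_on D m" "1-lipschitz_on D m" "\<And>t. t \<in> D \<Longrightarrow> \<bar>m t\<bar> \<le> B"
    if "m \<in> convex_ball D B" for m
    using that by (auto simp: convex_ball_def convex_lipschitz_def intro: lipschitz_on_continuous_on)
  have fc: "convex_on UNIV (f m)" "convex_on UNIV (\<lambda>u. u\<^sup>2 / 2 - f m u)" if "m \<in> convex_ball D B" for m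
    unfolding f_def using convex_on_moreau[OF D(1,2) mD(1,2)[OF that]]
      convex_on_square_minus_moreau[OF D(1,2) mD(1)[OF that]] by auto
  have code_in: "code j m \<in> K j" if m: "m \<in> convex_ball D B" for j m
  proof -
    have V01: "V j m i \<in> {- R j..R j}" if i: "i \<le> 1" for i
    proof -
      have iz: "0 \<le> real i * h j" "real i * h j \<le> 1"
        using h(1,2)[of j] mult_mono[of "real i" 1 "h j" 1] i by auto
      have "\<bar>f m (u j i)\<bar> \<le> B + (2 * T + 2)\<^sup>2 / 2"
        unfolding f_def
      proof (rule moreau_abs_le[OF D(1,2) mD(1,4)[OF m]])
        fix t assume "t \<in> D"
        then have "\<bar>t\<bar> \<le> T" using D by auto
        then show "\<bar>u j i - t\<bar> \<le> 2 * T + 2" using iz T unfolding u_def U_def by linarith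
      qed
      then have "\<bar>f m (u j i)\<bar> \<le> real r" using r by linarith
      then have "\<bar>f m (u j i)\<bar> * 4 ^ j \<le> real r * 4 ^ j" by (intro mult_right_mono) auto
      then have "\<bar>f m (u j i) / (h j)\<^sup>2\<bar> \<le> real r * 4 ^ j" by (simp add: h abs_mult)
      then have "\<bar>f m (u j i) / (h j)\<^sup>2\<bar> \<le> of_int (int r * 4 ^ j)" by simp
      then show ?thesis unfolding V_def R_def by (simp only: atLeastAtMost_iff) linarith
    qed
    have dd: "V j m (i + 2) - 2 * V j m (i + 1) + V j m i \<in> {-3..3}" for i
    proof -
      define a where "a = u j i"
      have ua: "u j (i + 1) = a + h j" "u j (i + 2) = a + 2 * h j"
        by (simp_all add: u_def a_def algebra_simps)
      have mid: "(1 - 1/2) *\<^sub>R a + (1/2) *\<^sub>R (a + 2 * h j) = a + h j" by (simp add: field_simps)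
      have "f m (a + h j) \<le> f m a / 2 + f m (a + 2 * h j) / 2"
        using convex_onD[OF fc(1)[OF m], of "1/2" a "a + 2 * h j"] unfolding mid by simp
      moreover have "(a + h j)\<^sup>2 / 2 - f m (a + h j) \<le> (a\<^sup>2 / 2 - f m a) / 2 + ((a + 2 * h j)\<^sup>2 / 2 - f m (a + 2 * h j)) / 2"
        using convex_onD[OF fc(2)[OF m], of "1/2" a "a + 2 * h j"] unfolding mid by simp
      moreover have "a\<^sup>2 + (a + 2 * h j)\<^sup>2 - 2 * (a + h j)\<^sup>2 = 2 * (h j)\<^sup>2"
        by (simp add: power2_eq_square algebra_simps)
      moreover have "0 \<le> F2 - 2 * F1 + F0 \<and> F2 - 2 * F1 + F0 \<le> e"
        if "F1 \<le> F0 / 2 + F2 / 2" "q1 / 2 - F1 \<le> (q0 / 2 - F0) / 2 + (q2 / 2 - F2) / 2" "q0 + q2 - 2 * q1 = 2 * e"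
        for F0 F1 F2 q0 q1 q2 e :: real
        using that by (simp add: field_simps)
      ultimately have d: "0 \<le> f m (a + 2 * h j) - 2 * f m (a + h j) + f m a"
        "f m (a + 2 * h j) - 2 * f m (a + h j) + f m a \<le> (h j)\<^sup>2" by blast+
      define q where "q x = f m x / (h j)\<^sup>2" for x
      have "q (a + 2 * h j) - 2 * q (a + h j) + q a = (f m (a + 2 * h j) - 2 * f m (a + h j) + f m a) / (h j)\<^sup>2"
        by (simp add: q_def add_divide_distrib diff_divide_distrib)
      then have "0 \<le> q (a + 2 * h j) - 2 * q (a + h j) + q a" "q (a + 2 * h j) - 2 * q (a + h j) + q a \<le> 1"
        using d h(1)[of j] by auto
      then show ?thesis
        unfolding V_def ua a_def[symmetric] q_def[symmetric] atLeastAtMost_iff by linarith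
    qed
    show ?thesis using V01 dd by (auto simp: code_def K_def)
  qed
  have le: "m1 t \<le> m2 t + 2 / 4 ^ j"
    if m: "m1 \<in> convex_ball D B" "m2 \<in> convex_ball D B" and c: "code j m1 = code j m2" and t: "t \<in> D" for j m1 m2 t
  proof -
    have Veq: "V j m1 i = V j m2 i" if "i \<le> N j + 1" for i
      using second_difference_code_eq[of "V j m1" "V j m2" "N j" i] c that by (simp add: code_def)
    have grid: "f m1 (u j i) \<le> f m2 (u j i) + (h j)\<^sup>2" if "i \<le> N j + 1" for i
      using Veq[OF that] h(1)[of j] unfolding V_def by (intro floor_eq_imp_le) auto
    have "m1 t \<le> m2 t + ((h j)\<^sup>2 + (h j)\<^sup>2 / 8)"
    proof (rule moreau_le_imp_le[OF D(1) mD(2,3)[OF m(1)] mD(1)[OF m(2)] _ t])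
      fix x assume "\<exists>t\<in>D. \<bar>x - t\<bar> \<le> 1"
      then have x: "- U \<le> x" "x \<le> U" using D(3) unfolding U_def by fastforce+
      define i where "i = nat \<lfloor>(x + U) / h j\<rfloor>"
      have p: "0 \<le> (x + U) / h j" using x h(1)[of j] by simp
      have "real i \<le> (x + U) / h j" "(x + U) / h j \<le> real i + 1" using p unfolding i_def by linarith+
      then have ui: "u j i \<le> x" "x \<le> u j i + h j"
        using h(1)[of j] unfolding u_def by (auto simp: field_simps)
      have "(x + U) / h j \<le> 2 * U * 2 ^ j"
        using x by (simp add: h_def)
      then have iN: "i \<le> N j" unfolding i_def N_def by linarith
      have "u j (i + 1) = u j i + h j" by (simp add: u_def algebra_simps)
      then show "moreau D m1 x \<le> moreau D m2 x + ((h j)\<^sup>2 + (h j)\<^sup>2 / 8)"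
        using convex_between_grid[OF fc(1)[OF m(1)] fc(2)[OF m(2)] h(1) ui, of "(h j)\<^sup>2"] grid[of i] grid[of "i + 1"] iN
        by (simp add: f_def)
    qed
    also have "\<dots> \<le> m2 t + 2 / 4 ^ j" by (simp add: h field_simps)
    finally show ?thesis .
  qed
  have "\<bar>m1 t - m2 t\<bar> \<le> 2 / 4 ^ j"
    if "m1 \<in> convex_ball D B" "m2 \<in> convex_ball D B" "code j m1 = code j m2" "t \<in> D" for j m1 m2 t
    using le[of m1 m2 j t] le[of m2 m1 j t] that by (simp add: abs_le_iff)
  then show ?thesis
    using sub fin code_in unfolding subexp_code_def by (intro exI[of _ K] exI[of _ code]) auto
qed

section \<open>Differences of ridge functions\<close>

text \<open>Coordinates are rounded at 4^-j. The number of labels is polynomial in 4^j, so the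
  direction does not change the order of the entropy; the factor \<open>CARD('d)\<close> comes from
  bounding the norm by the sum of the coordinates.\<close>

lemma index_space_code:
  "\<exists>K (code :: nat \<Rightarrow> real ^ 'd \<Rightarrow> 'd \<Rightarrow> int).
    subexp_code (index_space (k :: 'd::finite)) (\<lambda>j \<theta>1 \<theta>2. norm (\<theta>1 - \<theta>2) \<le> real CARD('d) / 4 ^ j) K code"
proof -
  define code :: "nat \<Rightarrow> real ^ 'd \<Rightarrow> 'd \<Rightarrow> int" where "code j \<theta> = (\<lambda>i. \<lfloor>\<theta> $ i / (1 / 4 ^ j)\<rfloor>)" for j \<theta>
  define K :: "nat \<Rightarrow> ('d \<Rightarrow> int) set" where "K j = (\<Pi>\<^sub>E i\<in>UNIV. {- (4 ^ j)..4 ^ j})" for j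
  have fin: "finite (K j)" for j unfolding K_def by (intro finite_PiE) auto
  have "real (card {- (4 ^ j)..4 ^ j :: int}) = 2 * 4 ^ j + 1" for j :: nat
  proof -
    have "real (card {- (4 ^ j)..4 ^ j :: int}) = of_int (2 * 4 ^ j + 1)" by simp
    then show ?thesis by simp
  qed
  then have card: "real (card (K j)) = (2 * 4 ^ j + 1) ^ CARD('d)" for j
    unfolding K_def by (subst card_PiE) (simp_all only: finite prod_constant of_nat_power)
  have "subexp (\<lambda>j. 3 * 4 ^ j)" by (intro subexp_mult subexp_const subexp_4) auto
  then have "subexp (\<lambda>j. 2 * 4 ^ j + 1)" by (rule subexp_mono) simp
  then have sub: "subexp (\<lambda>j. real (card (K j)))" unfolding card by (intro subexp_power) auto
  have inK: "code j \<theta> \<in> K j" if "\<theta> \<in> index_space k" for j \<theta>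
  proof -
    have "code j \<theta> i \<in> {- (4 ^ j)..4 ^ j}" for i
    proof -
      have "\<bar>\<theta> $ i\<bar> \<le> 1" using component_le_norm_cart[of \<theta> i] that by (simp add: index_space_def)
      then have "\<bar>\<theta> $ i\<bar> * 4 ^ j \<le> 1 * 4 ^ j" by (intro mult_right_mono) auto
      then have "\<bar>\<theta> $ i / (1 / 4 ^ j)\<bar> \<le> of_int (4 ^ j)" by (simp add: abs_mult)
      then show ?thesis unfolding code_def by (simp only: atLeastAtMost_iff) linarith
    qed
    then show ?thesis by (auto simp: K_def)
  qed
  have close: "norm (\<theta>1 - \<theta>2) \<le> real CARD('d) / 4 ^ j" if "code j \<theta>1 = code j \<theta>2" for j and \<theta>1 \<theta>2 :: "real ^ 'd"
  proof -
    have "\<bar>(\<theta>1 - \<theta>2) $ i\<bar> \<le> 1 / 4 ^ j" for i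
    proof -
      have "\<lfloor>\<theta>1 $ i / (1 / 4 ^ j)\<rfloor> = \<lfloor>\<theta>2 $ i / (1 / 4 ^ j)\<rfloor>" using that by (metis code_def)
      then have "\<theta>1 $ i \<le> \<theta>2 $ i + 1 / 4 ^ j" "\<theta>2 $ i \<le> \<theta>1 $ i + 1 / 4 ^ j"
        by (auto intro!: floor_eq_imp_le)
      then show ?thesis by (simp add: abs_le_iff)
    qed
    then have "(\<Sum>i\<in>UNIV. \<bar>(\<theta>1 - \<theta>2) $ i\<bar>) \<le> (\<Sum>i\<in>(UNIV :: 'd set). 1 / 4 ^ j)" by (intro sum_mono) auto
    then show ?thesis using norm_le_l1_cart[of "\<theta>1 - \<theta>2"] by simp
  qed
  show ?thesis
    using sub fin inK close unfolding subexp_code_def by (intro exI[of _ K] exI[of _ code]) auto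
qed

text \<open>Different parameters may describe the same function, so one parameter is fixed for every
  g in \<open>S\<close>; the label then depends on g, and one member of \<open>S\<close> is kept for
  each label that occurs.\<close>

lemma net_of_code:
  fixes code :: "'p \<Rightarrow> 'c" and \<phi> :: "'p \<Rightarrow> 'x \<Rightarrow> real"
  assumes K: "finite K" "code ` I \<subseteq> K"
    and close: "\<And>p p'. p \<in> I \<Longrightarrow> p' \<in> I \<Longrightarrow> code p = code p' \<Longrightarrow> sup_close \<X> c (\<phi> p) (\<phi> p')"
    and S: "S \<subseteq> \<phi> ` I"
  shows "\<exists>N\<subseteq>S. finite N \<and> card N \<le> card K \<and> (\<forall>g\<in>S. \<exists>u\<in>N. sup_close \<X> c g u)"
proof -
  obtain p where p: "\<And>g. g \<in> S \<Longrightarrow> p g \<in> I \<and> \<phi> (p g) = g" using S by (metis image_iff subsetD)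
  define cd where "cd g = code (p g)" for g
  have sub: "cd ` S \<subseteq> K" using p K by (auto simp: cd_def)
  define N where "N = inv_into S cd ` (cd ` S)"
  show ?thesis
  proof (intro exI[of _ N] conjI ballI)
    show "N \<subseteq> S" by (auto simp: N_def inv_into_into)
    show "finite N" unfolding N_def using sub K finite_subset by blast
    have "card N \<le> card (cd ` S)" unfolding N_def using sub K finite_subset by (blast intro: card_image_le)
    also have "\<dots> \<le> card K" by (rule card_mono[OF K(1) sub])
    finally show "card N \<le> card K" .
    fix g assume g: "g \<in> S"
    define u where "u = inv_into S cd (cd g)"
    have u: "u \<in> S" "cd u = cd g"
      using g unfolding u_def by (auto intro!: inv_into_into f_inv_into_f[of _ cd])
    have "sup_close \<X> c (\<phi> (p g)) (\<phi> (p u))" using close[of "p g" "p u"] p g u by (simp add: cd_def)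
    then show "\<exists>u\<in>N. sup_close \<X> c g u" using p g u by (intro bexI[of _ u]) (auto simp: N_def u_def)
  qed
qed

text \<open>Nets are required inside every subset of \<open>G\<close>, because chaining is applied
  to a subset of small norm and the variance bounds hold only between its members.\<close>

definition subexp_nets :: "'x set \<Rightarrow> ('x \<Rightarrow> real) set \<Rightarrow> real \<Rightarrow> real \<Rightarrow> bool" where
  "subexp_nets \<X> G A C \<longleftrightarrow> 0 \<le> A \<and> 0 < C \<and> (\<forall>g\<in>G. \<forall>g'\<in>G. sup_close \<X> C g g') \<and>
     (\<forall>S\<subseteq>G. \<forall>j. \<exists>N\<subseteq>S. finite N \<and> real (card N) \<le> exp (A * 2 ^ j) \<and> (\<forall>g\<in>S. \<exists>u\<in>N. sup_close \<X> (C / 4 ^ j) g u))"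

text \<open>Values of the link functions outside \<open>D\<close> are arbitrary. Setting the
  difference to 0 off \<open>\<X>\<close> makes it Borel measurable and bounded on the whole
  space.\<close>

definition index_diff :: "'x set \<Rightarrow> (real \<Rightarrow> real) \<Rightarrow> 'x::real_inner \<Rightarrow> (real \<Rightarrow> real) \<Rightarrow> 'x \<Rightarrow> 'x \<Rightarrow> real" where
  "index_diff \<X> m1 \<theta>1 m2 \<theta>2 = (\<lambda>x. if x \<in> \<X> then m1 (\<theta>1 \<bullet> x) - m2 (\<theta>2 \<bullet> x) else 0)"

text \<open>The subtracted function also ranges over the ball. It will be the true link divided by
  L, which varies with L, and shrinking a difference by a factor shrinks both members.\<close>

definition index_diffs :: "'d::finite \<Rightarrow> (real ^ 'd) set \<Rightarrow> real set \<Rightarrow> real \<Rightarrow> (real ^ 'd \<Rightarrow> real) set" where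
  "index_diffs k \<X> D B = {index_diff \<X> m1 \<theta>1 m2 \<theta>2 | m1 \<theta>1 m2 \<theta>2.
     m1 \<in> convex_ball D B \<and> \<theta>1 \<in> index_space k \<and> m2 \<in> convex_ball D B \<and> \<theta>2 \<in> index_space k}"

lemma link_domain_mem: "x \<in> \<X> \<Longrightarrow> \<theta> \<in> index_space k \<Longrightarrow> \<theta> \<bullet> x \<in> link_domain k \<X>"
  unfolding link_domain_def by (intro hull_inc) auto

locale index_geometry =
  fixes k :: "'d::finite" and \<X> :: "(real ^ 'd) set" and D :: "real set" and T :: real
  assumes D: "compact D" "convex D" "D \<noteq> {}" "\<And>t. t \<in> D \<Longrightarrow> \<bar>t\<bar> \<le> T"
    and mem: "\<And>x \<theta>. x \<in> \<X> \<Longrightarrow> \<theta> \<in> index_space k \<Longrightarrow> \<theta> \<bullet> x \<in> D"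
    and \<X>: "closed \<X>" "\<And>x. x \<in> \<X> \<Longrightarrow> norm x \<le> T"
    and index_ne: "index_space k \<noteq> {}"
begin

abbreviation \<G> :: "real \<Rightarrow> (real ^ 'd \<Rightarrow> real) set" where
  "\<G> B \<equiv> index_diffs k \<X> D B"

lemma index_diffs_zero:
  assumes B: "0 \<le> B"
  shows "(\<lambda>_. 0) \<in> \<G> B"
proof -
  obtain \<theta> where \<theta>: "\<theta> \<in> index_space k" using index_ne by auto
  have "(\<lambda>_. 0) \<in> convex_ball D B"
    using B D by (simp add: convex_ball_def convex_lipschitz_def convex_on_const lipschitz_on_def)
  moreover have "index_diff \<X> (\<lambda>_. 0) \<theta> (\<lambda>_. 0) \<theta> = (\<lambda>_. 0)" by (simp add: index_diff_def fun_eq_iff)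
  ultimately show ?thesis unfolding index_diffs_def mem_Collect_eq using \<theta> by metis
qed

lemma convex_ball_scale:
  assumes "m \<in> convex_ball D B" "0 \<le> t" "t \<le> 1"
  shows "(\<lambda>x. t * m x) \<in> convex_ball D B"
proof -
  have m: "convex_on D m" "1-lipschitz_on D m" "\<And>x. x \<in> D \<Longrightarrow> \<bar>m x\<bar> \<le> B"
    using assms by (auto simp: convex_ball_def convex_lipschitz_def)
  have "1-lipschitz_on D (\<lambda>x. t * m x)"
  proof (rule lipschitz_onI)
    fix x y assume xy: "x \<in> D" "y \<in> D"
    have "dist (t * m x) (t * m y) = t * dist (m x) (m y)"
      using assms by (simp add: dist_real_def abs_mult flip: right_diff_distrib)
    also have "\<dots> \<le> 1 * (1 * dist x y)"
      using assms lipschitz_onD[OF m(2) xy] by (intro mult_mono) auto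
    finally show "dist (t * m x) (t * m y) \<le> 1 * dist x y" by simp
  qed simp
  moreover have "convex_on D (\<lambda>x. t * m x)" using convex_on_cmul[OF assms(2) m(1)] .
  moreover have "\<bar>t * m x\<bar> \<le> B" if "x \<in> D" for x
    using mult_mono[OF assms(3) m(3)[OF that]] assms by (simp add: abs_mult)
  ultimately show ?thesis by (simp add: convex_ball_def convex_lipschitz_def)
qed

lemma index_diffs_scale:
  assumes "g \<in> \<G> B" "0 \<le> t" "t \<le> 1"
  shows "(\<lambda>x. t * g x) \<in> \<G> B"
proof -
  obtain m1 \<theta>1 m2 \<theta>2 where g: "g = index_diff \<X> m1 \<theta>1 m2 \<theta>2" "m1 \<in> convex_ball D B" "\<theta>1 \<in> index_space k"
     "m2 \<in> convex_ball D B" "\<theta>2 \<in> index_space k" using assms(1) by (auto simp: index_diffs_def)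
  have "(\<lambda>x. t * g x) = index_diff \<X> (\<lambda>x. t * m1 x) \<theta>1 (\<lambda>x. t * m2 x) \<theta>2"
    by (simp add: g(1) index_diff_def fun_eq_iff right_diff_distrib)
  then show ?thesis
    unfolding index_diffs_def mem_Collect_eq using g(2-5) convex_ball_scale[OF _ assms(2,3)] by metis
qed

lemma index_diffs_bounded:
  assumes B: "0 \<le> B" and "g \<in> \<G> B"
  shows "\<bar>g x\<bar> \<le> 2 * B"
proof -
  obtain m1 \<theta>1 m2 \<theta>2 where g: "g = index_diff \<X> m1 \<theta>1 m2 \<theta>2" "m1 \<in> convex_ball D B" "\<theta>1 \<in> index_space k"
     "m2 \<in> convex_ball D B" "\<theta>2 \<in> index_space k" using assms(2) by (auto simp: index_diffs_def)
  show ?thesis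
  proof (cases "x \<in> \<X>")
    case True
    then have "\<bar>m1 (\<theta>1 \<bullet> x)\<bar> \<le> B" "\<bar>m2 (\<theta>2 \<bullet> x)\<bar> \<le> B"
      using g mem by (auto simp: convex_ball_def)
    then show ?thesis using True by (simp add: g(1) index_diff_def)
  qed (use B in \<open>simp add: g(1) index_diff_def\<close>)
qed

lemma borel_measurable_composition_index:
  fixes m :: "real \<Rightarrow> real"
  assumes "continuous_on D m" "\<theta> \<in> index_space k"
  shows "(\<lambda>x. if x \<in> \<X> then m (\<theta> \<bullet> x) else 0) \<in> borel_measurable borel"
proof -
  have "continuous_on \<X> (\<lambda>x. m (\<theta> \<bullet> x))"
    using assms mem by (intro continuous_on_compose2[OF assms(1)] continuous_intros) auto
  then have "(\<lambda>x. indicator \<X> x *\<^sub>R m (\<theta> \<bullet> x)) \<in> borel_measurable borel"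
    using \<X>(1) by (intro borel_measurable_continuous_on_indicator) auto
  also have "(\<lambda>x. indicator \<X> x *\<^sub>R m (\<theta> \<bullet> x)) = (\<lambda>x. if x \<in> \<X> then m (\<theta> \<bullet> x) else 0)"
    by (auto simp: indicator_def)
  finally show ?thesis .
qed

lemma index_diffs_measurable:
  assumes "g \<in> \<G> B"
  shows "g \<in> borel_measurable borel"
proof -
  obtain m1 \<theta>1 m2 \<theta>2 where g: "g = index_diff \<X> m1 \<theta>1 m2 \<theta>2" "m1 \<in> convex_ball D B" "\<theta>1 \<in> index_space k"
     "m2 \<in> convex_ball D B" "\<theta>2 \<in> index_space k" using assms by (auto simp: index_diffs_def)
  have c: "continuous_on D m1" "continuous_on D m2"
    using g by (auto simp: convex_ball_def convex_lipschitz_def intro: lipschitz_on_continuous_on)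
  have "g = (\<lambda>x. (if x \<in> \<X> then m1 (\<theta>1 \<bullet> x) else 0) - (if x \<in> \<X> then m2 (\<theta>2 \<bullet> x) else 0))"
    by (auto simp: g(1) index_diff_def)
  then show ?thesis
    using borel_measurable_composition_index[OF c(1) g(3)] borel_measurable_composition_index[OF c(2) g(5)] by simp
qed

lemma index_diffs_nets:
  assumes B: "0 \<le> B"
  shows "\<exists>A C. subexp_nets \<X> (\<G> B) A C"
proof -
  have T: "0 \<le> T" using D by force
  \<comment> \<open>Each of the two ridge functions contributes 2 + d * T times 4^-j, the 2 from the
    link and d * T from the direction. The term 4 * B covers the diameter of the class, as scale 0
    requires.\<close>
  define C where "C = 2 * (2 + real CARD('d) * T) + 4 * B"
  have C: "0 < C" using T B by (simp add: C_def add_pos_nonneg)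
  obtain Km and cm :: "nat \<Rightarrow> (real \<Rightarrow> real) \<Rightarrow> int \<times> int \<times> int list" where
    cm: "subexp_code (convex_ball D B) (\<lambda>j m1 m2. \<forall>t\<in>D. \<bar>m1 t - m2 t\<bar> \<le> 2 / 4 ^ j) Km cm"
    using convex_ball_code[OF D(1,3,4) B] by blast
  obtain Kt and ct :: "nat \<Rightarrow> real ^ 'd \<Rightarrow> 'd \<Rightarrow> int" where
    ct: "subexp_code (index_space k) (\<lambda>j \<theta>1 \<theta>2. norm (\<theta>1 - \<theta>2) \<le> real CARD('d) / 4 ^ j) Kt ct"
    using index_space_code by blast
  define I where "I = (convex_ball D B \<times> index_space k) \<times> (convex_ball D B \<times> index_space k)"
  define K where "K j = (Km j \<times> Kt j) \<times> (Km j \<times> Kt j)" for j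
  define code where "code j = (\<lambda>((m1, \<theta>1), (m2, \<theta>2)). ((cm j m1, ct j \<theta>1), (cm j m2, ct j \<theta>2)))" for j
  define \<phi> where "\<phi> = (\<lambda>((m1, \<theta>1), (m2, \<theta>2)). index_diff \<X> m1 \<theta>1 m2 \<theta>2)"
  have G: "\<G> B = \<phi> ` I" by (force simp: index_diffs_def \<phi>_def I_def)
  have "subexp (\<lambda>j. real (card (K j)))"
    unfolding K_def card_cartesian_product of_nat_mult using cm ct by (intro subexp_mult) (auto simp: subexp_code_def)
  then obtain A where A: "0 \<le> A" "\<And>j. real (card (K j)) \<le> exp (A * 2 ^ j)" by (auto simp: subexp_def)
  have one: "\<bar>m (\<theta> \<bullet> x) - m' (\<theta>' \<bullet> x)\<bar> \<le> (2 + real CARD('d) * T) / 4 ^ j"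
    if m: "m \<in> convex_ball D B" "m' \<in> convex_ball D B" "cm j m = cm j m'"
      and \<theta>: "\<theta> \<in> index_space k" "\<theta>' \<in> index_space k" "ct j \<theta> = ct j \<theta>'" and x: "x \<in> \<X>" for j m m' \<theta> \<theta>' x
  proof -
    have "\<bar>m (\<theta> \<bullet> x) - m (\<theta>' \<bullet> x)\<bar> \<le> \<bar>\<theta> \<bullet> x - \<theta>' \<bullet> x\<bar>"
      using lipschitz_onD[of 1 D m "\<theta> \<bullet> x" "\<theta>' \<bullet> x"] m mem[OF x] \<theta>
      by (simp add: convex_ball_def convex_lipschitz_def dist_real_def)
    also have "\<dots> \<le> norm (\<theta> - \<theta>') * norm x"
      by (metis Cauchy_Schwarz_ineq2 inner_diff_left)
    also have "\<dots> \<le> (real CARD('d) / 4 ^ j) * T"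
      using ct \<theta> \<X>(2)[OF x] by (intro mult_mono) (auto simp: subexp_code_def)
    finally have "\<bar>m (\<theta> \<bullet> x) - m (\<theta>' \<bullet> x)\<bar> \<le> (real CARD('d) * T) / 4 ^ j" by simp
    moreover have "\<bar>m (\<theta>' \<bullet> x) - m' (\<theta>' \<bullet> x)\<bar> \<le> 2 / 4 ^ j"
      using cm m mem[OF x \<theta>(2)] by (auto simp: subexp_code_def)
    ultimately show ?thesis unfolding add_divide_distrib by linarith
  qed
  have close: "sup_close \<X> (C / 4 ^ j) (\<phi> p) (\<phi> p')" if "p \<in> I" "p' \<in> I" "code j p = code j p'" for j p p'
  proof -
    obtain m1 \<theta>1 m2 \<theta>2 where p: "p = ((m1, \<theta>1), (m2, \<theta>2))" by (metis prod.exhaust)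
    obtain n1 \<eta>1 n2 \<eta>2 where p': "p' = ((n1, \<eta>1), (n2, \<eta>2))" by (metis prod.exhaust)
    show ?thesis
      unfolding sup_close_def
    proof
      fix x assume x: "x \<in> \<X>"
      have "\<bar>m1 (\<theta>1 \<bullet> x) - n1 (\<eta>1 \<bullet> x)\<bar> \<le> (2 + real CARD('d) * T) / 4 ^ j"
        "\<bar>m2 (\<theta>2 \<bullet> x) - n2 (\<eta>2 \<bullet> x)\<bar> \<le> (2 + real CARD('d) * T) / 4 ^ j"
        using that x by (auto simp: p p' I_def code_def intro!: one)
      then have "\<bar>\<phi> p x - \<phi> p' x\<bar> \<le> 2 * ((2 + real CARD('d) * T) / 4 ^ j)"
        unfolding \<phi>_def p p' index_diff_def using x by (simp only: prod.case if_True)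
      also have "\<dots> \<le> C / 4 ^ j" using B by (simp add: C_def divide_right_mono)
      finally show "\<bar>\<phi> p x - \<phi> p' x\<bar> \<le> C / 4 ^ j" .
    qed
  qed
  have inK: "code j ` I \<subseteq> K j" for j
  proof -
    have "cm j m \<in> Km j" if "m \<in> convex_ball D B" for m
      using cm that unfolding subexp_code_def by blast
    moreover have "ct j \<theta> \<in> Kt j" if "\<theta> \<in> index_space k" for \<theta>
      using ct that unfolding subexp_code_def by blast
    ultimately show ?thesis unfolding code_def I_def K_def by (force simp del: prod.sel)
  qed
  have "subexp_nets \<X> (\<G> B) A C"
    unfolding subexp_nets_def
  proof (intro conjI A(1) C ballI allI impI)
    fix g g' assume g: "g \<in> \<G> B" "g' \<in> \<G> B"
    have "\<bar>g x - g' x\<bar> \<le> C" for x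
    proof -
      have "\<bar>g x - g' x\<bar> \<le> 4 * B"
        using index_diffs_bounded[OF B g(1), of x] index_diffs_bounded[OF B g(2), of x] by linarith
      also have "\<dots> \<le> C" using T by (simp add: C_def)
      finally show ?thesis .
    qed
    then show "sup_close \<X> C g g'" by (simp add: sup_close_def)
  next
    fix S j assume S: "S \<subseteq> \<G> B"
    have "finite (K j)" using cm ct by (simp add: K_def subexp_code_def)
    from net_of_code[OF this inK close S[unfolded G]]
    obtain N where "N \<subseteq> S" "finite N" "card N \<le> card (K j)" "\<forall>g\<in>S. \<exists>u\<in>N. sup_close \<X> (C / 4 ^ j) g u" by blast
    then show "\<exists>N\<subseteq>S. finite N \<and> real (card N) \<le> exp (A * 2 ^ j) \<and> (\<forall>g\<in>S. \<exists>u\<in>N. sup_close \<X> (C / 4 ^ j) g u)"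
      using A(2)[of j] by (meson of_nat_le_iff order_trans)
  qed
  then show ?thesis by blast
qed

end

section \<open>Maximal inequalities\<close>

text \<open>With d = 4^-k, the entropy term sqrt(n) * d^(3/4) is at most n * d^2 exactly when d is
  at least n^(-2/5). If d exceeds this threshold by the factor \<open>Q\<close>, a factor Q^(5/4) is
  gained, of which \<open>Q\<close> is kept. The second claim lets n * d^2 absorb constants, such as
  range terms for bounded variables.\<close>

lemma dyadic_radius_le:
  assumes n: "1 \<le> n" and Q: "1 \<le> Q" "Q * real n powr (- 2/5) \<le> 1 / 4 ^ k"
  shows "Q * (sqrt (real n) * (sqrt 2 ^ k / 4 ^ k)) \<le> real n * (1 / 4 ^ k)\<^sup>2"
    and "Q \<le> real n * (1 / 4 ^ k)\<^sup>2"
proof -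
  define d where "d = (1 / 4 ^ k :: real)"
  have d: "0 < d" by (simp add: d_def)
  have d4: "d = 4 powr (- real k)" by (simp add: d_def powr_minus powr_realpow inverse_eq_divide)
  have "sqrt 2 = 4 powr (1/4 :: real)"
  proof -
    have "4 powr (1/4 :: real) = (2 powr 2) powr (1/4)" by simp
    then show ?thesis unfolding powr_powr by (simp add: powr_half_sqrt)
  qed
  then have "sqrt 2 ^ k = 4 powr (real k / 4)" by (simp add: powr_power)
  then have "sqrt 2 ^ k / 4 ^ k = 4 powr (real k / 4) * d" by (simp add: d_def)
  also have "\<dots> = 4 powr (real k / 4 - real k)" unfolding d4 powr_add[symmetric] by simp
  also have "\<dots> = d powr (3/4)" unfolding d4 powr_powr by (simp add: mult.commute)
  finally have s: "sqrt 2 ^ k / 4 ^ k = d powr (3/4)" .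
  have Qd: "Q powr (5/4) * real n powr (- 1/2) \<le> d powr (5/4)"
  proof -
    have "Q powr (5/4) * real n powr (- 1/2) = (Q * real n powr (- 2/5)) powr (5/4)"
      using Q n by (simp add: powr_mult powr_powr)
    also have "\<dots> \<le> d powr (5/4)" using Q n by (intro powr_mono2) (auto simp: d_def)
    finally show ?thesis .
  qed
  have Q': "Q \<le> Q powr (5/4)" using powr_mono[of 1 "5/4" Q] Q by simp
  have "Q * real n powr (- 1/2) \<le> d powr (5/4)"
    using mult_right_mono[OF Q', of "real n powr (- 1/2)"] Qd by simp
  then have "Q * real n powr (- 1/2) * (real n * d powr (3/4)) \<le> d powr (5/4) * (real n * d powr (3/4))"
    by (rule mult_right_mono) simp
  then have "Q * ((real n * real n powr (- 1/2)) * d powr (3/4)) \<le> real n * (d powr (5/4) * d powr (3/4))"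
    by (simp only: mult_ac)
  moreover have "real n * real n powr (- 1/2) = sqrt (real n)"
    using n by (simp add: powr_mult_base powr_half_sqrt)
  moreover have "d powr (5/4) * d powr (3/4) = d\<^sup>2"
    using d by (simp add: powr_add[symmetric])
  ultimately show "Q * (sqrt (real n) * (sqrt 2 ^ k / 4 ^ k)) \<le> real n * (1 / 4 ^ k)\<^sup>2"
    unfolding s d_def[symmetric] by (simp only:)
  have "Q\<^sup>2 * real n powr (- 4/5) \<le> d\<^sup>2"
  proof -
    have "Q\<^sup>2 * real n powr (- 4/5) = (Q * real n powr (- 2/5))\<^sup>2"
      using n by (simp add: power_mult_distrib powr_power)
    also have "\<dots> \<le> d\<^sup>2" using Q n by (intro power_mono) (auto simp: d_def)
    finally show ?thesis .
  qed
  moreover have "Q * real n powr (- 1) \<le> Q\<^sup>2 * real n powr (- 4/5)"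
    using Q n by (intro mult_mono powr_mono) (auto simp: power2_eq_square)
  ultimately have "Q * real n powr (- 1) * real n \<le> d\<^sup>2 * real n" by (intro mult_right_mono) auto
  then show "Q \<le> real n * (1 / 4 ^ k)\<^sup>2"
    using n unfolding d_def[symmetric] by (simp add: powr_minus field_simps)
qed

lemma le_one_plus_powr:
  fixes x q :: real
  assumes "0 \<le> x" "2 \<le> q"
  shows "x \<le> 1 + x powr q" "x\<^sup>2 \<le> 1 + x powr q"
proof -
  have "x \<le> 1 + x powr q \<and> x\<^sup>2 \<le> 1 + x powr q"
  proof (cases "x \<le> 1")
    case True
    then have "x\<^sup>2 \<le> 1" using assms by (simp add: power_le_one)
    then show ?thesis using True by (simp add: add_increasing2)
  next
    case False
    then have "x powr 1 \<le> x powr q" "x powr 2 \<le> x powr q" using assms by (intro powr_mono; simp)+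
    then show ?thesis using False by simp
  qed
  then show "x \<le> 1 + x powr q" "x\<^sup>2 \<le> 1 + x powr q" by auto
qed

text \<open>The conditional moment assumptions are kept only as integrals against bounded functions
  of the design, which is the form in which they enter the mean and the variance of a link.\<close>

locale index_regression = prob_space M + index_geometry k \<X> D T
  for M :: "'w measure" and k :: "'d::finite" and \<X> :: "(real ^ 'd) set" and D :: "real set" and T :: real +
  fixes X :: "nat \<Rightarrow> 'w \<Rightarrow> real ^ 'd" and e :: "nat \<Rightarrow> 'w \<Rightarrow> real"
    and P :: "(real ^ 'd) measure" and \<sigma> q \<mu> :: real
  assumes indep: "indep_vars (\<lambda>_. borel) (\<lambda>i \<omega>. (X i \<omega>, e i \<omega>)) UNIV"
    and P: "\<And>i. distr M borel (X i) = P"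
    and X_in: "AE \<omega> in M. \<forall>i. X i \<omega> \<in> \<X>"
    and noise_mean: "\<And>i w c. w \<in> borel_measurable borel \<Longrightarrow> (\<And>x. \<bar>w x\<bar> \<le> c) \<Longrightarrow>
      expectation (\<lambda>\<omega>. e i \<omega> * w (X i \<omega>)) = 0"
    and noise_var: "\<And>i w c. w \<in> borel_measurable borel \<Longrightarrow> (\<And>x. \<bar>w x\<bar> \<le> c) \<Longrightarrow>
      expectation (\<lambda>\<omega>. (e i \<omega> * w (X i \<omega>))\<^sup>2) \<le> \<sigma>\<^sup>2 * (\<integral>x. (w x)\<^sup>2 \<partial>P)"
    and q: "2 \<le> q"
    and noise_moment: "\<And>i. integrable M (\<lambda>\<omega>. \<bar>e i \<omega>\<bar> powr q)" "\<And>i. expectation (\<lambda>\<omega>. \<bar>e i \<omega>\<bar> powr q) = \<mu>"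
begin

lemma pair_measurable [measurable]: "(\<lambda>\<omega>. (X i \<omega>, e i \<omega>)) \<in> borel_measurable M"
  using indep by (auto simp: indep_vars_def)

lemma X_measurable [measurable]: "X i \<in> borel_measurable M"
  using measurable_compose[OF pair_measurable[of i, unfolded borel_prod[symmetric]] measurable_fst] by simp

lemma e_measurable [measurable]: "e i \<in> borel_measurable M"
  using measurable_compose[OF pair_measurable[of i, unfolded borel_prod[symmetric]] measurable_snd] by simp

lemma indep_compose:
  assumes "\<And>i. (\<lambda>p. h i (fst p) (snd p)) \<in> borel_measurable (borel :: ((real ^ 'd) \<times> real) measure)"
  shows "indep_vars (\<lambda>_. borel) (\<lambda>i \<omega>. h i (X i \<omega>) (e i \<omega>) :: real) {..<n::nat}"
  using indep_vars_subset[OF indep_vars_compose2[OF indep, of "\<lambda>i p. h i (fst p) (snd p)" "\<lambda>_. borel"], of "{..<n}"] assms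
  by simp

lemma prob_space_P: "prob_space P"
  using prob_space_distr[OF X_measurable, of 0] P by simp

lemma sets_P [measurable_cong]: "sets P = sets borel"
  using P[of 0] by (metis sets_distr)

lemma AE_P: "AE x in P. x \<in> \<X>"
proof -
  have "AE \<omega> in M. X 0 \<omega> \<in> \<X>" using X_in by auto
  then show ?thesis
    unfolding P[of 0, symmetric] using \<X>(1) by (subst AE_distr_iff) (auto intro: borel_closed)
qed

lemma expectation_X:
  assumes [measurable]: "(h :: real ^ 'd \<Rightarrow> real) \<in> borel_measurable borel"
  shows "expectation (\<lambda>\<omega>. h (X i \<omega>)) = (\<integral>x. h x \<partial>P)"
  unfolding P[of i, symmetric] by (subst integral_distr) auto

lemma integrable_P:
  assumes [measurable]: "(h :: real ^ 'd \<Rightarrow> real) \<in> borel_measurable borel" and c: "\<And>x. \<bar>h x\<bar> \<le> c"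
  shows "integrable P h"
proof -
  interpret PP: prob_space P by (rule prob_space_P)
  show ?thesis using c by (intro PP.integrable_const_bound[where B = c]) auto
qed

lemma integrable_noise: "integrable M (e i)" "integrable M (\<lambda>\<omega>. (e i \<omega>)\<^sup>2)"
proof -
  note le = le_one_plus_powr[OF _ q]
  have I: "integrable M (\<lambda>\<omega>. 1 + \<bar>e i \<omega>\<bar> powr q)" using noise_moment by simp
  show "integrable M (e i)"
    by (rule Bochner_Integration.integrable_bound[OF I]) (use le in \<open>auto\<close>)
  show "integrable M (\<lambda>\<omega>. (e i \<omega>)\<^sup>2)"
    by (rule Bochner_Integration.integrable_bound[OF I]) (use le[of "\<bar>e i _\<bar>"] in \<open>auto\<close>)
qed

lemma expectation_abs_noise_le: "expectation (\<lambda>\<omega>. \<bar>e i \<omega>\<bar>) \<le> 1 + \<mu>"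
proof -
  note le = le_one_plus_powr[OF _ q]
  have "expectation (\<lambda>\<omega>. \<bar>e i \<omega>\<bar>) \<le> expectation (\<lambda>\<omega>. 1 + \<bar>e i \<omega>\<bar> powr q)"
    using integrable_noise noise_moment le by (intro integral_mono) auto
  also have "\<dots> = 1 + \<mu>" using noise_moment by (simp add: prob_space)
  finally show ?thesis .
qed

lemma moment_nonneg: "0 \<le> \<mu>"
  unfolding noise_moment(2)[of 0, symmetric] by simp

definition sqnorm :: "(real ^ 'd \<Rightarrow> real) \<Rightarrow> real" where
  "sqnorm u = (\<integral>x. (u x)\<^sup>2 \<partial>P)"

lemma sqnorm_nonneg: "0 \<le> sqnorm u"
  by (simp add: sqnorm_def)

lemma sqnorm_scale: "sqnorm (\<lambda>x. t * u x) = t\<^sup>2 * sqnorm u"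
  by (simp add: sqnorm_def power_mult_distrib)

lemma bounded_square_integrable:
  assumes [measurable]: "(u :: real ^ 'd \<Rightarrow> real) \<in> borel_measurable borel" and c: "\<And>x. \<bar>u x\<bar> \<le> c"
  shows "integrable P (\<lambda>x. (u x)\<^sup>2)"
proof (rule integrable_P[where c = "c\<^sup>2"])
  show "\<bar>(u x)\<^sup>2\<bar> \<le> c\<^sup>2" for x using c[of x] by (metis abs_ge_zero abs_power2 power2_abs power_mono)
qed simp

lemma sqnorm_diff_le:
  assumes [measurable]: "u \<in> borel_measurable borel" "v \<in> borel_measurable borel"
    and c: "\<And>x. \<bar>u x\<bar> \<le> c" "\<And>x. \<bar>v x\<bar> \<le> c"
  shows "sqnorm (\<lambda>x. u x - v x) \<le> 2 * sqnorm u + 2 * sqnorm v"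
proof -
  have I: "integrable P (\<lambda>x. (u x)\<^sup>2)" "integrable P (\<lambda>x. (v x)\<^sup>2)"
    using bounded_square_integrable assms by blast+
  have "\<bar>u x - v x\<bar> \<le> 2 * c" for x using c[of x] by linarith
  then have J: "integrable P (\<lambda>x. (u x - v x)\<^sup>2)" by (intro bounded_square_integrable) auto
  have "(u x - v x)\<^sup>2 \<le> 2 * (u x)\<^sup>2 + 2 * (v x)\<^sup>2" for x
    using zero_le_power2[of "u x + v x"] by (simp add: power2_eq_square algebra_simps)
  then have "sqnorm (\<lambda>x. u x - v x) \<le> (\<integral>x. 2 * (u x)\<^sup>2 + 2 * (v x)\<^sup>2 \<partial>P)"
    unfolding sqnorm_def using I J by (intro integral_mono) auto
  then show ?thesis using I by (simp add: sqnorm_def)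
qed

text \<open>\<open>c\<close> secures integrability on the whole space; the size is measured by
  \<open>d\<close> on \<open>\<X>\<close>, where \<open>P\<close> is concentrated.\<close>

lemma sqnorm_le_of_AE:
  assumes [measurable]: "u \<in> borel_measurable borel" and c: "\<And>x. \<bar>u x\<bar> \<le> c" and d: "\<And>x. x \<in> \<X> \<Longrightarrow> \<bar>u x\<bar> \<le> d"
  shows "sqnorm u \<le> d\<^sup>2"
proof -
  interpret PP: prob_space P by (rule prob_space_P)
  have "sqnorm u \<le> (\<integral>x. d\<^sup>2 \<partial>P)"
    unfolding sqnorm_def
  proof (rule integral_mono_AE[OF bounded_square_integrable[OF assms(1) c]])
    show "AE x in P. (u x)\<^sup>2 \<le> d\<^sup>2"
      using AE_P by eventually_elim (metis abs_ge_zero d power2_abs power_mono)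
  qed auto
  then show ?thesis by (simp add: PP.prob_space)
qed

end

section \<open>Lower bound for the empirical norm\<close>

context index_regression
begin

text \<open>Chaining for the centred process n * \<open>sqnorm u\<close> - (sum of u(X)^2). On
  functions bounded by 2 * B squaring is Lipschitz with constant 4 * B, so squares inherit the sup
  and L2 distances of the functions. \<open>Q\<close> is chosen, independently of n and of the
  radius, so large that the fluctuation is at most half of n * d^2; for functions of norm exactly d
  this leaves half of the expected sum.\<close>

lemma empirical_norm_lower:
  assumes B: "0 < B" and \<tau>: "1 \<le> \<tau>"
  shows "\<exists>Q\<ge>1. \<forall>n\<ge>1. \<forall>k0. Q * real n powr (- 2/5) \<le> 1 / 4 ^ k0 \<longrightarrow>
    (\<exists>E\<in>events. prob E \<le> 2 * exp (- \<tau>) \<and> (\<forall>\<omega>\<in>space M - E. (\<forall>i. X i \<omega> \<in> \<X>) \<longrightarrow>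
      (\<forall>g\<in>\<G> B. sqnorm g \<le> (1 / 4 ^ k0)\<^sup>2 \<longrightarrow> real n * sqnorm g - real n * (1 / 4 ^ k0)\<^sup>2 / 2 \<le> (\<Sum>i<n. (g (X i \<omega>))\<^sup>2))))"
proof -
  have B0: "0 \<le> B" using B by simp
  note Gm = index_diffs_measurable and Gb = index_diffs_bounded[OF B0]
  obtain A C where nets: "subexp_nets \<X> (\<G> B) A C" using index_diffs_nets[OF B0] by blast
  then have AC: "0 \<le> A" "0 < C"
    "\<And>g g'. g \<in> \<G> B \<Longrightarrow> g' \<in> \<G> B \<Longrightarrow> sup_close \<X> C g g'"
    "\<And>S j. S \<subseteq> \<G> B \<Longrightarrow> \<exists>N\<subseteq>S. finite N \<and> real (card N) \<le> exp (A * 2 ^ j) \<and> (\<forall>g\<in>S. \<exists>u\<in>N. sup_close \<X> (C / 4 ^ j) g u)"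
    by (simp_all add: subexp_nets_def)
  define \<kappa> where "\<kappa> = 3 * A + \<tau>"
  \<comment> \<open>\<open>W\<close> collects the deviation term, the range term and, in 8 * B * C,
    the error below the last scale. With Q = 2 * W + 1 the ratio W / Q is below 1/2.\<close>
  define W where "W = 2 * (8 * B) * sqrt \<kappa> * (3 + 2 * C) + 2 * C * (8 * B) * \<kappa> + 8 * B * C"
  have W: "0 \<le> W" using AC B \<tau> by (simp add: W_def \<kappa>_def)
  define Q where "Q = 2 * W + 1"
  have Q: "1 \<le> Q" using W by (simp add: Q_def)
  show ?thesis
  proof (intro exI[of _ Q] conjI Q allI impI)
    fix n k0 :: nat assume n: "1 \<le> n" and Qn: "Q * real n powr (- 2/5) \<le> 1 / 4 ^ k0"
    define S where "S = {g \<in> \<G> B. sqnorm g \<le> (1 / 4 ^ k0)\<^sup>2}"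
    have SG: "S \<subseteq> \<G> B" by (auto simp: S_def)
    define Z where "Z u i \<omega> = sqnorm u - (u (X i \<omega>))\<^sup>2" for u and i :: nat and \<omega>
    have dm: "(\<lambda>x. (v x)\<^sup>2 - (u x)\<^sup>2) \<in> borel_measurable borel" if "u \<in> S" "v \<in> S" for u v
      using Gm SG that by (intro borel_measurable_diff borel_measurable_power) auto
    have dw: "\<bar>(v x)\<^sup>2 - (u x)\<^sup>2\<bar> \<le> 4 * B * \<bar>u x - v x\<bar>" if "u \<in> S" "v \<in> S" for u v x
    proof -
      have "\<bar>(v x)\<^sup>2 - (u x)\<^sup>2\<bar> = \<bar>u x + v x\<bar> * \<bar>u x - v x\<bar>"
        by (simp add: power2_eq_square abs_mult[symmetric]) (simp add: abs_if algebra_simps)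
      also have "\<dots> \<le> (4 * B) * \<bar>u x - v x\<bar>"
      proof (rule mult_right_mono)
        have "u \<in> \<G> B" "v \<in> \<G> B" using that SG by auto
        from Gb[OF this(1), of x] Gb[OF this(2), of x] show "\<bar>u x + v x\<bar> \<le> 4 * B" by linarith
      qed simp
      finally show ?thesis .
    qed
    have db: "\<bar>(v x)\<^sup>2 - (u x)\<^sup>2\<bar> \<le> 16 * B\<^sup>2" if "u \<in> S" "v \<in> S" for u v x
    proof -
      have uv: "u \<in> \<G> B" "v \<in> \<G> B" using that SG by auto
      have "\<bar>u x - v x\<bar> \<le> 4 * B" using Gb[OF uv(1), of x] Gb[OF uv(2), of x] by linarith
      then have "4 * B * \<bar>u x - v x\<bar> \<le> 4 * B * (4 * B)" using B by (intro mult_left_mono) auto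
      then show ?thesis using dw[OF that, of x] by (simp add: power2_eq_square)
    qed
    have Zd: "Z u i \<omega> - Z v i \<omega> = ((v (X i \<omega>))\<^sup>2 - (u (X i \<omega>))\<^sup>2) - (\<integral>x. (v x)\<^sup>2 - (u x)\<^sup>2 \<partial>P)"
      if "u \<in> S" "v \<in> S" for u v i \<omega>
    proof -
      have "integrable P (\<lambda>x. (u x)\<^sup>2)" "integrable P (\<lambda>x. (v x)\<^sup>2)"
        using bounded_square_integrable Gm Gb that SG by blast+
      then show ?thesis by (simp add: Z_def sqnorm_def)
    qed
    interpret PP: prob_space P by (rule prob_space_P)
    have dI: "\<bar>\<integral>x. (v x)\<^sup>2 - (u x)\<^sup>2 \<partial>P\<bar> \<le> 4 * B * c" if uv: "u \<in> S" "v \<in> S" "sup_close \<X> c u v" for u v c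
    proof -
      have i: "integrable P (\<lambda>x. (v x)\<^sup>2 - (u x)\<^sup>2)" using integrable_P dm db uv by blast
      have "AE x in P. \<bar>(v x)\<^sup>2 - (u x)\<^sup>2\<bar> \<le> 4 * B * c"
        using AE_P
      proof eventually_elim
        case (elim x)
        then have "\<bar>u x - v x\<bar> \<le> c" using uv by (auto simp: sup_close_def)
        then have "4 * B * \<bar>u x - v x\<bar> \<le> 4 * B * c" using B by (intro mult_left_mono) auto
        then show ?case using dw[OF uv(1,2), of x] by linarith
      qed
      then have "(\<integral>x. \<bar>(v x)\<^sup>2 - (u x)\<^sup>2\<bar> \<partial>P) \<le> (\<integral>x. 4 * B * c \<partial>P)"
        using i by (intro integral_mono_AE) auto
      moreover have "\<bar>\<integral>x. (v x)\<^sup>2 - (u x)\<^sup>2 \<partial>P\<bar> \<le> (\<integral>x. \<bar>(v x)\<^sup>2 - (u x)\<^sup>2\<bar> \<partial>P)"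
        by (rule integral_abs_bound)
      moreover have "(\<integral>x. 4 * B * c \<partial>P) = 4 * B * c" by (simp add: PP.prob_space)
      ultimately show ?thesis by linarith
    qed
    have var: "expectation (\<lambda>\<omega>. (Z u i \<omega> - Z v i \<omega>)\<^sup>2) \<le> (4 * B)\<^sup>2 * sqnorm (\<lambda>x. u x - v x)"
      if uv: "u \<in> S" "v \<in> S" for u v i
    proof -
      let ?h = "\<lambda>x. (v x)\<^sup>2 - (u x)\<^sup>2"
      have [measurable]: "?h \<in> borel_measurable borel" by (rule dm[OF uv])
      have uvG: "u \<in> \<G> B" "v \<in> \<G> B" using uv SG by auto
      have I1: "integrable M (\<lambda>\<omega>. ?h (X i \<omega>))"
        by (rule integrable_const_bound[where B = "16 * B\<^sup>2"]) (use db[OF uv] in auto)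
      have I2': "integrable P (\<lambda>x. (?h x)\<^sup>2)" using dm db uv by (intro bounded_square_integrable) auto
      have I2: "integrable M (\<lambda>\<omega>. (?h (X i \<omega>))\<^sup>2)"
        using I2' unfolding P[of i, symmetric] by (subst (asm) integrable_distr_eq) auto
      have "expectation (\<lambda>\<omega>. (Z u i \<omega> - Z v i \<omega>)\<^sup>2) = expectation (\<lambda>\<omega>. (?h (X i \<omega>) - expectation (\<lambda>\<omega>. ?h (X i \<omega>)))\<^sup>2)"
        by (simp only: Zd[OF uv] expectation_X[OF dm[OF uv]])
      also have "\<dots> \<le> expectation (\<lambda>\<omega>. (?h (X i \<omega>))\<^sup>2)" using variance_eq[OF I1 I2] by simp
      also have "\<dots> = (\<integral>x. (?h x)\<^sup>2 \<partial>P)" by (rule expectation_X) simp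
      also have "\<dots> \<le> (\<integral>x. (4 * B)\<^sup>2 * (u x - v x)\<^sup>2 \<partial>P)"
      proof (rule integral_mono[OF I2'])
        have "\<bar>u x - v x\<bar> \<le> 4 * B" for x using Gb[OF uvG(1), of x] Gb[OF uvG(2), of x] by linarith
        then show "integrable P (\<lambda>x. (4 * B)\<^sup>2 * (u x - v x)\<^sup>2)"
          using Gm[OF uvG(1)] Gm[OF uvG(2)] by (intro integrable_mult_right bounded_square_integrable) auto
        show "(?h x)\<^sup>2 \<le> (4 * B)\<^sup>2 * (u x - v x)\<^sup>2" for x
          using power_mono[OF dw[OF uv, of x], of 2] by (simp add: power_mult_distrib)
      qed
      finally show ?thesis by (simp add: sqnorm_def)
    qed
    have sqd: "sqnorm (\<lambda>x. u x - v x) \<le> c\<^sup>2" if uv: "u \<in> S" "v \<in> S" "sup_close \<X> c u v" for u v c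
    proof -
      have uvG: "u \<in> \<G> B" "v \<in> \<G> B" using uv SG by auto
      have "\<bar>u x - v x\<bar> \<le> 4 * B" for x using Gb[OF uvG(1), of x] Gb[OF uvG(2), of x] by linarith
      then show ?thesis using uv Gm[OF uvG(1)] Gm[OF uvG(2)]
        by (intro sqnorm_le_of_AE[where c = "4 * B"]) (auto simp: sup_close_def)
    qed
    have sqd': "sqnorm (\<lambda>x. u x - v x) \<le> 4 * (1 / 4 ^ k0)\<^sup>2" if uv: "u \<in> S" "v \<in> S" for u v
    proof -
      have uvG: "u \<in> \<G> B" "v \<in> \<G> B" using uv SG by auto
      have "sqnorm (\<lambda>x. u x - v x) \<le> 2 * sqnorm u + 2 * sqnorm v"
        using Gm uvG Gb by (intro sqnorm_diff_le[where c = "2 * B"]) auto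
      then show ?thesis using uv by (simp add: S_def)
    qed
    \<comment> \<open>The drift is 0 by centring. In the range bound 8 * B is 4 * B for the square
      plus 4 * B for its mean; in the deviation bound it is 4 * B times the 2 from the diameter of
      \<open>S\<close>. The last scale is n, where 4^n is at least n, so replacing g by the net
      point costs only a constant over all n summands.\<close>
    have "\<exists>E\<in>events. prob E \<le> 2 * exp (- \<tau>) \<and>
    (\<forall>\<omega>\<in>space M - E. \<forall>g\<in>S. \<exists>u\<in>S. sup_close \<X> (C / 4 ^ n) g u \<and>
      (\<Sum>i<n. Z u i \<omega> - Z (\<lambda>_. 0) i \<omega>) \<le> 2 * real n * 0 * C
        + 2 * (8 * B) * sqrt (real n * (3 * A + \<tau>)) * ((3 + 2 * C) * (sqrt 2 ^ k0 / 4 ^ k0))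
        + 2 * C * (8 * B) * (3 * A + \<tau>))"
    proof (rule chaining_bound)
      show z: "(\<lambda>_. 0) \<in> S"
        unfolding S_def using index_diffs_zero[OF B0] by (simp add: sqnorm_def)
      show "sup_close \<X> C g (\<lambda>_. 0)" if "g \<in> S" for g using AC(3) SG that z by blast
      show "\<exists>N\<subseteq>S. finite N \<and> real (card N) \<le> exp (A * 2 ^ j) \<and> (\<forall>g\<in>S. \<exists>u\<in>N. sup_close \<X> (C / 4 ^ j) g u)" for j
        by (rule AC(4)[OF SG])
      show "indep_vars (\<lambda>_. borel) (\<lambda>i \<omega>. Z u i \<omega> - Z v i \<omega>) {..<n}" if uv: "u \<in> S" "v \<in> S" for u v
        unfolding Zd[OF uv]
      proof (rule indep_compose[where h = "\<lambda>i x e. ((v x)\<^sup>2 - (u x)\<^sup>2) - (\<integral>x. (v x)\<^sup>2 - (u x)\<^sup>2 \<partial>P)"])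
        show "(\<lambda>p :: (real ^ 'd) \<times> real. ((v (fst p))\<^sup>2 - (u (fst p))\<^sup>2) - (\<integral>x. (v x)\<^sup>2 - (u x)\<^sup>2 \<partial>P)) \<in> borel_measurable borel"
          unfolding borel_prod[symmetric] using measurable_compose[OF measurable_fst dm[OF uv]]
          by (intro borel_measurable_diff[where g = "\<lambda>_. integral\<^sup>L P _"]) auto
      qed
      show "AE \<omega> in M. \<bar>Z u i \<omega> - Z v i \<omega>\<bar> \<le> 8 * B * c"
        if uv: "u \<in> S" "v \<in> S" "sup_close \<X> c u v" for u v c i
        using X_in
      proof eventually_elim
        case (elim \<omega>)
        then have "\<bar>u (X i \<omega>) - v (X i \<omega>)\<bar> \<le> c" using uv by (auto simp: sup_close_def)
        then have "4 * B * \<bar>u (X i \<omega>) - v (X i \<omega>)\<bar> \<le> 4 * B * c" using B by (intro mult_left_mono) auto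
        then show ?case using dw[OF uv(1,2), of "X i \<omega>"] dI[OF uv] unfolding Zd[OF uv(1,2)] by linarith
      qed
      show "expectation (\<lambda>\<omega>. Z u i \<omega> - Z v i \<omega>) \<le> 0 * c" if uv: "u \<in> S" "v \<in> S" for u v c i
      proof -
        have "integrable M (\<lambda>\<omega>. (v (X i \<omega>))\<^sup>2 - (u (X i \<omega>))\<^sup>2)"
          by (rule integrable_const_bound[where B = "16 * B\<^sup>2"])
            (use db[OF uv] measurable_compose[OF X_measurable dm[OF uv]] in auto)
        then show ?thesis unfolding Zd[OF uv] using expectation_X[OF dm[OF uv], of i] by (simp add: prob_space)
      qed
      show "expectation (\<lambda>\<omega>. (Z u i \<omega> - Z v i \<omega>)\<^sup>2) \<le> (8 * B * c)\<^sup>2"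
        if uv: "u \<in> S" "v \<in> S" "sup_close \<X> c u v" for u v c i
      proof -
        have "(4 * B)\<^sup>2 * sqnorm (\<lambda>x. u x - v x) \<le> (4 * B)\<^sup>2 * c\<^sup>2" using sqd[OF uv] by (intro mult_left_mono) auto
        also have "\<dots> \<le> (8 * B * c)\<^sup>2" by (simp add: power_mult_distrib)
        finally show ?thesis using var[OF uv(1,2), of i] by linarith
      qed
      show "expectation (\<lambda>\<omega>. (Z u i \<omega> - Z v i \<omega>)\<^sup>2) \<le> (8 * B / 4 ^ k0)\<^sup>2" if uv: "u \<in> S" "v \<in> S" for u v i
      proof -
        have "(4 * B)\<^sup>2 * sqnorm (\<lambda>x. u x - v x) \<le> (4 * B)\<^sup>2 * (4 * (1 / 4 ^ k0)\<^sup>2)"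
          using sqd'[OF uv] by (intro mult_left_mono) auto
        also have "\<dots> = (8 * B / 4 ^ k0)\<^sup>2" by (simp add: power_mult_distrib power_divide)
        finally show ?thesis using var[OF uv(1,2), of i] by linarith
      qed
    qed (use AC B \<tau> n in auto)
    then obtain E where E: "E \<in> events" "prob E \<le> 2 * exp (- \<tau>)"
      and main: "\<And>\<omega> g. \<omega> \<in> space M - E \<Longrightarrow> g \<in> S \<Longrightarrow> \<exists>u\<in>S. sup_close \<X> (C / 4 ^ n) g u \<and>
      (\<Sum>i<n. Z u i \<omega>) \<le> 2 * (8 * B) * sqrt (real n * \<kappa>) * ((3 + 2 * C) * (sqrt 2 ^ k0 / 4 ^ k0)) + 2 * C * (8 * B) * \<kappa>"
      unfolding \<kappa>_def by (auto simp: Z_def sqnorm_def)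
    show "\<exists>E\<in>events. prob E \<le> 2 * exp (- \<tau>) \<and> (\<forall>\<omega>\<in>space M - E. (\<forall>i. X i \<omega> \<in> \<X>) \<longrightarrow>
      (\<forall>g\<in>\<G> B. sqnorm g \<le> (1 / 4 ^ k0)\<^sup>2 \<longrightarrow> real n * sqnorm g - real n * (1 / 4 ^ k0)\<^sup>2 / 2 \<le> (\<Sum>i<n. (g (X i \<omega>))\<^sup>2)))"
    proof (intro bexI[OF _ E(1)] conjI E(2) ballI impI)
      fix \<omega> g assume \<omega>: "\<omega> \<in> space M - E" and Xin: "\<forall>i. X i \<omega> \<in> \<X>" and g: "g \<in> \<G> B" "sqnorm g \<le> (1 / 4 ^ k0)\<^sup>2"
      then have gS: "g \<in> S" by (simp add: S_def)
      obtain u where u: "u \<in> S" "sup_close \<X> (C / 4 ^ n) g u"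
        "(\<Sum>i<n. Z u i \<omega>) \<le> 2 * (8 * B) * sqrt (real n * \<kappa>) * ((3 + 2 * C) * (sqrt 2 ^ k0 / 4 ^ k0)) + 2 * C * (8 * B) * \<kappa>"
        using main[OF \<omega> gS] by blast
      have n4: "real n \<le> 4 ^ n"
      proof -
        have "n \<le> 4 ^ n" by (rule less_imp_le[OF power_gt_expt]) simp
        then show ?thesis by (metis of_nat_le_iff of_nat_numeral of_nat_power)
      qed
      have "Z g i \<omega> - Z u i \<omega> \<le> 8 * B * (C / 4 ^ n)" for i
      proof -
        have "\<bar>g (X i \<omega>) - u (X i \<omega>)\<bar> \<le> C / 4 ^ n" using u Xin by (auto simp: sup_close_def)
        then have "4 * B * \<bar>g (X i \<omega>) - u (X i \<omega>)\<bar> \<le> 4 * B * (C / 4 ^ n)" using B by (intro mult_left_mono) auto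
        then show ?thesis using dw[OF gS u(1), of "X i \<omega>"] dI[OF gS u(1,2)] unfolding Zd[OF gS u(1)] by linarith
      qed
      then have "(\<Sum>i<n. Z g i \<omega> - Z u i \<omega>) \<le> (\<Sum>i<n. 8 * B * (C / 4 ^ n))" by (rule sum_mono)
      also have "\<dots> = 8 * B * C * (real n / 4 ^ n)" by simp
      also have "\<dots> \<le> 8 * B * C * 1" using n4 B AC by (intro mult_left_mono) auto
      finally have "(\<Sum>i<n. Z g i \<omega>) \<le> (\<Sum>i<n. Z u i \<omega>) + 8 * B * C" by (simp add: sum_subtractf)
      also have "\<dots> \<le> 2 * (8 * B) * sqrt \<kappa> * (3 + 2 * C) * (sqrt (real n) * (sqrt 2 ^ k0 / 4 ^ k0)) + (2 * C * (8 * B) * \<kappa> + 8 * B * C) * 1"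
        using u(3) by (simp add: real_sqrt_mult mult_ac)
      also have "\<dots> \<le> 2 * (8 * B) * sqrt \<kappa> * (3 + 2 * C) * (real n * (1 / 4 ^ k0)\<^sup>2 / Q) + (2 * C * (8 * B) * \<kappa> + 8 * B * C) * (real n * (1 / 4 ^ k0)\<^sup>2 / Q)"
        using dyadic_radius_le[OF n Q Qn] Q AC B \<tau>
        by (intro add_mono mult_left_mono) (auto simp: field_simps \<kappa>_def)
      also have "\<dots> = W * (real n * (1 / 4 ^ k0)\<^sup>2 / Q)" unfolding W_def by (simp only: distrib_right add.assoc)
      also have "\<dots> \<le> (Q / 2) * (real n * (1 / 4 ^ k0)\<^sup>2 / Q)"
        using Q by (intro mult_right_mono) (auto simp: Q_def)
      also have "\<dots> = real n * (1 / 4 ^ k0)\<^sup>2 / 2" using Q by simp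
      finally have "real n * sqnorm g - (\<Sum>i<n. (g (X i \<omega>))\<^sup>2) \<le> real n * (1 / 4 ^ k0)\<^sup>2 / 2"
        by (simp add: Z_def sum_subtractf)
      then show "real n * sqnorm g - real n * (1 / 4 ^ k0)\<^sup>2 / 2 \<le> (\<Sum>i<n. (g (X i \<omega>))\<^sup>2)" by linarith
    qed
  qed
qed

end

section \<open>Truncated noise and the upper bound for the noise term\<close>

definition clip :: "real \<Rightarrow> real \<Rightarrow> real" where
  "clip R x = (if \<bar>x\<bar> \<le> R then x else 0)"

lemma clip_measurable [measurable]: "clip R \<in> borel_measurable borel"
  unfolding clip_def by measurable

text \<open>Truncation acts only where |x| > R, and there |x| is at most R^(1 - p) * |x|^p. For
  noise with conditional mean zero, taking expectations bounds the bias by c * R^(1 - q) *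
  \<mu>.\<close>

lemma clip_mult_le:
  assumes R: "0 < R" and w: "\<bar>w\<bar> \<le> c" and p: "2 \<le> p"
  shows "clip R x * w \<le> x * w + c * R powr (1 - p) * \<bar>x\<bar> powr p"
proof (cases "\<bar>x\<bar> \<le> R")
  case False
  then have x: "0 < \<bar>x\<bar>" "R \<le> \<bar>x\<bar>" using R by auto
  have c: "0 \<le> c" using w by linarith
  have "R powr (p - 1) \<le> \<bar>x\<bar> powr (p - 1)" using x R p by (intro powr_mono2) auto
  then have "\<bar>x\<bar> * (R powr (1 - p) * R powr (p - 1)) \<le> \<bar>x\<bar> * (R powr (1 - p) * \<bar>x\<bar> powr (p - 1))"
    by (intro mult_left_mono) auto
  moreover have "R powr (1 - p) * R powr (p - 1) = 1" using R by (simp add: powr_add[symmetric])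
  moreover have "\<bar>x\<bar> * \<bar>x\<bar> powr (p - 1) = \<bar>x\<bar> powr p" using x by (simp add: powr_mult_base)
  ultimately have "\<bar>x\<bar> \<le> R powr (1 - p) * \<bar>x\<bar> powr p" by (metis mult.left_commute mult.right_neutral)
  then have "c * \<bar>x\<bar> \<le> c * (R powr (1 - p) * \<bar>x\<bar> powr p)" using c by (rule mult_left_mono)
  moreover have "- (x * w) \<le> c * \<bar>x\<bar>"
  proof -
    have "- (x * w) \<le> \<bar>x\<bar> * \<bar>w\<bar>" by (metis abs_ge_minus_self abs_mult)
    also have "\<dots> \<le> \<bar>x\<bar> * c" using w by (intro mult_left_mono) auto
    finally show ?thesis by (simp add: mult.commute)
  qed
  ultimately show ?thesis using False by (simp add: clip_def mult.assoc)
qed (use w in \<open>simp add: clip_def\<close>)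

context index_regression
begin

text \<open>Chaining is applied to the clipped noise, which equals the noise on the event that all
  its values are at most \<open>r * real n powr (1/q)\<close>. Bias and range then contribute terms
  of order n^(1/q), absorbed by the second condition on the radius, and the deviation is absorbed by
  the first. The bound \<open>K\<close> on the mean absolute noise is used below the last chaining
  scale.\<close>

lemma multiplier_upper:
  assumes B: "0 < B" and \<tau>: "1 \<le> \<tau>" and r: "0 < r" and K: "0 \<le> K"
  shows "\<exists>c\<ge>0. \<forall>n\<ge>1. \<forall>k0. real n powr (- 2/5) \<le> 1 / 4 ^ k0 \<longrightarrow> real n powr (1/q) \<le> real n * (1 / 4 ^ k0)\<^sup>2 \<longrightarrow>
    (\<exists>E\<in>events. prob E \<le> 2 * exp (- \<tau>) \<and> (\<forall>\<omega>\<in>space M - E. (\<forall>i. X i \<omega> \<in> \<X>) \<longrightarrow>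
      (\<forall>i<n. \<bar>e i \<omega>\<bar> \<le> r * real n powr (1/q)) \<longrightarrow> (\<Sum>i<n. \<bar>e i \<omega>\<bar>) \<le> real n * K \<longrightarrow>
      (\<forall>g\<in>\<G> B. sqnorm g \<le> (1 / 4 ^ k0)\<^sup>2 \<longrightarrow> (\<Sum>i<n. e i \<omega> * g (X i \<omega>)) \<le> c * (real n * (1 / 4 ^ k0)\<^sup>2))))"
proof -
  have B0: "0 \<le> B" using B by simp
  note Gm = index_diffs_measurable and Gb = index_diffs_bounded[OF B0]
  obtain A C where nets: "subexp_nets \<X> (\<G> B) A C" using index_diffs_nets[OF B0] by blast
  then have AC: "0 \<le> A" "0 < C"
    "\<And>g g'. g \<in> \<G> B \<Longrightarrow> g' \<in> \<G> B \<Longrightarrow> sup_close \<X> C g g'"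
    "\<And>S j. S \<subseteq> \<G> B \<Longrightarrow> \<exists>N\<subseteq>S. finite N \<and> real (card N) \<le> exp (A * 2 ^ j) \<and> (\<forall>g\<in>S. \<exists>u\<in>N. sup_close \<X> (C / 4 ^ j) g u)"
    by (simp_all add: subexp_nets_def)
  define \<kappa> where "\<kappa> = 3 * A + \<tau>"
  have \<kappa>: "0 < \<kappa>" using AC \<tau> by (simp add: \<kappa>_def)
  \<comment> \<open>The factor 2 comes from the diameter of \<open>S\<close>, which is twice its
    radius; the added 1 keeps \<open>s\<close> positive when \<sigma> = 0.\<close>
  define s where "s = 2 * \<bar>\<sigma>\<bar> + 1"
  \<comment> \<open>The four summands are the truncation bias, the deviation, the range and the
    error below the last scale.\<close>
  define c where "c = 2 * (\<mu> * r powr (1 - q)) * C + 2 * s * sqrt \<kappa> * (3 + 2 * C) + 2 * C * r * \<kappa> + C * K"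
  have c: "0 \<le> c" using AC B \<tau> r K moment_nonneg \<kappa> by (simp add: c_def s_def)
  show ?thesis
  proof (intro exI[of _ c] conjI c allI impI)
    fix n k0 :: nat
    assume n: "1 \<le> n" and n1: "real n powr (- 2/5) \<le> 1 / 4 ^ k0" and n2: "real n powr (1/q) \<le> real n * (1 / 4 ^ k0)\<^sup>2"
    define R where "R = r * real n powr (1/q)"
    have R: "0 < R" using r n by (simp add: R_def)
    define a where "a = \<mu> * R powr (1 - q)"
    have a: "0 \<le> a" using moment_nonneg by (simp add: a_def)
    \<comment> \<open>At truncation level R the summed bias is of order n * R^(1 - q). For R of
      order n^(1/q) this has the same order as R, so bias and range are balanced.\<close>
    have na: "real n * a = \<mu> * r powr (1 - q) * real n powr (1/q)"
    proof -
      have "R powr (1 - q) = r powr (1 - q) * real n powr (1/q - 1)"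
        using r n q by (simp add: R_def powr_mult powr_powr diff_divide_distrib)
      moreover have "real n * real n powr (1/q - 1) = real n powr (1/q)"
        using n by (simp add: powr_mult_base)
      ultimately show ?thesis by (simp add: a_def)
    qed
    define S where "S = {g \<in> \<G> B. sqnorm g \<le> (1 / 4 ^ k0)\<^sup>2}"
    have SG: "S \<subseteq> \<G> B" by (auto simp: S_def)
    define Z where "Z u i \<omega> = clip R (e i \<omega>) * u (X i \<omega>)" for u and i :: nat and \<omega>
    have Zd: "Z u i \<omega> - Z v i \<omega> = clip R (e i \<omega>) * (u (X i \<omega>) - v (X i \<omega>))" for u v i \<omega>
      by (simp add: Z_def algebra_simps)
    have dm: "(\<lambda>x. u x - v x) \<in> borel_measurable borel" if "u \<in> S" "v \<in> S" for u v
      using Gm SG that by (intro borel_measurable_diff) auto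
    have db: "\<bar>u x - v x\<bar> \<le> 4 * B" if "u \<in> S" "v \<in> S" for u v x
    proof -
      have uv: "u \<in> \<G> B" "v \<in> \<G> B" using that SG by auto
      show ?thesis using Gb[OF uv(1), of x] Gb[OF uv(2), of x] by linarith
    qed
    have sqd: "sqnorm (\<lambda>x. u x - v x) \<le> c\<^sup>2" if uv: "u \<in> S" "v \<in> S" "sup_close \<X> c u v" for u v c
      using dm[OF uv(1,2)] db[OF uv(1,2)] uv(3) by (intro sqnorm_le_of_AE[where c = "4 * B"]) (auto simp: sup_close_def)
    have sqd': "sqnorm (\<lambda>x. u x - v x) \<le> 4 * (1 / 4 ^ k0)\<^sup>2" if uv: "u \<in> S" "v \<in> S" for u v
    proof -
      have uvG: "u \<in> \<G> B" "v \<in> \<G> B" using uv SG by auto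
      have "sqnorm (\<lambda>x. u x - v x) \<le> 2 * sqnorm u + 2 * sqnorm v"
        using Gm uvG Gb by (intro sqnorm_diff_le[where c = "2 * B"]) auto
      then show ?thesis using uv by (simp add: S_def)
    qed
    have int: "integrable M (\<lambda>\<omega>. e i \<omega> * (u (X i \<omega>) - v (X i \<omega>)))"
      "integrable M (\<lambda>\<omega>. (e i \<omega> * (u (X i \<omega>) - v (X i \<omega>)))\<^sup>2)" if uv: "u \<in> S" "v \<in> S" for u v i
    proof -
      have [measurable]: "(\<lambda>\<omega>. u (X i \<omega>) - v (X i \<omega>)) \<in> borel_measurable M"
        using measurable_compose[OF X_measurable dm[OF uv]] .
      show "integrable M (\<lambda>\<omega>. e i \<omega> * (u (X i \<omega>) - v (X i \<omega>)))"
      proof (rule Bochner_Integration.integrable_bound)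
        show "integrable M (\<lambda>\<omega>. (4 * B) * e i \<omega>)" using integrable_noise by simp
        show "AE \<omega> in M. norm (e i \<omega> * (u (X i \<omega>) - v (X i \<omega>))) \<le> norm (4 * B * e i \<omega>)"
        proof (rule AE_I2)
          fix \<omega>
          have "\<bar>e i \<omega>\<bar> * \<bar>u (X i \<omega>) - v (X i \<omega>)\<bar> \<le> \<bar>e i \<omega>\<bar> * (4 * B)"
            using db[OF uv] by (intro mult_left_mono) auto
          then show "norm (e i \<omega> * (u (X i \<omega>) - v (X i \<omega>))) \<le> norm (4 * B * e i \<omega>)"
            using B by (simp add: abs_mult mult_ac)
        qed
      qed measurable
      show "integrable M (\<lambda>\<omega>. (e i \<omega> * (u (X i \<omega>) - v (X i \<omega>)))\<^sup>2)"
      proof (rule Bochner_Integration.integrable_bound)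
        show "integrable M (\<lambda>\<omega>. (4 * B)\<^sup>2 * (e i \<omega>)\<^sup>2)" using integrable_noise by simp
        show "AE \<omega> in M. norm ((e i \<omega> * (u (X i \<omega>) - v (X i \<omega>)))\<^sup>2) \<le> norm ((4 * B)\<^sup>2 * (e i \<omega>)\<^sup>2)"
        proof (rule AE_I2)
          fix \<omega>
          have "\<bar>u (X i \<omega>) - v (X i \<omega>)\<bar>\<^sup>2 \<le> (4 * B)\<^sup>2"
            using db[OF uv] by (intro power_mono) auto
          then have "(e i \<omega>)\<^sup>2 * \<bar>u (X i \<omega>) - v (X i \<omega>)\<bar>\<^sup>2 \<le> (e i \<omega>)\<^sup>2 * (4 * B)\<^sup>2"
            by (intro mult_left_mono) auto
          then show "norm ((e i \<omega> * (u (X i \<omega>) - v (X i \<omega>)))\<^sup>2) \<le> norm ((4 * B)\<^sup>2 * (e i \<omega>)\<^sup>2)"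
            by (simp add: power_mult_distrib mult_ac)
        qed
      qed measurable
    qed
    have var: "expectation (\<lambda>\<omega>. (Z u i \<omega> - Z v i \<omega>)\<^sup>2) \<le> \<sigma>\<^sup>2 * sqnorm (\<lambda>x. u x - v x)"
      if uv: "u \<in> S" "v \<in> S" for u v i
    proof -
      \<comment> \<open>Clipping can only decrease the square, so the conditional variance bound of
        the original noise applies.\<close>
      have "expectation (\<lambda>\<omega>. (Z u i \<omega> - Z v i \<omega>)\<^sup>2) \<le> expectation (\<lambda>\<omega>. (e i \<omega> * (u (X i \<omega>) - v (X i \<omega>)))\<^sup>2)"
        unfolding Zd using int(2)[OF uv] by (intro integral_mono') (auto simp: clip_def)
      also have "\<dots> \<le> \<sigma>\<^sup>2 * sqnorm (\<lambda>x. u x - v x)"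
        unfolding sqnorm_def by (rule noise_var[OF dm[OF uv] db[OF uv]])
      finally show ?thesis .
    qed
    have "\<exists>E\<in>events. prob E \<le> 2 * exp (- \<tau>) \<and>
    (\<forall>\<omega>\<in>space M - E. \<forall>g\<in>S. \<exists>u\<in>S. sup_close \<X> (C / 4 ^ n) g u \<and>
      (\<Sum>i<n. Z u i \<omega> - Z (\<lambda>_. 0) i \<omega>) \<le> 2 * real n * a * C
        + 2 * s * sqrt (real n * (3 * A + \<tau>)) * ((3 + 2 * C) * (sqrt 2 ^ k0 / 4 ^ k0))
        + 2 * C * R * (3 * A + \<tau>))"
    proof (rule chaining_bound)
      show z: "(\<lambda>_. 0) \<in> S"
        unfolding S_def using index_diffs_zero[OF B0] by (simp add: sqnorm_def)
      show "sup_close \<X> C g (\<lambda>_. 0)" if "g \<in> S" for g using AC(3) SG that z by blast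
      show "\<exists>N\<subseteq>S. finite N \<and> real (card N) \<le> exp (A * 2 ^ j) \<and> (\<forall>g\<in>S. \<exists>u\<in>N. sup_close \<X> (C / 4 ^ j) g u)" for j
        by (rule AC(4)[OF SG])
      show "indep_vars (\<lambda>_. borel) (\<lambda>i \<omega>. Z u i \<omega> - Z v i \<omega>) {..<n}" if uv: "u \<in> S" "v \<in> S" for u v
        unfolding Zd
      proof (rule indep_compose[where h = "\<lambda>i x e. clip R e * (u x - v x)"])
        show "(\<lambda>p :: (real ^ 'd) \<times> real. clip R (snd p) * (u (fst p) - v (fst p))) \<in> borel_measurable borel"
          unfolding borel_prod[symmetric]
          using measurable_compose[OF measurable_fst dm[OF uv]] measurable_compose[OF measurable_snd clip_measurable]
          by (intro borel_measurable_times) auto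
      qed
      show "AE \<omega> in M. \<bar>Z u i \<omega> - Z v i \<omega>\<bar> \<le> R * c"
        if uv: "u \<in> S" "v \<in> S" "sup_close \<X> c u v" for u v c i
        using X_in
      proof eventually_elim
        case (elim \<omega>)
        then have "\<bar>u (X i \<omega>) - v (X i \<omega>)\<bar> \<le> c" using uv by (auto simp: sup_close_def)
        then show ?case unfolding Zd abs_mult using R by (intro mult_mono) (auto simp: clip_def)
      qed
      show "expectation (\<lambda>\<omega>. Z u i \<omega> - Z v i \<omega>) \<le> a * c"
        if uv: "u \<in> S" "v \<in> S" "sup_close \<X> c u v" and i: "i < n" for u v c i
      proof -
        have [measurable]: "(\<lambda>\<omega>. u (X i \<omega>) - v (X i \<omega>)) \<in> borel_measurable M"
          using measurable_compose[OF X_measurable dm[OF uv(1,2)]] .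
        have I: "integrable M (\<lambda>\<omega>. clip R (e i \<omega>) * (u (X i \<omega>) - v (X i \<omega>)))"
          by (rule Bochner_Integration.integrable_bound[OF int(1)[OF uv(1,2)]]) (auto simp: clip_def)
        have "expectation (\<lambda>\<omega>. Z u i \<omega> - Z v i \<omega>)
            \<le> expectation (\<lambda>\<omega>. e i \<omega> * (u (X i \<omega>) - v (X i \<omega>)) + c * R powr (1 - q) * \<bar>e i \<omega>\<bar> powr q)"
          unfolding Zd
        proof (rule integral_mono_AE[OF I])
          show "AE \<omega> in M. clip R (e i \<omega>) * (u (X i \<omega>) - v (X i \<omega>))
            \<le> e i \<omega> * (u (X i \<omega>) - v (X i \<omega>)) + c * R powr (1 - q) * \<bar>e i \<omega>\<bar> powr q"
            using X_in
          proof eventually_elim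
            case (elim \<omega>)
            then have "\<bar>u (X i \<omega>) - v (X i \<omega>)\<bar> \<le> c" using uv by (auto simp: sup_close_def)
            then show ?case by (rule clip_mult_le[OF R _ q])
          qed
        qed (use int(1)[OF uv(1,2)] noise_moment in auto)
        also have "\<dots> = c * R powr (1 - q) * \<mu>"
          using int(1)[OF uv(1,2)] noise_moment noise_mean[OF dm[OF uv(1,2)] db[OF uv(1,2)]] by simp
        finally show ?thesis by (simp add: a_def mult_ac)
      qed
      show "expectation (\<lambda>\<omega>. (Z u i \<omega> - Z v i \<omega>)\<^sup>2) \<le> (s * c)\<^sup>2"
        if uv: "u \<in> S" "v \<in> S" "sup_close \<X> c u v" for u v c i
      proof -
        have "\<sigma>\<^sup>2 * sqnorm (\<lambda>x. u x - v x) \<le> s\<^sup>2 * c\<^sup>2" using sqd[OF uv]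
          by (intro mult_mono) (auto simp: s_def abs_le_square_iff[symmetric] sqnorm_nonneg)
        then show ?thesis using var[OF uv(1,2), of i] by (simp add: power_mult_distrib)
      qed
      show "expectation (\<lambda>\<omega>. (Z u i \<omega> - Z v i \<omega>)\<^sup>2) \<le> (s / 4 ^ k0)\<^sup>2" if uv: "u \<in> S" "v \<in> S" for u v i
      proof -
        have "(2 * \<bar>\<sigma>\<bar>)\<^sup>2 \<le> s\<^sup>2" by (intro power_mono) (auto simp: s_def)
        then have s4: "4 * \<sigma>\<^sup>2 \<le> s\<^sup>2" by (simp add: power_mult_distrib)
        have "\<sigma>\<^sup>2 * sqnorm (\<lambda>x. u x - v x) \<le> \<sigma>\<^sup>2 * (4 * (1 / 4 ^ k0)\<^sup>2)"
          using sqd'[OF uv] by (intro mult_left_mono) auto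
        also have "\<dots> \<le> s\<^sup>2 * (1 / 4 ^ k0)\<^sup>2"
          using mult_right_mono[OF s4, of "(1 / 4 ^ k0)\<^sup>2"] by (simp add: mult_ac)
        finally show ?thesis using var[OF uv(1,2), of i] by (simp add: power_divide)
      qed
    qed (use AC \<tau> n R a in \<open>auto simp: s_def\<close>)
    then obtain E where E: "E \<in> events" "prob E \<le> 2 * exp (- \<tau>)"
      and main: "\<And>\<omega> g. \<omega> \<in> space M - E \<Longrightarrow> g \<in> S \<Longrightarrow> \<exists>u\<in>S. sup_close \<X> (C / 4 ^ n) g u \<and>
      (\<Sum>i<n. Z u i \<omega>) \<le> 2 * real n * a * C + 2 * s * sqrt (real n * \<kappa>) * ((3 + 2 * C) * (sqrt 2 ^ k0 / 4 ^ k0)) + 2 * C * R * \<kappa>"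
      unfolding \<kappa>_def by (auto simp: Z_def)
    show "\<exists>E\<in>events. prob E \<le> 2 * exp (- \<tau>) \<and> (\<forall>\<omega>\<in>space M - E. (\<forall>i. X i \<omega> \<in> \<X>) \<longrightarrow>
      (\<forall>i<n. \<bar>e i \<omega>\<bar> \<le> r * real n powr (1/q)) \<longrightarrow> (\<Sum>i<n. \<bar>e i \<omega>\<bar>) \<le> real n * K \<longrightarrow>
      (\<forall>g\<in>\<G> B. sqnorm g \<le> (1 / 4 ^ k0)\<^sup>2 \<longrightarrow> (\<Sum>i<n. e i \<omega> * g (X i \<omega>)) \<le> c * (real n * (1 / 4 ^ k0)\<^sup>2)))"
    proof (intro bexI[OF _ E(1)] conjI E(2) ballI impI)
      fix \<omega> g assume \<omega>: "\<omega> \<in> space M - E" and Xin: "\<forall>i. X i \<omega> \<in> \<X>" and g: "g \<in> \<G> B" "sqnorm g \<le> (1 / 4 ^ k0)\<^sup>2"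
        and small: "\<forall>i<n. \<bar>e i \<omega>\<bar> \<le> r * real n powr (1/q)" and eK: "(\<Sum>i<n. \<bar>e i \<omega>\<bar>) \<le> real n * K"
      then have gS: "g \<in> S" by (simp add: S_def)
      obtain u where u: "u \<in> S" "sup_close \<X> (C / 4 ^ n) g u"
        "(\<Sum>i<n. Z u i \<omega>) \<le> 2 * real n * a * C + 2 * s * sqrt (real n * \<kappa>) * ((3 + 2 * C) * (sqrt 2 ^ k0 / 4 ^ k0)) + 2 * C * R * \<kappa>"
        using main[OF \<omega> gS] by blast
      have n4: "real n \<le> 4 ^ n"
      proof -
        have "n \<le> 4 ^ n" by (rule less_imp_le[OF power_gt_expt]) simp
        then show ?thesis by (metis of_nat_le_iff of_nat_numeral of_nat_power)
      qed
      define H where "H = real n * (1 / 4 ^ k0)\<^sup>2"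
      have H: "real n powr (1/q) \<le> H" "sqrt (real n) * (sqrt 2 ^ k0 / 4 ^ k0) \<le> H" "1 \<le> H"
        using n2 dyadic_radius_le[OF n, of 1 k0] n1 by (auto simp: H_def)
      have eZ: "Z v i \<omega> = e i \<omega> * v (X i \<omega>)" if "i < n" for v i
        using small that by (simp add: Z_def clip_def R_def)
      have "(\<Sum>i<n. Z g i \<omega> - Z u i \<omega>) \<le> (\<Sum>i<n. \<bar>e i \<omega>\<bar> * (C / 4 ^ n))"
      proof (rule sum_mono)
        fix i
        have "\<bar>g (X i \<omega>) - u (X i \<omega>)\<bar> \<le> C / 4 ^ n" using u Xin by (auto simp: sup_close_def)
        then have "\<bar>clip R (e i \<omega>) * (g (X i \<omega>) - u (X i \<omega>))\<bar> \<le> \<bar>e i \<omega>\<bar> * (C / 4 ^ n)"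
          unfolding abs_mult by (intro mult_mono) (auto simp: clip_def)
        then show "Z g i \<omega> - Z u i \<omega> \<le> \<bar>e i \<omega>\<bar> * (C / 4 ^ n)" unfolding Zd by linarith
      qed
      also have "\<dots> = (\<Sum>i<n. \<bar>e i \<omega>\<bar>) * (C / 4 ^ n)" by (rule sum_distrib_right[symmetric])
      also have "\<dots> \<le> (real n * K) * (C / 4 ^ n)" using eK AC by (intro mult_right_mono) auto
      also have "\<dots> = C * K * (real n / 4 ^ n)" by simp
      also have "\<dots> \<le> C * K * 1" using n4 AC K by (intro mult_left_mono) auto
      also have "\<dots> \<le> C * K * H" using H AC K by (intro mult_left_mono) auto
      finally have "(\<Sum>i<n. Z g i \<omega>) \<le> (\<Sum>i<n. Z u i \<omega>) + C * K * H" by (simp add: sum_subtractf)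
      also have "(\<Sum>i<n. Z u i \<omega>) \<le> 2 * (\<mu> * r powr (1 - q)) * C * real n powr (1/q)
          + 2 * s * sqrt \<kappa> * (3 + 2 * C) * (sqrt (real n) * (sqrt 2 ^ k0 / 4 ^ k0)) + 2 * C * r * \<kappa> * real n powr (1/q)"
      proof -
        have e1: "2 * real n * a * C = 2 * (\<mu> * r powr (1 - q)) * C * real n powr (1/q)"
        proof -
          have "2 * real n * a * C = 2 * (real n * a) * C" by simp
          then show ?thesis unfolding na by simp
        qed
        have e2: "2 * s * sqrt (real n * \<kappa>) * ((3 + 2 * C) * (sqrt 2 ^ k0 / 4 ^ k0))
          = 2 * s * sqrt \<kappa> * (3 + 2 * C) * (sqrt (real n) * (sqrt 2 ^ k0 / 4 ^ k0))"
          by (simp add: real_sqrt_mult)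
        have e3: "2 * C * R * \<kappa> = 2 * C * r * \<kappa> * real n powr (1/q)" by (simp add: R_def)
        show ?thesis using u(3) unfolding e1 e2 e3 .
      qed
      also have "\<dots> \<le> 2 * (\<mu> * r powr (1 - q)) * C * H + 2 * s * sqrt \<kappa> * (3 + 2 * C) * H + 2 * C * r * \<kappa> * H"
        using H AC r \<kappa> moment_nonneg by (intro add_mono mult_left_mono) (auto simp: s_def)
      also have "\<dots> + C * K * H = c * H" unfolding c_def by (simp only: distrib_right)
      finally show "(\<Sum>i<n. e i \<omega> * g (X i \<omega>)) \<le> c * (real n * (1 / 4 ^ k0)\<^sup>2)"
        using eZ by (simp add: H_def)
    qed
  qed
qed

end

section \<open>From the basic inequality to the rate\<close>

text \<open>Chaining is available at radii 4^-k only; this replaces a given radius by such a power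
  at the price of a factor 4.\<close>

lemma dyadic_between:
  fixes x :: real
  assumes "0 < x" "x \<le> 1"
  obtains k :: nat where "x \<le> 1 / 4 ^ k" "1 / 4 ^ k \<le> 4 * x"
proof -
  obtain j :: nat where j: "1 / x < 4 ^ j" using real_arch_pow[of 4 "1 / x"] by auto
  define l where "l = (LEAST j :: nat. 1 / x < 4 ^ j)"
  have l: "1 / x < 4 ^ l" unfolding l_def using j by (rule LeastI)
  have "l \<noteq> 0" using l assms by (intro notI) (simp add: field_simps)
  then obtain k where k: "l = Suc k" by (cases l) auto
  have "\<not> 1 / x < 4 ^ k" using not_less_Least[of k "\<lambda>j. 1 / x < 4 ^ j"] k by (simp add: l_def)
  then have "x \<le> 1 / 4 ^ k" using assms by (simp add: field_simps)
  moreover have "1 / 4 ^ k \<le> 4 * x" using l assms by (simp add: k field_simps)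
  ultimately show ?thesis by (rule that)
qed

text \<open>The deterministic core: \<rho> is the norm of g, \<open>s\<close> the empirical mean of
  g^2 and \<open>t\<close> that of the noise times g. Below \<delta> the bound is immediate and
  yields the term L * x. Otherwise L * \<rho>^2 is at most 4 * t, and \<rho> is compared with
  \<eta>. The part of \<eta> due to \<open>x\<close> fits under L * x because sqrt L is at most L /
  sqrt L0.\<close>

lemma rate_of_basic_inequality:
  fixes L L0 \<rho> \<delta> \<eta> c Q x y s t :: real
  assumes L: "0 < L0" "L0 \<le> L" and pos: "0 \<le> \<rho>" "0 \<le> x" "0 \<le> y" "0 < \<delta>" "0 < \<eta>" "0 \<le> c" "0 \<le> Q"
    and \<delta>: "\<delta> \<le> 4 * (Q * x)" and \<eta>: "\<eta> \<le> 4 * max x y"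
    and low: "\<delta> \<le> \<rho> \<Longrightarrow> \<rho>\<^sup>2 / 2 \<le> s"
    and up: "\<rho> \<le> \<eta> \<Longrightarrow> t \<le> c * \<eta>\<^sup>2" "\<eta> < \<rho> \<Longrightarrow> t \<le> c * \<rho> * \<eta>"
    and basic: "L * s \<le> 2 * t"
  shows "L * \<rho> \<le> (4 * Q + (2 * sqrt c + 4 * c / sqrt L0) * (4 * (1 + 1 / sqrt L0))) * max (L * x) (sqrt L * y)"
proof -
  have L': "0 < L" using L by simp
  define m where "m = max (L * x) (sqrt L * y)"
  have m: "L * x \<le> m" "sqrt L * y \<le> m" by (auto simp: m_def)
  have m0: "0 \<le> m" using m(1) pos L' by (meson less_imp_le mult_nonneg_nonneg order_trans)
  define b where "b = 2 * sqrt c + 4 * c / sqrt L0"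
  have b: "0 \<le> b" using pos L by (simp add: b_def)
  have \<eta>m: "sqrt L * \<eta> \<le> 4 * (1 + 1 / sqrt L0) * m"
  proof -
    have "sqrt L * x \<le> (1 / sqrt L0) * m"
    proof -
      have "sqrt L0 * sqrt L \<le> sqrt L * sqrt L" using L L' by (intro mult_right_mono) auto
      then have "sqrt L0 * sqrt L \<le> L" using L' by simp
      then have "sqrt L0 * sqrt L * x \<le> L * x" using pos by (intro mult_right_mono) auto
      then have "sqrt L0 * (sqrt L * x) \<le> m" using m by simp
      then show ?thesis using L by (simp add: field_simps)
    qed
    moreover have "0 \<le> (1 / sqrt L0) * m" using L m0 by simp
    ultimately have "sqrt L * max x y \<le> (1 + 1 / sqrt L0) * m"
      using m m0 by (cases "x \<le> y") (simp_all add: max_def distrib_right)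
    moreover have "sqrt L * \<eta> \<le> sqrt L * (4 * max x y)" using \<eta> L' by (intro mult_left_mono) auto
    ultimately have "sqrt L * \<eta> \<le> 4 * ((1 + 1 / sqrt L0) * m)" by simp
    then show ?thesis by (simp only: mult.assoc)
  qed
  have split: "L * \<rho> \<le> 4 * Q * m \<or> L * \<rho> \<le> b * (sqrt L * \<eta>)"
  proof (cases "\<delta> \<le> \<rho>")
    case False
    then have "L * \<rho> \<le> L * (4 * (Q * x))" using L' \<delta> by (intro mult_left_mono) auto
    also have "\<dots> = 4 * Q * (L * x)" by simp
    also have "\<dots> \<le> 4 * Q * m" using m pos by (intro mult_left_mono) auto
    finally show ?thesis by simp
  next
    case True
    have "L * (\<rho>\<^sup>2 / 2) \<le> L * s" using low[OF True] L' by (intro mult_left_mono) auto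
    then have B: "L * \<rho>\<^sup>2 \<le> 4 * t" using basic by simp
    show ?thesis
    proof (cases "\<rho> \<le> \<eta>")
      case True
      \<comment> \<open>Here the factor sqrt L arises: L * \<rho>^2 is at most a constant times
        \<eta>^2, and multiplying by L before taking the root leaves sqrt L * \<eta>.\<close>
      have "(L * \<rho>)\<^sup>2 = L * (L * \<rho>\<^sup>2)" by (simp add: power2_eq_square)
      also have "\<dots> \<le> L * (4 * (c * \<eta>\<^sup>2))" using B up(1)[OF True] L' by (intro mult_left_mono) auto
      also have "\<dots> = (2 * sqrt c * (sqrt L * \<eta>))\<^sup>2"
        unfolding power_mult_distrib real_sqrt_pow2[OF pos(6)] real_sqrt_pow2[OF less_imp_le[OF L']] by simp
      finally have "L * \<rho> \<le> 2 * sqrt c * (sqrt L * \<eta>)"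
        by (rule power2_le_imp_le) (use L' pos in simp)
      also have "\<dots> \<le> b * (sqrt L * \<eta>)" using L L' pos by (intro mult_right_mono) (auto simp: b_def)
      finally show ?thesis by simp
    next
      case False
      then have \<rho>: "0 < \<rho>" using pos by simp
      \<comment> \<open>The noise bound is linear in \<rho>, so one factor cancels. The result has
        no power of L on the right and is enlarged by sqrt (L / L0).\<close>
      have "L * \<rho> * \<rho> \<le> 4 * c * \<eta> * \<rho>" using B up(2) False by (simp add: power2_eq_square mult_ac)
      then have "L * \<rho> \<le> 4 * c * \<eta>" using \<rho> by simp
      also have "\<dots> \<le> (4 * c / sqrt L0) * (sqrt L * \<eta>)"
      proof -
        have "1 \<le> sqrt L / sqrt L0" using L by simp
        then have "4 * c * \<eta> * 1 \<le> 4 * c * \<eta> * (sqrt L / sqrt L0)" using pos by (intro mult_left_mono) auto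
        then show ?thesis by (simp add: mult_ac)
      qed
      also have "\<dots> \<le> b * (sqrt L * \<eta>)" using L L' pos by (intro mult_right_mono) (auto simp: b_def)
      finally show ?thesis by simp
    qed
  qed
  have "b * (sqrt L * \<eta>) \<le> b * (4 * (1 + 1 / sqrt L0)) * m"
    using mult_left_mono[OF \<eta>m b] by (simp add: mult_ac)
  moreover have "0 \<le> b * (4 * (1 + 1 / sqrt L0)) * m" "0 \<le> 4 * Q * m" using b m0 L pos by simp_all
  ultimately have "L * \<rho> \<le> 4 * Q * m + b * (4 * (1 + 1 / sqrt L0)) * m" using split by linarith
  then show ?thesis unfolding m_def b_def by (simp only: distrib_right)
qed

context index_regression
begin

text \<open>Markov's inequality for q-th powers gives each index a probability of order 1 / n at the
  level n^(1/q), and the union bound adds up n of them.\<close>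

lemma noise_max_prob:
  assumes r: "0 < r" and n: "1 \<le> n"
  shows "{\<omega> \<in> space M. \<exists>i<n. \<bar>e i \<omega>\<bar> > r * real n powr (1/q)} \<in> events"
    and "prob {\<omega> \<in> space M. \<exists>i<n. \<bar>e i \<omega>\<bar> > r * real n powr (1/q)} \<le> \<mu> / r powr q"
proof -
  define F where "F i = {\<omega> \<in> space M. \<bar>e i \<omega>\<bar> powr q \<ge> r powr q * real n}" for i
  have F: "F i \<in> events" for i unfolding F_def by measurable
  have pF: "prob (F i) \<le> \<mu> / (r powr q * real n)" for i
    unfolding F_def noise_moment(2)[of i, symmetric] using r n noise_moment(1)
    by (intro integral_Markov_inequality_measure[where A = "{}"]) auto
  have sub: "{\<omega> \<in> space M. \<exists>i<n. \<bar>e i \<omega>\<bar> > r * real n powr (1/q)} \<subseteq> (\<Union>i<n. F i)"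
  proof safe
    fix \<omega> i assume \<omega>: "\<omega> \<in> space M" and i: "i < n" and gt: "\<bar>e i \<omega>\<bar> > r * real n powr (1/q)"
    have "(r * real n powr (1/q)) powr q \<le> \<bar>e i \<omega>\<bar> powr q" using gt r q by (intro powr_mono2) auto
    also have "(r * real n powr (1/q)) powr q = r powr q * real n"
      using r n q by (simp add: powr_mult powr_powr)
    finally show "\<omega> \<in> (\<Union>i<n. F i)" using \<omega> i by (auto simp: F_def)
  qed
  show "{\<omega> \<in> space M. \<exists>i<n. \<bar>e i \<omega>\<bar> > r * real n powr (1/q)} \<in> events" by measurable
  have "prob {\<omega> \<in> space M. \<exists>i<n. \<bar>e i \<omega>\<bar> > r * real n powr (1/q)} \<le> prob (\<Union>i<n. F i)"
    using sub F by (intro finite_measure_mono) auto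
  also have "\<dots> \<le> (\<Sum>i<n. prob (F i))" using F by (intro finite_measure_subadditive_finite) auto
  also have "\<dots> \<le> (\<Sum>i<n. \<mu> / (r powr q * real n))" by (intro sum_mono pF)
  also have "\<dots> = \<mu> / r powr q" using n by simp
  finally show "prob {\<omega> \<in> space M. \<exists>i<n. \<bar>e i \<omega>\<bar> > r * real n powr (1/q)} \<le> \<mu> / r powr q" .
qed

lemma noise_mean_prob:
  assumes K: "0 < K" and n: "1 \<le> n"
  shows "{\<omega> \<in> space M. (\<Sum>i<n. \<bar>e i \<omega>\<bar>) \<ge> real n * K} \<in> events"
    and "prob {\<omega> \<in> space M. (\<Sum>i<n. \<bar>e i \<omega>\<bar>) \<ge> real n * K} \<le> (1 + \<mu>) / K"
proof -
  show "{\<omega> \<in> space M. (\<Sum>i<n. \<bar>e i \<omega>\<bar>) \<ge> real n * K} \<in> events" by measurable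
  have "prob {\<omega> \<in> space M. (\<Sum>i<n. \<bar>e i \<omega>\<bar>) \<ge> real n * K} \<le> expectation (\<lambda>\<omega>. \<Sum>i<n. \<bar>e i \<omega>\<bar>) / (real n * K)"
    using K n integrable_noise(1)
    by (intro integral_Markov_inequality_measure[where A = "{}"]) (auto intro!: AE_I2 sum_nonneg)
  also have "expectation (\<lambda>\<omega>. \<Sum>i<n. \<bar>e i \<omega>\<bar>) = (\<Sum>i<n. expectation (\<lambda>\<omega>. \<bar>e i \<omega>\<bar>))"
    using integrable_noise(1) by (intro Bochner_Integration.integral_sum) auto
  also have "(\<Sum>i<n. expectation (\<lambda>\<omega>. \<bar>e i \<omega>\<bar>)) / (real n * K) \<le> (\<Sum>i<n. 1 + \<mu>) / (real n * K)"
    using expectation_abs_noise_le K by (intro divide_right_mono sum_mono) auto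
  also have "\<dots> = (1 + \<mu>) / K" using n by simp
  finally show "prob {\<omega> \<in> space M. (\<Sum>i<n. \<bar>e i \<omega>\<bar>) \<ge> real n * K} \<le> (1 + \<mu>) / K" .
qed

text \<open>
  The class is star-shaped, so the two maximal inequalities, which control functions of norm at most
  the given radius, extend to all functions by rescaling.
\<close>

lemma rescale_to_radius:
  assumes g: "g \<in> \<G> B" and \<rho>: "\<rho> = sqrt (sqnorm g)" and \<delta>: "0 < \<delta>" "\<delta> \<le> \<rho>"
  shows "(\<lambda>x. \<delta> / \<rho> * g x) \<in> \<G> B" "sqnorm (\<lambda>x. \<delta> / \<rho> * g x) = \<delta>\<^sup>2"
proof -
  have "0 < \<rho>" using \<delta> by simp
  then show "(\<lambda>x. \<delta> / \<rho> * g x) \<in> \<G> B" using g \<delta> by (intro index_diffs_scale) auto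
  have "sqnorm g = \<rho>\<^sup>2" by (simp add: \<rho> sqnorm_nonneg)
  then show "sqnorm (\<lambda>x. \<delta> / \<rho> * g x) = \<delta>\<^sup>2"
    unfolding sqnorm_scale using \<open>0 < \<rho>\<close> by (simp add: power_divide)
qed

text \<open>A single exceptional event serves all L at once, since the class does not depend on L
  and L enters only through the deterministic argument. The event is a union of four, each of
  probability at most \<epsilon> / 4.\<close>

lemma basic_inequality_rate:
  assumes B: "0 < B" and K: "0 < K" and L0: "0 < L0" and \<epsilon>: "0 < \<epsilon>" and K\<epsilon>: "(1 + \<mu>) / K \<le> \<epsilon> / 4"
  shows "\<exists>c\<ge>0. \<forall>\<^sub>F n in sequentially. \<exists>A\<in>events. prob A \<le> \<epsilon> \<and>
    (\<forall>\<omega>\<in>space M - A. (\<forall>i. X i \<omega> \<in> \<X>) \<longrightarrow> (\<Sum>i<n. \<bar>e i \<omega>\<bar>) \<le> real n * K \<and>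
      (\<forall>g\<in>\<G> B. \<forall>L\<ge>L0. L * (\<Sum>i<n. (g (X i \<omega>))\<^sup>2) \<le> 2 * (\<Sum>i<n. e i \<omega> * g (X i \<omega>)) \<longrightarrow>
         L * sqrt (sqnorm g) \<le> c * max (L * real n powr (- 2/5)) (sqrt L * real n powr (1/(2*q) - 1/2))))"
proof -
  define \<tau> where "\<tau> = max 1 (ln (8 / \<epsilon>))"
  have \<tau>: "1 \<le> \<tau>" by (simp add: \<tau>_def)
  have e\<tau>: "2 * exp (- \<tau>) \<le> \<epsilon> / 4"
  proof -
    have "exp (- \<tau>) \<le> exp (- ln (8 / \<epsilon>))" by (simp add: \<tau>_def)
    also have "\<dots> = \<epsilon> / 8" using \<epsilon> by (simp add: exp_minus)
    finally show ?thesis by simp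
  qed
  \<comment> \<open>Solves r^q = 4 * (\<mu> + 1) / \<epsilon>, so that large noise values have
    probability at most \<epsilon> / 4; \<mu> + 1 keeps \<open>r\<close> positive.\<close>
  define r where "r = (4 * (\<mu> + 1) / \<epsilon>) powr (1/q)"
  have r: "0 < r" using \<epsilon> moment_nonneg by (simp add: r_def)
  have rq: "\<mu> / r powr q \<le> \<epsilon> / 4"
  proof -
    have "r powr q = 4 * (\<mu> + 1) / \<epsilon>" using \<epsilon> moment_nonneg q by (simp add: r_def powr_powr)
    moreover have "\<mu> / (4 * (\<mu> + 1) / \<epsilon>) = (\<mu> / (\<mu> + 1)) * (\<epsilon> / 4)" by simp
    moreover have "(\<mu> / (\<mu> + 1)) * (\<epsilon> / 4) \<le> 1 * (\<epsilon> / 4)"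
      using \<epsilon> moment_nonneg by (intro mult_right_mono) auto
    ultimately show ?thesis by (simp only: mult_1)
  qed
  obtain Q where Q: "1 \<le> Q" and low: "\<And>n k0. 1 \<le> n \<Longrightarrow> Q * real n powr (- 2/5) \<le> 1 / 4 ^ k0 \<Longrightarrow>
    \<exists>E\<in>events. prob E \<le> 2 * exp (- \<tau>) \<and> (\<forall>\<omega>\<in>space M - E. (\<forall>i. X i \<omega> \<in> \<X>) \<longrightarrow>
      (\<forall>g\<in>\<G> B. sqnorm g \<le> (1 / 4 ^ k0)\<^sup>2 \<longrightarrow> real n * sqnorm g - real n * (1 / 4 ^ k0)\<^sup>2 / 2 \<le> (\<Sum>i<n. (g (X i \<omega>))\<^sup>2)))"
    using empirical_norm_lower[OF B \<tau>] by blast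
  obtain c where c: "0 \<le> c" and up: "\<And>n k0. 1 \<le> n \<Longrightarrow> real n powr (- 2/5) \<le> 1 / 4 ^ k0 \<Longrightarrow> real n powr (1/q) \<le> real n * (1 / 4 ^ k0)\<^sup>2 \<Longrightarrow>
    \<exists>E\<in>events. prob E \<le> 2 * exp (- \<tau>) \<and> (\<forall>\<omega>\<in>space M - E. (\<forall>i. X i \<omega> \<in> \<X>) \<longrightarrow>
      (\<forall>i<n. \<bar>e i \<omega>\<bar> \<le> r * real n powr (1/q)) \<longrightarrow> (\<Sum>i<n. \<bar>e i \<omega>\<bar>) \<le> real n * K \<longrightarrow>
      (\<forall>g\<in>\<G> B. sqnorm g \<le> (1 / 4 ^ k0)\<^sup>2 \<longrightarrow> (\<Sum>i<n. e i \<omega> * g (X i \<omega>)) \<le> c * (real n * (1 / 4 ^ k0)\<^sup>2)))"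
    using multiplier_upper[OF B \<tau> r less_imp_le[OF K]] by blast
  define cf where "cf = 4 * Q + (2 * sqrt c + 4 * c / sqrt L0) * (4 * (1 + 1 / sqrt L0))"
  have cf: "0 \<le> cf" using Q c L0 by (simp add: cf_def)
  have "((\<lambda>n. Q * real n powr (- 2/5)) \<longlongrightarrow> Q * 0) sequentially"
    by (intro tendsto_mult tendsto_const tendsto_neg_powr) (auto simp: filterlim_real_sequentially)
  then have ev: "\<forall>\<^sub>F n in sequentially. Q * real n powr (- 2/5) < 1"
    by (rule order_tendstoD) simp
  show ?thesis
  proof (intro exI[of _ cf] conjI cf)
    show "\<forall>\<^sub>F n in sequentially. \<exists>A\<in>events. prob A \<le> \<epsilon> \<and>
    (\<forall>\<omega>\<in>space M - A. (\<forall>i. X i \<omega> \<in> \<X>) \<longrightarrow> (\<Sum>i<n. \<bar>e i \<omega>\<bar>) \<le> real n * K \<and>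
      (\<forall>g\<in>\<G> B. \<forall>L\<ge>L0. L * (\<Sum>i<n. (g (X i \<omega>))\<^sup>2) \<le> 2 * (\<Sum>i<n. e i \<omega> * g (X i \<omega>)) \<longrightarrow>
         L * sqrt (sqnorm g) \<le> cf * max (L * real n powr (- 2/5)) (sqrt L * real n powr (1/(2*q) - 1/2))))"
      using ev eventually_ge_at_top[of 1]
    proof eventually_elim
      case (elim n)
      then have n: "1 \<le> n" and Q1: "Q * real n powr (- 2/5) \<le> 1" by auto
      define x where "x = real n powr (- 2/5)"
      define y where "y = real n powr (1/(2*q) - 1/2)"
      have x: "0 < x" "0 < y" using n by (simp_all add: x_def y_def)
      have xy1: "max x y \<le> 1"
      proof -
        have "1/(2*q) - 1/2 \<le> 0" using q by (simp add: field_simps)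
        then have "y \<le> 1" unfolding y_def using n powr_mono[of "1/(2*q) - 1/2" 0 "real n"] by simp
        moreover have "x \<le> 1" unfolding x_def using n powr_mono[of "-2/5" 0 "real n"] by simp
        ultimately show ?thesis by simp
      qed
      \<comment> \<open>Two radii: \<delta> is of order Q * x, for the empirical norm, and \<eta> of
        order max x y, for the noise. The constants of the noise bound go into \<open>c\<close> and
        not into the radius.\<close>
      obtain k1 :: nat where k1: "Q * x \<le> 1 / 4 ^ k1" "1 / 4 ^ k1 \<le> 4 * (Q * x)"
        using dyadic_between[of "Q * x"] Q Q1 x by (auto simp: x_def)
      obtain k2 :: nat where k2: "max x y \<le> 1 / 4 ^ k2" "1 / 4 ^ k2 \<le> 4 * max x y"
        using dyadic_between[of "max x y"] xy1 x by (auto simp: less_max_iff_disj)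
      have k2': "x \<le> 1 / 4 ^ k2" using k2(1) by simp
      define \<delta> where "\<delta> = (1 / 4 ^ k1 :: real)"
      define \<eta> where "\<eta> = (1 / 4 ^ k2 :: real)"
      have pos: "0 < \<delta>" "0 < \<eta>" by (simp_all add: \<delta>_def \<eta>_def)
      have n2: "real n powr (1/q) \<le> real n * \<eta>\<^sup>2"
      proof -
        \<comment> \<open>\<open>y\<close> is the radius at which n * y^2 equals the order n^(1/q)
          of the truncation terms.\<close>
        have "real n * y\<^sup>2 = real n powr (1/q)"
          using n q by (simp add: y_def powr_power powr_mult_base field_simps)
        moreover have "y\<^sup>2 \<le> \<eta>\<^sup>2" using k2(1) x by (intro power_mono) (auto simp: \<eta>_def)
        ultimately show ?thesis using n by (metis mult_left_mono of_nat_0_le_iff)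
      qed
      obtain E1 where E1: "E1 \<in> events" "prob E1 \<le> 2 * exp (- \<tau>)"
        and low': "\<And>\<omega> g. \<omega> \<in> space M - E1 \<Longrightarrow> (\<forall>i. X i \<omega> \<in> \<X>) \<Longrightarrow> g \<in> \<G> B \<Longrightarrow> sqnorm g \<le> \<delta>\<^sup>2 \<Longrightarrow>
          real n * sqnorm g - real n * \<delta>\<^sup>2 / 2 \<le> (\<Sum>i<n. (g (X i \<omega>))\<^sup>2)"
        using low[OF n k1(1)[unfolded x_def]] unfolding \<delta>_def by blast
      obtain E2 where E2: "E2 \<in> events" "prob E2 \<le> 2 * exp (- \<tau>)"
        and up': "\<And>\<omega> g. \<omega> \<in> space M - E2 \<Longrightarrow> (\<forall>i. X i \<omega> \<in> \<X>) \<Longrightarrow>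
          (\<forall>i<n. \<bar>e i \<omega>\<bar> \<le> r * real n powr (1/q)) \<Longrightarrow> (\<Sum>i<n. \<bar>e i \<omega>\<bar>) \<le> real n * K \<Longrightarrow>
          g \<in> \<G> B \<Longrightarrow> sqnorm g \<le> \<eta>\<^sup>2 \<Longrightarrow> (\<Sum>i<n. e i \<omega> * g (X i \<omega>)) \<le> c * (real n * \<eta>\<^sup>2)"
        using up[OF n k2'[unfolded x_def] n2[unfolded \<eta>_def]] unfolding \<eta>_def by blast
      define E3 where "E3 = {\<omega> \<in> space M. \<exists>i<n. \<bar>e i \<omega>\<bar> > r * real n powr (1/q)}"
      define E4 where "E4 = {\<omega> \<in> space M. (\<Sum>i<n. \<bar>e i \<omega>\<bar>) \<ge> real n * K}"
      have E34: "E3 \<in> events" "E4 \<in> events" "prob E3 \<le> \<epsilon> / 4" "prob E4 \<le> \<epsilon> / 4"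
        unfolding E3_def E4_def
        using noise_max_prob(1)[OF r n] noise_mean_prob(1)[OF K n]
          order_trans[OF noise_max_prob(2)[OF r n] rq] order_trans[OF noise_mean_prob(2)[OF K n] K\<epsilon>] by auto
      have ev: "E1 \<union> E2 \<union> E3 \<union> E4 \<in> events" using E1 E2 E34 by auto
      have "prob (E1 \<union> E2 \<union> E3 \<union> E4) \<le> prob E1 + prob E2 + prob E3 + prob E4"
        using E1(1) E2(1) E34(1,2) by (intro order_trans[OF measure_Un_le] add_mono) auto
      then have pr: "prob (E1 \<union> E2 \<union> E3 \<union> E4) \<le> \<epsilon>" using E1 E2 E34 e\<tau> by linarith
      show ?case
      proof (intro bexI[OF _ ev] conjI pr ballI impI allI)
        fix \<omega> assume \<omega>: "\<omega> \<in> space M - (E1 \<union> E2 \<union> E3 \<union> E4)" and Xin: "\<forall>i. X i \<omega> \<in> \<X>"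
        show eK: "(\<Sum>i<n. \<bar>e i \<omega>\<bar>) \<le> real n * K" using \<omega> by (auto simp: E4_def)
        have small: "\<forall>i<n. \<bar>e i \<omega>\<bar> \<le> r * real n powr (1/q)"
        proof (intro allI impI, rule ccontr)
          fix i assume "i < n" "\<not> \<bar>e i \<omega>\<bar> \<le> r * real n powr (1/q)"
          then have "\<omega> \<in> E3" using \<omega> by (auto simp: E3_def not_le)
          then show False using \<omega> by simp
        qed
        fix g L assume g: "g \<in> \<G> B" and L: "L0 \<le> L"
          and basic: "L * (\<Sum>i<n. (g (X i \<omega>))\<^sup>2) \<le> 2 * (\<Sum>i<n. e i \<omega> * g (X i \<omega>))"
        define \<rho> where "\<rho> = sqrt (sqnorm g)"
        have sq: "sqnorm g = \<rho>\<^sup>2" "0 \<le> \<rho>" by (simp_all add: \<rho>_def sqnorm_nonneg)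
        have N: "0 < real n" using n by simp
        show "L * sqrt (sqnorm g) \<le> cf * max (L * real n powr (- 2/5)) (sqrt L * real n powr (1/(2*q) - 1/2))"
          unfolding \<rho>_def[symmetric] cf_def x_def[symmetric] y_def[symmetric]
        proof (rule rate_of_basic_inequality[where \<delta> = \<delta> and \<eta> = \<eta> and s = "(\<Sum>i<n. (g (X i \<omega>))\<^sup>2) / real n"
              and t = "(\<Sum>i<n. e i \<omega> * g (X i \<omega>)) / real n"])
          show "\<rho>\<^sup>2 / 2 \<le> (\<Sum>i<n. (g (X i \<omega>))\<^sup>2) / real n" if le: "\<delta> \<le> \<rho>"
          proof -
            have \<rho>: "0 < \<rho>" using le pos by simp
            note R = rescale_to_radius[OF g \<rho>_def pos(1) le]
            have "real n * \<delta>\<^sup>2 / 2 \<le> (\<Sum>i<n. (\<delta> / \<rho> * g (X i \<omega>))\<^sup>2)"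
              using low'[of \<omega>, OF _ Xin R(1)] \<omega> R(2) by simp
            also have "\<dots> = (\<delta> / \<rho>)\<^sup>2 * (\<Sum>i<n. (g (X i \<omega>))\<^sup>2)"
              by (simp only: power_mult_distrib sum_distrib_left)
            finally show ?thesis using \<rho> pos N by (simp add: field_simps power2_eq_square)
          qed
          show "(\<Sum>i<n. e i \<omega> * g (X i \<omega>)) / real n \<le> c * \<eta>\<^sup>2" if le: "\<rho> \<le> \<eta>"
          proof -
            have "sqnorm g \<le> \<eta>\<^sup>2" unfolding sq(1) using le sq(2) by (rule power_mono)
            then show ?thesis using up'[OF _ Xin small eK g] \<omega> N by (simp add: field_simps)
          qed
          show "(\<Sum>i<n. e i \<omega> * g (X i \<omega>)) / real n \<le> c * \<rho> * \<eta>" if gt: "\<eta> < \<rho>"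
          proof -
            have \<rho>: "0 < \<rho>" using gt pos by simp
            note R = rescale_to_radius[OF g \<rho>_def pos(2) less_imp_le[OF gt]]
            \<comment> \<open>The noise sum is linear in g, so rescaling to norm \<eta> and back
              turns \<eta>^2 into \<rho> * \<eta>; the sum of squares above scales
              quadratically.\<close>
            have "(\<eta> / \<rho>) * (\<Sum>i<n. e i \<omega> * g (X i \<omega>)) = (\<Sum>i<n. e i \<omega> * (\<eta> / \<rho> * g (X i \<omega>)))"
              by (simp add: sum_distrib_left mult_ac)
            also have "\<dots> \<le> c * (real n * \<eta>\<^sup>2)"
              using up'[OF _ Xin small eK R(1)] \<omega> R(2) by simp
            finally show ?thesis using \<rho> pos N by (simp add: field_simps power2_eq_square)
          qed
          show "L * ((\<Sum>i<n. (g (X i \<omega>))\<^sup>2) / real n) \<le> 2 * ((\<Sum>i<n. e i \<omega> * g (X i \<omega>)) / real n)"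
            using divide_right_mono[OF basic less_imp_le[OF N]] by simp
        qed (use L0 L sq x pos c Q k1 k2 in \<open>auto simp: \<delta>_def \<eta>_def\<close>)
      qed
    qed
  qed
qed

end

section \<open>The least squares estimator\<close>

text \<open>The complement is the union of all open null sets, and by the Lindelof property
  countably many of them have the same union.\<close>

lemma measure_support_complement:
  fixes P :: "'a::second_countable_topology measure"
  assumes "sets P = sets borel"
  shows "closed (measure_support P)" "AE x in P. x \<in> measure_support P"
proof -
  define \<U> where "\<U> = {U :: 'a set. open U \<and> emeasure P U = 0}"
  have c: "- measure_support P = \<Union>\<U>"
    by (auto simp: measure_support_def \<U>_def zero_less_iff_neq_zero)
  show "closed (measure_support P)"
    unfolding closed_def c by (auto simp: \<U>_def)
  obtain \<V> where V: "\<V> \<subseteq> \<U>" "countable \<V>" "\<Union>\<V> = \<Union>\<U>"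
    using Lindelof[of \<U>] by (auto simp: \<U>_def)
  have null: "U \<in> null_sets P" if "U \<in> \<V>" for U
    using V that assms by (auto simp: \<U>_def null_sets_def)
  have "(\<Union>U\<in>\<V>. U) \<in> null_sets P" using V(2) null by (intro null_sets_UN') auto
  then have "- measure_support P \<in> null_sets P" using V c by simp
  then show "AE x in P. x \<in> measure_support P" by (rule AE_not_in[THEN AE_mp]) auto
qed

lemma index_space_compact: "compact (index_space (k :: 'd::finite))"
proof -
  have "index_space k = sphere 0 1 \<inter> {\<eta>. 0 \<le> \<eta> $ k}"
    by (auto simp: index_space_def)
  moreover have "closed {\<eta> :: real ^ 'd. 0 \<le> \<eta> $ k}"
    by (intro closed_Collect_le continuous_intros)
  ultimately show ?thesis by (simp add: compact_Int_closed)
qed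

text \<open>Before taking the hull, the domain is the image of a compact product under the inner
  product. Compactness of \<open>D\<close> is what makes the minimum in the Moreau envelope
  attained.\<close>

lemma index_geometry_support:
  fixes \<X> :: "(real ^ 'd::finite) set"
  assumes cl: "closed \<X>" and ne: "\<X> \<noteq> {}" and T: "\<And>x. x \<in> \<X> \<Longrightarrow> norm x \<le> T" and ind: "index_space k \<noteq> {}"
  shows "index_geometry k \<X> (link_domain k \<X>) T"
proof
  have bd: "bounded \<X>" using T by (auto simp: bounded_iff)
  then have cX: "compact \<X>" using cl by (simp add: compact_eq_bounded_closed)
  have img: "{\<theta> \<bullet> x | \<theta> x. x \<in> \<X> \<and> \<theta> \<in> index_space k} = (\<lambda>(\<theta>, x). \<theta> \<bullet> x) ` (index_space k \<times> \<X>)"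
    by auto
  have "compact ((\<lambda>(\<theta>, x). \<theta> \<bullet> x) ` (index_space k \<times> \<X>))"
    by (intro compact_continuous_image compact_Times index_space_compact cX)
      (auto simp: case_prod_beta intro!: continuous_intros)
  then show "compact (link_domain k \<X>)"
    unfolding link_domain_def img by (rule compact_convex_hull)
  show "convex (link_domain k \<X>)" by (simp add: link_domain_def)
  obtain x \<theta> where "x \<in> \<X>" "\<theta> \<in> index_space k" using ne ind by auto
  then show "link_domain k \<X> \<noteq> {}" using link_domain_mem by blast
  show "\<bar>t\<bar> \<le> T" if "t \<in> link_domain k \<X>" for t
  proof -
    have "link_domain k \<X> \<subseteq> {- T..T}"
      unfolding link_domain_def
    proof (rule hull_minimal)
      show "{\<theta> \<bullet> x | \<theta> x. x \<in> \<X> \<and> \<theta> \<in> index_space k} \<subseteq> {- T..T}"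
      proof safe
        fix \<theta> x assume *: "x \<in> \<X>" "\<theta> \<in> index_space k"
        have "\<bar>\<theta> \<bullet> x\<bar> \<le> norm \<theta> * norm x" by (rule Cauchy_Schwarz_ineq2)
        also have "\<dots> \<le> T" using * T by (simp add: index_space_def)
        finally show "\<theta> \<bullet> x \<in> {- T..T}" by (auto simp: abs_le_iff)
      qed
    qed simp
    then show ?thesis using that by (auto simp: abs_le_iff)
  qed
  show "norm x \<le> T" if "x \<in> \<X>" for x using T that .
  show "\<theta> \<bullet> x \<in> link_domain k \<X>" if "x \<in> \<X>" "\<theta> \<in> index_space k" for x \<theta> using link_domain_mem that .
qed (use cl ind in auto)

lemma convex_lipschitz_add_const:
  assumes "m \<in> convex_lipschitz D L"
  shows "(\<lambda>t. m t + c) \<in> convex_lipschitz D L"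
proof -
  have m: "convex_on D m" "L-lipschitz_on D m" using assms by (auto simp: convex_lipschitz_def)
  have "convex D" using m(1) by (rule convex_on_imp_convex)
  then have "convex_on D (\<lambda>t. m t + c)" using m(1) by (intro convex_on_add) (simp_all add: convex_on_const)
  moreover have "L-lipschitz_on D (\<lambda>t. m t + c)" using m(2) by (simp add: lipschitz_on_def)
  ultimately show ?thesis by (simp add: convex_lipschitz_def)
qed

text \<open>Convexity and the Lipschitz condition survive adding a constant. Shifting by the mean
  residual \<open>a\<close> lowers the sum of squares by n * a^2, so minimality forces a =
  0.\<close>

lemma CLSE_residual_sum:
  assumes clse: "is_CLSE k D L n x y m \<theta>" and n: "1 \<le> n"
  shows "(\<Sum>i<n. y i - m (\<theta> \<bullet> x i)) = 0"
proof -
  define r where "r i = y i - m (\<theta> \<bullet> x i)" for i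
  define a where "a = (\<Sum>i<n. r i) / real n"
  have "empirical_risk n x y m \<theta> \<le> empirical_risk n x y (\<lambda>t. m t + a) \<theta>"
    using clse convex_lipschitz_add_const by (auto simp: is_CLSE_def)
  then have "(\<Sum>i<n. (r i)\<^sup>2) \<le> (\<Sum>i<n. (r i - a)\<^sup>2)"
    using n by (simp add: empirical_risk_def r_def diff_diff_eq divide_le_cancel)
  also have "\<dots> = (\<Sum>i<n. (r i)\<^sup>2 - 2 * a * r i + a\<^sup>2)"
    by (simp add: power2_diff algebra_simps)
  also have "\<dots> = (\<Sum>i<n. (r i)\<^sup>2) - 2 * a * (\<Sum>i<n. r i) + real n * a\<^sup>2"
    by (simp add: sum.distrib sum_subtractf sum_distrib_left)
  also have "(\<Sum>i<n. r i) = real n * a" using n by (simp add: a_def)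
  finally have "real n * a\<^sup>2 \<le> 0" by (simp add: power2_eq_square mult_ac)
  then have "a = 0" using n by (simp add: mult_le_0_iff)
  then show ?thesis using n by (simp add: a_def r_def)
qed

lemma CLSE_basic_inequality:
  assumes clse: "is_CLSE k D L n x y m \<theta>" and n: "1 \<le> n"
    and m0: "m0 \<in> convex_lipschitz D L" "\<theta>0 \<in> index_space k"
  shows "(\<Sum>i<n. (m (\<theta> \<bullet> x i) - m0 (\<theta>0 \<bullet> x i))\<^sup>2)
    \<le> 2 * (\<Sum>i<n. (y i - m0 (\<theta>0 \<bullet> x i)) * (m (\<theta> \<bullet> x i) - m0 (\<theta>0 \<bullet> x i)))"
proof -
  define e where "e i = y i - m0 (\<theta>0 \<bullet> x i)" for i
  define d where "d i = m (\<theta> \<bullet> x i) - m0 (\<theta>0 \<bullet> x i)" for i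
  have "empirical_risk n x y m \<theta> \<le> empirical_risk n x y m0 \<theta>0"
    using clse m0 by (auto simp: is_CLSE_def)
  then have "(\<Sum>i<n. (e i - d i)\<^sup>2) \<le> (\<Sum>i<n. (e i)\<^sup>2)"
    using n by (simp add: empirical_risk_def e_def d_def divide_le_cancel)
  also have "(\<Sum>i<n. (e i - d i)\<^sup>2) = (\<Sum>i<n. (e i)\<^sup>2 - 2 * (e i * d i) + (d i)\<^sup>2)"
    by (simp add: power2_diff algebra_simps)
  also have "\<dots> = (\<Sum>i<n. (e i)\<^sup>2) - 2 * (\<Sum>i<n. e i * d i) + (\<Sum>i<n. (d i)\<^sup>2)"
    by (simp add: sum.distrib sum_subtractf sum_distrib_left)
  finally show ?thesis by (simp add: e_def d_def)
qed

lemma lipschitz_scale_down: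
  assumes m: "m \<in> convex_lipschitz D L" and L: "0 < L" and b: "\<And>t. t \<in> D \<Longrightarrow> \<bar>m t / L\<bar> \<le> B"
  shows "(\<lambda>t. m t / L) \<in> convex_ball D B"
proof -
  have m': "convex_on D m" "L-lipschitz_on D m" using m by (auto simp: convex_lipschitz_def)
  have "convex_on D (\<lambda>t. (1 / L) * m t)" using m' L by (intro convex_on_cmul) auto
  moreover have "1-lipschitz_on D (\<lambda>t. m t / L)"
  proof (rule lipschitz_onI)
    fix s t assume "s \<in> D" "t \<in> D"
    then have "\<bar>m s - m t\<bar> \<le> L * \<bar>s - t\<bar>" using lipschitz_onD[OF m'(2)] by (simp add: dist_real_def)
    then have "\<bar>m s - m t\<bar> / L \<le> \<bar>s - t\<bar>" using L by (simp add: field_simps)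
    then show "dist (m s / L) (m t / L) \<le> 1 * dist s t"
      using L by (simp add: dist_real_def diff_divide_distrib[symmetric] abs_divide)
  qed simp
  ultimately show ?thesis using b by (simp add: convex_ball_def convex_lipschitz_def)
qed

text \<open>The Lipschitz condition controls only the oscillation of \<open>m\<close>, at most 2 * T
  * L over \<open>D\<close>. Its level is fixed by the residuals: the mean of the fitted values
  equals the mean response, which is at most M0 + K in absolute value. Division by L makes the bound
  uniform over all L from L0 on.\<close>

lemma (in index_geometry) CLSE_bounded:
  assumes clse: "is_CLSE k D L n x y m \<theta>" and n: "1 \<le> n" and L: "0 < L0" "L0 \<le> L"
    and x: "\<And>i. i < n \<Longrightarrow> x i \<in> \<X>" and m0: "\<And>t. t \<in> D \<Longrightarrow> \<bar>m0 t\<bar> \<le> M0" and \<theta>0: "\<theta>0 \<in> index_space k"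
    and e: "(\<Sum>i<n. \<bar>y i - m0 (\<theta>0 \<bullet> x i)\<bar>) \<le> real n * K" and t: "t \<in> D" and K: "0 \<le> K"
  shows "\<bar>m t / L\<bar> \<le> (M0 + K) / L0 + 2 * T"
proof -
  have \<theta>: "\<theta> \<in> index_space k" and lip: "L-lipschitz_on D m"
    using clse by (auto simp: is_CLSE_def convex_lipschitz_def)
  have D': "\<theta> \<bullet> x i \<in> D" "\<theta>0 \<bullet> x i \<in> D" if "i < n" for i using mem x that \<theta> \<theta>0 by auto
  have N: "0 < real n" using n by simp
  have "real n * m t = (\<Sum>i<n. m t - m (\<theta> \<bullet> x i)) + (\<Sum>i<n. m0 (\<theta>0 \<bullet> x i)) + (\<Sum>i<n. y i - m0 (\<theta>0 \<bullet> x i))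
     - (\<Sum>i<n. y i - m (\<theta> \<bullet> x i))"
    by (simp add: sum_subtractf)
  then have eq: "real n * m t = (\<Sum>i<n. m t - m (\<theta> \<bullet> x i)) + (\<Sum>i<n. m0 (\<theta>0 \<bullet> x i)) + (\<Sum>i<n. y i - m0 (\<theta>0 \<bullet> x i))"
    using CLSE_residual_sum[OF clse n] by simp
  have "\<bar>\<Sum>i<n. m t - m (\<theta> \<bullet> x i)\<bar> \<le> (\<Sum>i<n. L * (2 * T))"
  proof (rule order_trans[OF sum_abs sum_mono])
    fix i assume "i \<in> {..<n}"
    then have i: "\<theta> \<bullet> x i \<in> D" using D' by simp
    have "\<bar>m t - m (\<theta> \<bullet> x i)\<bar> \<le> L * \<bar>t - \<theta> \<bullet> x i\<bar>"
      using lipschitz_onD[OF lip t i] by (simp add: dist_real_def)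
    also have "\<dots> \<le> L * (2 * T)" using D(4)[OF t] D(4)[OF i] L by (intro mult_left_mono) auto
    finally show "\<bar>m t - m (\<theta> \<bullet> x i)\<bar> \<le> L * (2 * T)" .
  qed
  moreover have "\<bar>\<Sum>i<n. m0 (\<theta>0 \<bullet> x i)\<bar> \<le> (\<Sum>i<n. M0)"
    using D' m0 by (intro order_trans[OF sum_abs sum_mono]) auto
  moreover have "\<bar>\<Sum>i<n. y i - m0 (\<theta>0 \<bullet> x i)\<bar> \<le> real n * K"
    using sum_abs e by (rule order_trans)
  ultimately have "\<bar>real n * m t\<bar> \<le> real n * (L * (2 * T)) + real n * M0 + real n * K"
    unfolding eq by simp
  then have "real n * \<bar>m t\<bar> \<le> real n * (L * (2 * T) + M0 + K)" by (simp add: abs_mult distrib_left)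
  then have "\<bar>m t\<bar> \<le> L * (2 * T) + (M0 + K)" using N by simp
  then have "\<bar>m t\<bar> / L \<le> (L * (2 * T) + (M0 + K)) / L" using L by (simp add: divide_right_mono)
  also have "\<dots> = 2 * T + (M0 + K) / L" using L by (simp add: add_divide_distrib)
  also have "\<dots> \<le> 2 * T + (M0 + K) / L0"
  proof -
    have "0 \<le> M0" using m0[OF t] by linarith
    then show ?thesis using L K by (intro add_left_mono divide_left_mono) auto
  qed
  finally show ?thesis using L by (simp add: abs_divide)
qed

section \<open>Integrals of noise times functions of the design, from conditional
  expectations\<close>

context prob_space
begin

lemma finite_measure_subalgebra_sigma_gen:
  assumes [measurable]: "random_variable borel X"
  shows "finite_measure_subalgebra M (sigma_gen M X)"
proof
  show "subalgebra M (sigma_gen M X)"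
    unfolding subalgebra_def sigma_gen_def
    by (auto simp: sets_vimage_algebra2 intro!: measurable_sets[OF assms])
qed

lemma sigma_gen_measurable:
  assumes [measurable]: "random_variable borel X" "w \<in> borel_measurable borel"
  shows "(\<lambda>\<omega>. w (X \<omega>)) \<in> borel_measurable (sigma_gen M X)"
  unfolding sigma_gen_def
  using measurable_compose[OF measurable_vimage_algebra1 assms(2)] by auto

lemma integrable_mult_bounded:
  fixes f g :: "'a \<Rightarrow> real"
  assumes f: "integrable M f" and [measurable]: "random_variable borel g" and c: "\<And>\<omega>. \<bar>g \<omega>\<bar> \<le> c"
  shows "integrable M (\<lambda>\<omega>. g \<omega> * f \<omega>)"
proof (rule Bochner_Integration.integrable_bound)
  show "integrable M (\<lambda>\<omega>. c * f \<omega>)" using f by simp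
  have "0 \<le> c" using c abs_ge_zero order_trans by blast
  then show "AE \<omega> in M. norm (g \<omega> * f \<omega>) \<le> norm (c * f \<omega>)"
    using c by (auto simp: abs_mult intro!: AE_I2 mult_right_mono)
qed (use f in measurable)

lemma expectation_mult_of_cond_exp_zero:
  assumes X: "random_variable borel X" and e: "integrable M e"
    and cond: "AE \<omega> in M. real_cond_exp M (sigma_gen M X) e \<omega> = 0"
    and w: "w \<in> borel_measurable borel" "\<And>x. \<bar>w x\<bar> \<le> c"
  shows "expectation (\<lambda>\<omega>. e \<omega> * w (X \<omega>)) = 0"
proof -
  interpret F: finite_measure_subalgebra M "sigma_gen M X"
    using X by (rule finite_measure_subalgebra_sigma_gen)
  note wX = measurable_compose[OF X w(1)]
  have i: "integrable M (\<lambda>\<omega>. w (X \<omega>) * e \<omega>)"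
    using w(2) by (intro integrable_mult_bounded[OF e wX])
  have "expectation (\<lambda>\<omega>. w (X \<omega>) * e \<omega>) = expectation (\<lambda>\<omega>. w (X \<omega>) * real_cond_exp M (sigma_gen M X) e \<omega>)"
    using F.real_cond_exp_intg(2)[OF i sigma_gen_measurable[OF X w(1)]] e by simp
  also have "\<dots> = expectation (\<lambda>\<omega>. 0)"
    using cond wX by (intro integral_cong_AE) auto
  finally show ?thesis by (simp add: mult.commute)
qed

text \<open>Conditioning on X pulls out w(X)^2 and replaces e^2 by v(X); the bound on
  \<open>v\<close> is available on \<open>S\<close>, which X meets almost surely.\<close>

lemma expectation_mult_of_cond_exp_le:
  assumes X: "random_variable borel X" and e: "random_variable borel e" "integrable M (\<lambda>\<omega>. (e \<omega>)\<^sup>2)"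
    and cond: "cond_exp_version M X (\<lambda>\<omega>. (e \<omega>)\<^sup>2) v"
    and S: "AE \<omega> in M. X \<omega> \<in> S" "\<And>x. x \<in> S \<Longrightarrow> v x \<le> s"
    and w: "w \<in> borel_measurable borel" "\<And>x. \<bar>w x\<bar> \<le> c"
  shows "expectation (\<lambda>\<omega>. (e \<omega> * w (X \<omega>))\<^sup>2) \<le> s * (\<integral>x. (w x)\<^sup>2 \<partial>distr M borel X)"
proof -
  interpret F: finite_measure_subalgebra M "sigma_gen M X"
    using X by (rule finite_measure_subalgebra_sigma_gen)
  have w2: "(\<lambda>x. (w x)\<^sup>2) \<in> borel_measurable borel" using w(1) by measurable
  note wX = measurable_compose[OF X w2]
  have b: "\<bar>(w x)\<^sup>2\<bar> \<le> c\<^sup>2" for x using w(2)[of x] by (metis abs_ge_zero abs_power2 power2_abs power_mono)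
  have i: "integrable M (\<lambda>\<omega>. (w (X \<omega>))\<^sup>2 * (e \<omega>)\<^sup>2)"
    using b by (intro integrable_mult_bounded[OF e(2) wX])
  have e2: "random_variable borel (\<lambda>\<omega>. (e \<omega>)\<^sup>2)" using e(1) by measurable
  note intg = F.real_cond_exp_intg[OF i sigma_gen_measurable[OF X w2] e2]
  have "expectation (\<lambda>\<omega>. (e \<omega> * w (X \<omega>))\<^sup>2) = expectation (\<lambda>\<omega>. (w (X \<omega>))\<^sup>2 * (e \<omega>)\<^sup>2)"
    by (simp add: power_mult_distrib mult.commute)
  also have "\<dots> = expectation (\<lambda>\<omega>. (w (X \<omega>))\<^sup>2 * real_cond_exp M (sigma_gen M X) (\<lambda>\<omega>. (e \<omega>)\<^sup>2) \<omega>)"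
    using intg(2) by simp
  also have "\<dots> \<le> expectation (\<lambda>\<omega>. s * (w (X \<omega>))\<^sup>2)"
  proof (rule integral_mono_AE[OF intg(1)])
    have "integrable M (\<lambda>\<omega>. (w (X \<omega>))\<^sup>2)"
      using b by (intro integrable_AE_bounded[OF wX, of "c\<^sup>2"]) auto
    then show "integrable M (\<lambda>\<omega>. s * (w (X \<omega>))\<^sup>2)" by simp
    have "AE \<omega> in M. real_cond_exp M (sigma_gen M X) (\<lambda>\<omega>. (e \<omega>)\<^sup>2) \<omega> = v (X \<omega>)"
      using cond by (simp add: cond_exp_version_def)
    then show "AE \<omega> in M. (w (X \<omega>))\<^sup>2 * real_cond_exp M (sigma_gen M X) (\<lambda>\<omega>. (e \<omega>)\<^sup>2) \<omega> \<le> s * (w (X \<omega>))\<^sup>2"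
      using S(1)
    proof eventually_elim
      case (elim \<omega>)
      then show ?case using mult_left_mono[OF S(2), of "X \<omega>" "(w (X \<omega>))\<^sup>2"] by (simp add: mult.commute)
    qed
  qed
  also have "\<dots> = s * (\<integral>x. (w x)\<^sup>2 \<partial>distr M borel X)"
    using X w2 by (simp add: integral_distr)
  finally show ?thesis .
qed

end

text \<open>The two weights of the theorem are the reciprocals of the two terms of the rate, so
  their minimum cancels the maximum of the terms.\<close>

lemma min_inverse_mult_max_le:
  fixes a b :: real
  assumes "0 < a" "0 < b"
  shows "min (1 / a) (1 / b) * max a b \<le> 1"
  using assms by (cases "a \<le> b") (auto simp: min_def max_def field_simps)

lemma bounded_random_SUP_le:
  fixes f :: "real \<Rightarrow> real"
  assumes "I \<noteq> {}" "\<And>L. L \<in> I \<Longrightarrow> 0 \<le> f L" "\<And>L. L \<in> I \<Longrightarrow> f L \<le> c"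
  shows "\<bar>SUP L\<in>I. ereal (f L)\<bar> \<le> ereal c"
proof -
  obtain L where L: "L \<in> I" using assms(1) by auto
  have "0 \<le> ereal (f L)" using assms(2)[OF L] by simp
  also have "\<dots> \<le> (SUP L\<in>I. ereal (f L))" using L by (rule SUP_upper)
  finally have "\<bar>SUP L\<in>I. ereal (f L)\<bar> = (SUP L\<in>I. ereal (f L))" by simp
  also have "\<dots> \<le> ereal c" using assms(3) by (intro SUP_least) simp
  finally show ?thesis .
qed

theorem theorem3p3:
  fixes M :: "'w measure"
    and k :: "'d::finite"
    and X :: "nat \<Rightarrow> 'w \<Rightarrow> real ^ 'd"
    and Y \<epsilon> :: "nat \<Rightarrow> 'w \<Rightarrow> real"
    and P\<^sub>X :: "(real ^ 'd) measure"
    and \<X> :: "(real ^ 'd) set"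
    and D :: "real set"
    and m\<^sub>0 :: "real \<Rightarrow> real"
    and \<theta>\<^sub>0 :: "real ^ 'd"
    and q M\<^sub>0 L\<^sub>0 T \<sigma> :: real
    and m_check :: "nat \<Rightarrow> real \<Rightarrow> 'w \<Rightarrow> real \<Rightarrow> real"
    and \<theta>_check :: "nat \<Rightarrow> real \<Rightarrow> 'w \<Rightarrow> real ^ 'd"
  assumes "prob_space M"
    and eps_rv: "\<And>i. \<epsilon> i \<in> borel_measurable M"
    and indep: "prob_space.indep_vars M (\<lambda>_. borel) (\<lambda>i \<omega>. (X i \<omega>, Y i \<omega>)) UNIV"
    and ident: "\<And>i. distr M borel (\<lambda>\<omega>. (X i \<omega>, Y i \<omega>)) = distr M borel (\<lambda>\<omega>. (X 0 \<omega>, Y 0 \<omega>))"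
    and model: "\<And>i. AE \<omega> in M. Y i \<omega> = m\<^sub>0 (\<theta>\<^sub>0 \<bullet> X i \<omega>) + \<epsilon> i \<omega>"
    and P\<^sub>X_def: "P\<^sub>X = distr M borel (X 0)"
    and \<X>_def: "\<X> = measure_support P\<^sub>X"
    and D_def: "D = link_domain k \<X>"
    and \<theta>\<^sub>0: "\<theta>\<^sub>0 \<in> index_space k"
    and q: "q \<ge> 2"
    and m\<^sub>0_convex: "convex_on D m\<^sub>0"
    and M\<^sub>0: "M\<^sub>0 \<ge> 1" "\<And>t. t \<in> D \<Longrightarrow> \<bar>m\<^sub>0 t\<bar> \<le> M\<^sub>0"
    and L\<^sub>0: "L\<^sub>0 > 0" "L\<^sub>0-lipschitz_on D m\<^sub>0"
    and T: "\<And>x. x \<in> \<X> \<Longrightarrow> norm x \<le> T"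
    and eps_moment: "\<And>i. integrable M (\<lambda>\<omega>. \<bar>\<epsilon> i \<omega>\<bar> powr q)"
    and eps_mean: "\<And>i. AE \<omega> in M. real_cond_exp M (sigma_gen M (X i)) (\<epsilon> i) \<omega> = 0"
    and eps_var: "\<And>i. \<exists>v. cond_exp_version M (X i) (\<lambda>\<omega>. (\<epsilon> i \<omega>)\<^sup>2) v \<and> (\<forall>x\<in>\<X>. v x \<le> \<sigma>\<^sup>2)"
    and CLSE: "AE \<omega> in M. \<forall>n\<ge>1. \<forall>L>0.
        is_CLSE k D L n (\<lambda>i. X i \<omega>) (\<lambda>i. Y i \<omega>) (m_check n L \<omega>) (\<theta>_check n L \<omega>)"
  shows "bigO_p M
     (\<lambda>n \<omega>. SUP L\<in>{L\<^sub>0..real n * L\<^sub>0}.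
        ereal (min (real n powr (2/5) / L) (real n powr (1/2 - 1/(2*q)) / sqrt L) *
               L2_norm_on P\<^sub>X \<X> (\<lambda>x. m_check n L \<omega> (\<theta>_check n L \<omega> \<bullet> x) - m\<^sub>0 (\<theta>\<^sub>0 \<bullet> x))))
     (\<lambda>n. sqrt (ln (ln (real n))))"
proof -
  interpret prob_space M by fact
  have XY: "random_variable borel (\<lambda>\<omega>. (X i \<omega>, Y i \<omega>))" for i
    using indep by (auto simp: indep_vars_def)
  have X [measurable]: "random_variable borel (X i)" for i
    using measurable_compose[OF XY[of i, folded borel_prod] measurable_fst] by simp
  have Y [measurable]: "random_variable borel (Y i)" for i
    using measurable_compose[OF XY[of i, folded borel_prod] measurable_snd] by simp
  have PX: "distr M borel (X i) = P\<^sub>X" for i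
  proof -
    have "distr M borel (X j) = distr (distr M borel (\<lambda>\<omega>. (X j \<omega>, Y j \<omega>))) borel fst" for j
      using XY[of j] by (subst distr_distr) (auto simp: comp_def borel_prod[symmetric])
    then show ?thesis using ident[of i] by (simp add: P\<^sub>X_def)
  qed
  interpret PX: prob_space P\<^sub>X unfolding P\<^sub>X_def by (rule prob_space_distr) simp
  have sPX: "sets P\<^sub>X = sets borel" by (simp add: P\<^sub>X_def)
  have \<X>: "closed \<X>" "AE x in P\<^sub>X. x \<in> \<X>"
    using measure_support_complement[OF sPX] by (simp_all add: \<X>_def)
  have \<X>_ne: "\<X> \<noteq> {}"
  proof
    assume "\<X> = {}"
    then have "AE x in P\<^sub>X. False" using \<X>(2) by simp
    then show False using PX.AE_False by simp
  qed
  have "AE \<omega> in M. X i \<omega> \<in> \<X>" for i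
    using \<X> unfolding PX[of i, symmetric] by (subst (asm) AE_distr_iff) auto
  then have X_in: "AE \<omega> in M. \<forall>i. X i \<omega> \<in> \<X>" by (simp add: AE_all_countable)
  interpret G: index_geometry k \<X> D T
    unfolding D_def using \<X>(1) \<X>_ne T \<theta>\<^sub>0 by (intro index_geometry_support) auto
  \<comment> \<open>\<open>m\<^sub>0\<close> is arbitrary outside \<open>D\<close>; cutting off
    outside \<open>\<X>\<close> gives a Borel function.\<close>
  define f0 where "f0 x = (if x \<in> \<X> then m\<^sub>0 (\<theta>\<^sub>0 \<bullet> x) else 0)" for x
  have f0 [measurable]: "f0 \<in> borel_measurable borel"
    unfolding f0_def using G.borel_measurable_composition_index[OF lipschitz_on_continuous_on[OF L\<^sub>0(2)] \<theta>\<^sub>0] .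
  \<comment> \<open>A version of the noise that is a Borel function of the pair (X, Y) at every
    sample point, so that independence and the common law transfer from the pairs. It equals
    \<epsilon> almost surely, which is enough for the moment conditions.\<close>
  define e where "e i \<omega> = Y i \<omega> - f0 (X i \<omega>)" for i \<omega>
  have e_rv [measurable]: "random_variable borel (e i)" for i unfolding e_def by measurable
  have e_eq: "AE \<omega> in M. e i \<omega> = \<epsilon> i \<omega>" for i
    using X_in model[of i] by eventually_elim (simp add: e_def f0_def)
  note [measurable] = eps_rv
  define \<mu> where "\<mu> = expectation (\<lambda>\<omega>. \<bar>e 0 \<omega>\<bar> powr q)"
  have mom: "integrable M (\<lambda>\<omega>. \<bar>e i \<omega>\<bar> powr q)" for i
  proof -
    have "AE \<omega> in M. \<bar>e i \<omega>\<bar> powr q = \<bar>\<epsilon> i \<omega>\<bar> powr q" using e_eq[of i] by eventually_elim simp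
    then show ?thesis using eps_moment[of i] by (subst integrable_cong_AE) auto
  qed
  have mom': "expectation (\<lambda>\<omega>. \<bar>e i \<omega>\<bar> powr q) = \<mu>" for i
  proof -
    have [measurable]: "(\<lambda>p. \<bar>snd p - f0 (fst p)\<bar> powr q) \<in> borel_measurable borel"
      unfolding borel_prod[symmetric] by measurable
    have "expectation (\<lambda>\<omega>. \<bar>e j \<omega>\<bar> powr q)
        = (\<integral>p. \<bar>snd p - f0 (fst p)\<bar> powr q \<partial>distr M borel (\<lambda>\<omega>. (X j \<omega>, Y j \<omega>)))" for j
      using XY[of j] by (subst integral_distr) (auto simp: e_def)
    then show ?thesis using ident[of i] by (simp add: \<mu>_def)
  qed
  have int\<epsilon>: "integrable M (\<epsilon> i)" "integrable M (\<lambda>\<omega>. (\<epsilon> i \<omega>)\<^sup>2)" for i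
  proof -
    have I: "integrable M (\<lambda>\<omega>. 1 + \<bar>\<epsilon> i \<omega>\<bar> powr q)" using eps_moment by simp
    show "integrable M (\<epsilon> i)"
      by (rule Bochner_Integration.integrable_bound[OF I])
        (use le_one_plus_powr(1)[OF _ q] in \<open>auto intro!: AE_I2\<close>)
    show "integrable M (\<lambda>\<omega>. (\<epsilon> i \<omega>)\<^sup>2)"
      by (rule Bochner_Integration.integrable_bound[OF I])
        (use le_one_plus_powr(2)[OF _ q, of "\<bar>\<epsilon> i _\<bar>"] in \<open>auto intro!: AE_I2\<close>)
  qed
  interpret R: index_regression M k \<X> D T X e P\<^sub>X \<sigma> q \<mu>
  proof
    have "(\<lambda>p. (fst p, snd p - f0 (fst p))) \<in> borel_measurable (borel :: ((real ^ 'd) \<times> real) measure)"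
      unfolding borel_prod[symmetric] by measurable
    then show "indep_vars (\<lambda>_. borel) (\<lambda>i \<omega>. (X i \<omega>, e i \<omega>)) UNIV"
      using indep_vars_compose2[OF indep, of "\<lambda>_ p. (fst p, snd p - f0 (fst p))" "\<lambda>_. borel"]
      by (simp add: e_def)
  next
    fix i :: nat and w :: "real ^ 'd \<Rightarrow> real" and c :: real
    assume w [measurable]: "w \<in> borel_measurable borel" and c: "\<And>x. \<bar>w x\<bar> \<le> c"
    have "expectation (\<lambda>\<omega>. e i \<omega> * w (X i \<omega>)) = expectation (\<lambda>\<omega>. \<epsilon> i \<omega> * w (X i \<omega>))"
      using e_eq[of i] by (intro integral_cong_AE) auto
    then show "expectation (\<lambda>\<omega>. e i \<omega> * w (X i \<omega>)) = 0"
      using expectation_mult_of_cond_exp_zero[OF X int\<epsilon>(1) eps_mean w c] by simp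
    have "expectation (\<lambda>\<omega>. (e i \<omega> * w (X i \<omega>))\<^sup>2) = expectation (\<lambda>\<omega>. (\<epsilon> i \<omega> * w (X i \<omega>))\<^sup>2)"
      using e_eq[of i] by (intro integral_cong_AE) auto
    moreover obtain v where v: "cond_exp_version M (X i) (\<lambda>\<omega>. (\<epsilon> i \<omega>)\<^sup>2) v" "\<And>x. x \<in> \<X> \<Longrightarrow> v x \<le> \<sigma>\<^sup>2"
      using eps_var[of i] by blast
    moreover have "AE \<omega> in M. X i \<omega> \<in> \<X>" using X_in by auto
    ultimately show "expectation (\<lambda>\<omega>. (e i \<omega> * w (X i \<omega>))\<^sup>2) \<le> \<sigma>\<^sup>2 * (\<integral>x. (w x)\<^sup>2 \<partial>P\<^sub>X)"
      using expectation_mult_of_cond_exp_le[OF X eps_rv int\<epsilon>(2) v(1) _ v(2) w c] unfolding PX by simp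
  qed (use PX X_in q mom mom' in auto)
  \<comment> \<open>The estimators are arbitrary selections, so the set where their defining
    property holds need not be measurable; its complement is covered by a null set.\<close>
  obtain N where N: "N \<in> null_sets M"
    and CLSE': "\<And>\<omega> n L. \<omega> \<in> space M - N \<Longrightarrow> 1 \<le> n \<Longrightarrow> 0 < L \<Longrightarrow>
      is_CLSE k D L n (\<lambda>i. X i \<omega>) (\<lambda>i. Y i \<omega>) (m_check n L \<omega>) (\<theta>_check n L \<omega>)"
    and X_in': "\<And>\<omega> i. \<omega> \<in> space M - N \<Longrightarrow> X i \<omega> \<in> \<X>"
  proof -
    define good where "good \<omega> \<longleftrightarrow> (\<forall>n\<ge>1. \<forall>L>0.
        is_CLSE k D L n (\<lambda>i. X i \<omega>) (\<lambda>i. Y i \<omega>) (m_check n L \<omega>) (\<theta>_check n L \<omega>)) \<and> (\<forall>i. X i \<omega> \<in> \<X>)" for \<omega>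
    have "AE \<omega> in M. good \<omega>"
      using CLSE X_in by eventually_elim (simp add: good_def)
    then obtain N where "N \<in> null_sets M" "{\<omega> \<in> space M. \<not> good \<omega>} \<subseteq> N"
      by (auto elim!: AE_E simp: null_sets_def)
    then show thesis by (intro that[of N]) (auto simp: good_def)
  qed
  show ?thesis
    unfolding bigO_p_def
  proof (intro allI impI)
    fix \<delta> :: real assume \<delta>: "0 < \<delta>"
    \<comment> \<open>By Markov's inequality the mean absolute noise exceeds \<open>K\<close> with
      probability at most \<delta> / 4. The estimators are bounded through this event, so the class
      radius \<open>B\<close> and the final constant depend on \<delta>, as stochastic boundedness
      allows.\<close>
    define K where "K = 4 * (1 + \<mu>) / \<delta>"
    have \<mu>: "0 \<le> \<mu>" by (rule R.moment_nonneg)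
    have K: "0 < K" "(1 + \<mu>) / K \<le> \<delta> / 4" using \<delta> \<mu> by (simp_all add: K_def field_simps)
    have T0: "0 \<le> T" using G.D(3,4) by force
    define B where "B = (M\<^sub>0 + K) / L\<^sub>0 + 2 * T"
    have B: "0 < B" using K M\<^sub>0(1) L\<^sub>0 T0 by (simp add: B_def add_pos_nonneg)
    obtain c where c: "0 \<le> c" and rate: "\<forall>\<^sub>F n in sequentially. \<exists>A\<in>events. prob A \<le> \<delta> \<and>
    (\<forall>\<omega>\<in>space M - A. (\<forall>i. X i \<omega> \<in> \<X>) \<longrightarrow> (\<Sum>i<n. \<bar>e i \<omega>\<bar>) \<le> real n * K \<and>
      (\<forall>g\<in>G.\<G> B. \<forall>L\<ge>L\<^sub>0. L * (\<Sum>i<n. (g (X i \<omega>))\<^sup>2) \<le> 2 * (\<Sum>i<n. e i \<omega> * g (X i \<omega>)) \<longrightarrow>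
         L * sqrt (R.sqnorm g) \<le> c * max (L * real n powr (- 2/5)) (sqrt L * real n powr (1/(2*q) - 1/2))))"
      using R.basic_inequality_rate[OF B K(1) L\<^sub>0(1) \<delta> K(2)] by blast
    have "filterlim (\<lambda>n. ln (ln (real n))) at_top sequentially"
      by (intro filterlim_compose[OF ln_at_top] filterlim_real_sequentially)
    then have ll: "\<forall>\<^sub>F n in sequentially. 1 \<le> ln (ln (real n))"
      by (simp add: filterlim_at_top)
    show "\<exists>C>0. \<forall>\<^sub>F n in sequentially. \<exists>A\<in>events. prob A \<le> \<delta> \<and>
      {\<omega> \<in> space M. ereal (C * sqrt (ln (ln (real n)))) < \<bar>SUP L\<in>{L\<^sub>0..real n * L\<^sub>0}.
        ereal (min (real n powr (2/5) / L) (real n powr (1/2 - 1/(2*q)) / sqrt L) *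
               L2_norm_on P\<^sub>X \<X> (\<lambda>x. m_check n L \<omega> (\<theta>_check n L \<omega> \<bullet> x) - m\<^sub>0 (\<theta>\<^sub>0 \<bullet> x)))\<bar>} \<subseteq> A"
    proof (intro exI[of _ "c + 1"] conjI)
      show "0 < c + 1" using c by simp
      show "\<forall>\<^sub>F n in sequentially. \<exists>A\<in>events. prob A \<le> \<delta> \<and>
      {\<omega> \<in> space M. ereal ((c + 1) * sqrt (ln (ln (real n)))) < \<bar>SUP L\<in>{L\<^sub>0..real n * L\<^sub>0}.
        ereal (min (real n powr (2/5) / L) (real n powr (1/2 - 1/(2*q)) / sqrt L) *
               L2_norm_on P\<^sub>X \<X> (\<lambda>x. m_check n L \<omega> (\<theta>_check n L \<omega> \<bullet> x) - m\<^sub>0 (\<theta>\<^sub>0 \<bullet> x)))\<bar>} \<subseteq> A"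
        using rate ll eventually_ge_at_top[of 1]
      proof eventually_elim
        case (elim n)
        then obtain A where A: "A \<in> events" "prob A \<le> \<delta>" and
          main: "\<And>\<omega>. \<omega> \<in> space M - A \<Longrightarrow> (\<forall>i. X i \<omega> \<in> \<X>) \<Longrightarrow> (\<Sum>i<n. \<bar>e i \<omega>\<bar>) \<le> real n * K \<and>
            (\<forall>g\<in>G.\<G> B. \<forall>L\<ge>L\<^sub>0. L * (\<Sum>i<n. (g (X i \<omega>))\<^sup>2) \<le> 2 * (\<Sum>i<n. e i \<omega> * g (X i \<omega>)) \<longrightarrow>
              L * sqrt (R.sqnorm g) \<le> c * max (L * real n powr (- 2/5)) (sqrt L * real n powr (1/(2*q) - 1/2)))"
          by blast
        have n: "1 \<le> n" and lln: "1 \<le> ln (ln (real n))" using elim by auto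
        let ?f = "\<lambda>\<omega> L. min (real n powr (2/5) / L) (real n powr (1/2 - 1/(2*q)) / sqrt L) *
               L2_norm_on P\<^sub>X \<X> (\<lambda>x. m_check n L \<omega> (\<theta>_check n L \<omega> \<bullet> x) - m\<^sub>0 (\<theta>\<^sub>0 \<bullet> x))"
        have bound: "0 \<le> ?f \<omega> L \<and> ?f \<omega> L \<le> c" if \<omega>: "\<omega> \<in> space M - A" "\<omega> \<in> space M - N" and L: "L\<^sub>0 \<le> L" for \<omega> L
        proof -
          have Lp: "0 < L" using L L\<^sub>0 by simp
          define m where "m = m_check n L \<omega>"
          define \<theta> where "\<theta> = \<theta>_check n L \<omega>"
          have clse: "is_CLSE k D L n (\<lambda>i. X i \<omega>) (\<lambda>i. Y i \<omega>) m \<theta>"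
            using CLSE'[OF \<omega>(2) n Lp] by (simp add: m_def \<theta>_def)
          have Xin: "\<forall>i. X i \<omega> \<in> \<X>" using X_in'[OF \<omega>(2)] by blast
          have e: "e i \<omega> = Y i \<omega> - m\<^sub>0 (\<theta>\<^sub>0 \<bullet> X i \<omega>)" for i using Xin by (simp add: e_def f0_def)
          note main' = main[OF \<omega>(1) Xin]
          have eK: "(\<Sum>i<n. \<bar>Y i \<omega> - m\<^sub>0 (\<theta>\<^sub>0 \<bullet> X i \<omega>)\<bar>) \<le> real n * K" using main' by (simp add: e)
          have mL: "m \<in> convex_lipschitz D L" "\<theta> \<in> index_space k" using clse by (auto simp: is_CLSE_def)
          have m0L: "m\<^sub>0 \<in> convex_lipschitz D L"
            using m\<^sub>0_convex lipschitz_on_le[OF L\<^sub>0(2) L] by (simp add: convex_lipschitz_def)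
          \<comment> \<open>For every L both members of \<open>g\<close> lie in the ball of radius
            \<open>B\<close>. In the basic inequality the squares carry L^2 and the noise term L, so
            one factor L remains on the left.\<close>
          define g where "g = index_diff \<X> (\<lambda>t. m t / L) \<theta> (\<lambda>t. m\<^sub>0 t / L) \<theta>\<^sub>0"
          have "(\<lambda>t. m t / L) \<in> convex_ball D B"
            using G.CLSE_bounded[OF clse n L\<^sub>0(1) L _ M\<^sub>0(2) \<theta>\<^sub>0 eK] Xin K
            by (intro lipschitz_scale_down[OF mL(1) Lp]) (simp add: B_def)
          moreover have "(\<lambda>t. m\<^sub>0 t / L) \<in> convex_ball D B"
          proof (rule lipschitz_scale_down[OF m0L Lp])
            fix t assume t: "t \<in> D"
            have "\<bar>m\<^sub>0 t / L\<bar> \<le> M\<^sub>0 / L\<^sub>0"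
              using M\<^sub>0(2)[OF t] M\<^sub>0(1) L L\<^sub>0(1) Lp by (simp add: abs_divide frac_le)
            also have "\<dots> \<le> B" using K L\<^sub>0 T0 by (simp add: B_def add_divide_distrib)
            finally show "\<bar>m\<^sub>0 t / L\<bar> \<le> B" .
          qed
          ultimately have g: "g \<in> G.\<G> B"
            unfolding g_def index_diffs_def using mL(2) \<theta>\<^sub>0 by blast
          have gx: "g x = (m (\<theta> \<bullet> x) - m\<^sub>0 (\<theta>\<^sub>0 \<bullet> x)) / L" if "x \<in> \<X>" for x
            using that by (simp add: g_def index_diff_def diff_divide_distrib)
          have g0: "g x = 0" if "x \<notin> \<X>" for x using that by (simp add: g_def index_diff_def)
          have "L * (\<Sum>i<n. (g (X i \<omega>))\<^sup>2) = (\<Sum>i<n. (m (\<theta> \<bullet> X i \<omega>) - m\<^sub>0 (\<theta>\<^sub>0 \<bullet> X i \<omega>))\<^sup>2) / L"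
            using Xin Lp by (simp add: gx power_divide sum_divide_distrib[symmetric] power2_eq_square)
          also have "\<dots> \<le> 2 * (\<Sum>i<n. (Y i \<omega> - m\<^sub>0 (\<theta>\<^sub>0 \<bullet> X i \<omega>)) * (m (\<theta> \<bullet> X i \<omega>) - m\<^sub>0 (\<theta>\<^sub>0 \<bullet> X i \<omega>))) / L"
            using CLSE_basic_inequality[OF clse n m0L \<theta>\<^sub>0] Lp by (intro divide_right_mono) auto
          also have "\<dots> = 2 * (\<Sum>i<n. e i \<omega> * g (X i \<omega>))"
            using Xin by (simp add: gx e sum_divide_distrib[symmetric])
          finally have r: "L * sqrt (R.sqnorm g) \<le> c * max (L * real n powr (- 2/5)) (sqrt L * real n powr (1/(2*q) - 1/2))"
            using main' g L by blast
          have "(LINT x:\<X>|P\<^sub>X. (m (\<theta> \<bullet> x) - m\<^sub>0 (\<theta>\<^sub>0 \<bullet> x))\<^sup>2) = (\<integral>x. L\<^sup>2 * (g x)\<^sup>2 \<partial>P\<^sub>X)"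
            unfolding set_lebesgue_integral_def
            using Lp by (intro Bochner_Integration.integral_cong) (auto simp: gx g0 indicator_def power_divide)
          then have "L2_norm_on P\<^sub>X \<X> (\<lambda>x. m (\<theta> \<bullet> x) - m\<^sub>0 (\<theta>\<^sub>0 \<bullet> x)) = L * sqrt (R.sqnorm g)"
            using Lp by (simp add: L2_norm_on_def R.sqnorm_def real_sqrt_mult)
          then have f: "?f \<omega> L = min (real n powr (2/5) / L) (real n powr (1/2 - 1/(2*q)) / sqrt L) * (L * sqrt (R.sqnorm g))"
            by (simp add: m_def \<theta>_def)
          define a where "a = L * real n powr (- 2/5)"
          define b where "b = sqrt L * real n powr (1/(2*q) - 1/2)"
          have ab: "0 < a" "0 < b" using n Lp by (simp_all add: a_def b_def)
          have "real n powr (2/5) / L = 1 / a"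
            using powr_minus[of "real n" "2/5"] by (simp add: a_def field_simps)
          moreover have "real n powr (1/2 - 1/(2*q)) / sqrt L = 1 / b"
          proof -
            define p where "p = 1/2 - 1/(2*q)"
            have "1/(2*q) - 1/2 = - p" by (simp add: p_def)
            then show ?thesis unfolding b_def p_def[symmetric] by (simp add: powr_minus_divide)
          qed
          ultimately have f': "?f \<omega> L = min (1 / a) (1 / b) * (L * sqrt (R.sqnorm g))" using f by simp
          have "?f \<omega> L \<le> min (1 / a) (1 / b) * (c * max a b)"
            unfolding f' using r[folded a_def b_def] ab by (intro mult_left_mono) auto
          also have "\<dots> = c * (min (1 / a) (1 / b) * max a b)" by simp
          also have "\<dots> \<le> c * 1" using min_inverse_mult_max_le[OF ab] c by (intro mult_left_mono) auto
          finally have "?f \<omega> L \<le> c" by simp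
          moreover have "0 \<le> ?f \<omega> L" unfolding f' using ab Lp by (simp add: R.sqnorm_nonneg)
          ultimately show ?thesis by simp
        qed
        have sup: "\<bar>SUP L\<in>{L\<^sub>0..real n * L\<^sub>0}. ereal (?f \<omega> L)\<bar> \<le> ereal ((c + 1) * sqrt (ln (ln (real n))))"
          if \<omega>: "\<omega> \<in> space M - A" "\<omega> \<in> space M - N" for \<omega>
        proof -
          have "L\<^sub>0 \<in> {L\<^sub>0..real n * L\<^sub>0}" using n L\<^sub>0 by simp
          then have "\<bar>SUP L\<in>{L\<^sub>0..real n * L\<^sub>0}. ereal (?f \<omega> L)\<bar> \<le> ereal c"
            using bound[OF \<omega>] by (intro bounded_random_SUP_le) auto
          \<comment> \<open>Eventually log log n is at least 1, so the constant bound implies the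
            claimed one; c + 1 replaces \<open>c\<close> because the constant must be
            positive.\<close>
          also have "c \<le> (c + 1) * sqrt (ln (ln (real n)))"
            using mult_mono[of c "c + 1" 1 "sqrt (ln (ln (real n)))"] lln c by simp
          finally show ?thesis by simp
        qed
        have "prob (A \<union> N) \<le> \<delta>"
          using measure_Un_null_set[OF A(1) N] A(2) by simp
        moreover have "A \<union> N \<in> events" using A(1) N by auto
        ultimately show ?case
          using sup by (intro bexI[of _ "A \<union> N"] conjI) (auto simp: not_less[symmetric])
      qed
    qed
  qed
qed

end
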